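(* Let $\mathcal{A}$ be a finite-dimensional $C^*$-algebra and let $\mathcal{K}$ be a finite-dimensional Hilbert space. Every OCP map $\varphi:\mathcal{A}\to\mathcal{B}(\mathcal{K})$ has a purification $(\mathcal{K},\mathcal{H},\pi,V)$ with $\mathcal{H}$ finite dimensional. Furthermore, given any such purification $(\mathcal{K},\mathcal{H},\pi,V)$ and any other purification $(\mathcal{K},\mathcal{I},\rho,W)$ of $\varphi$ with $\mathcal{I}$ finite dimensional and for which $(\mathcal{H},\pi)$ is unitarily equivalent to $(\mathcal{I},\rho)$, there exists a unitary intertwiner $U:\mathcal{H}\to\mathcal{I}$ (i.e. a unitary with $U\pi(a)=\rho(a)U$ for all $a\in\mathcal{A}$) such that $UV=W$.
   Context: All $C^*$-algebras and $^*$-homomorphisms are unital. $\mathcal{B}(\mathcal{K})$ is the algebra of bounded operators on $\mathcal{K}$. An OCP map $\varphi:\mathcal{A}\to\mathcal{B}(\mathcal{K})$ is a completely positive linear map (not necessarily unital). A purification of it is a quadruple $(\mathcal{K},\mathcal{H},\pi,V)$, where $\mathcal{H}$ is a Hilbert space, $\pi:\mathcal{A}\to\mathcal{B}(\mathcal{H})$ is a $^*$-homomorphism, and $V:\mathcal{K}\to\mathcal{H}$ is a bounded linear map such that $V^*\pi(a)V=\varphi(a)$ for all $a\in\mathcal{A}$. Representations $(\mathcal{H},\pi)$ and $(\mathcal{I},\rho)$ of $\mathcal{A}$ are unitarily equivalent if there is a unitary $S:\mathcal{H}\to\mathcal{I}$ with $S\pi(a)=\rho(a)S$ for all $a\in\mathcal{A}$.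 *)

theory Defs
  imports "HOL-Analysis.Abstract_Metric_Spaces" "HOL-Algebra.Module"
begin

text \<open>
  Vector spaces, Hilbert spaces and algebras are carrier-based, so that one can quantify
  existentially over Hilbert spaces of unknown dimension. A complex vector space is a
  \<^locale>\<open>module\<close> over the field of complex numbers. As usual for \<^type>\<open>module\<close> records, the
  multiplicative fields are ignored when the structure is only a vector space.
\<close>

definition complex_field :: "complex ring" where
  "complex_field = \<lparr>carrier = UNIV, monoid.mult = (*), one = 1, ring.zero = 0, add = (+)\<rparr>"

definition fin_dim :: "(complex, 'a, 'm) module_scheme \<Rightarrow> bool" where
  "fin_dim M \<longleftrightarrow> (\<exists>B. finite B \<and> B \<subseteq> carrier M \<and>
     (\<forall>v\<in>carrier M. \<exists>c. v = (\<Oplus>\<^bsub>M\<^esub>b\<in>B. c b \<odot>\<^bsub>M\<^esub> b)))"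

definition linear_map ::
  "(complex, 'a, 'm) module_scheme \<Rightarrow> (complex, 'b, 'n) module_scheme \<Rightarrow> ('a \<Rightarrow> 'b) \<Rightarrow> bool" where
  "linear_map M N f \<longleftrightarrow> f \<in> carrier M \<rightarrow> carrier N \<and>
     (\<forall>x\<in>carrier M. \<forall>y\<in>carrier M. f (x \<oplus>\<^bsub>M\<^esub> y) = f x \<oplus>\<^bsub>N\<^esub> f y) \<and>
     (\<forall>c. \<forall>x\<in>carrier M. f (c \<odot>\<^bsub>M\<^esub> x) = c \<odot>\<^bsub>N\<^esub> f x)"

text \<open>
  The norm is kept in a separate extension of the record, because positivity and
  *-homomorphisms only refer to the *-algebra structure.
\<close>

record 'a star_algebra = "(complex, 'a) module" +
  star :: "'a \<Rightarrow> 'a"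

record 'a cstar_algebra = "'a star_algebra" +
  cnorm :: "'a \<Rightarrow> real"

text \<open>The zero algebra (where \<open>\<one> = \<zero>\<close>) is not excluded.\<close>

locale cstar_algebra = ring A + module complex_field A
  for A :: "('a, 'm) cstar_algebra_scheme" (structure) +
  assumes smult_mult_left:
      "\<lbrakk>x \<in> carrier A; y \<in> carrier A\<rbrakk> \<Longrightarrow> (c \<odot> x) \<otimes> y = c \<odot> (x \<otimes> y)"
    and smult_mult_right:
      "\<lbrakk>x \<in> carrier A; y \<in> carrier A\<rbrakk> \<Longrightarrow> x \<otimes> (c \<odot> y) = c \<odot> (x \<otimes> y)"
    and star_closed: "x \<in> carrier A \<Longrightarrow> star A x \<in> carrier A"
    and star_star: "x \<in> carrier A \<Longrightarrow> star A (star A x) = x"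
    and star_add:
      "\<lbrakk>x \<in> carrier A; y \<in> carrier A\<rbrakk> \<Longrightarrow> star A (x \<oplus> y) = star A x \<oplus> star A y"
    and star_smult: "x \<in> carrier A \<Longrightarrow> star A (c \<odot> x) = cnj c \<odot> star A x"
    and star_mult:
      "\<lbrakk>x \<in> carrier A; y \<in> carrier A\<rbrakk> \<Longrightarrow> star A (x \<otimes> y) = star A y \<otimes> star A x"
    and cnorm_nonneg: "x \<in> carrier A \<Longrightarrow> 0 \<le> cnorm A x"
    and cnorm_eq_zero: "x \<in> carrier A \<Longrightarrow> cnorm A x = 0 \<longleftrightarrow> x = \<zero>"
    and cnorm_triangle:
      "\<lbrakk>x \<in> carrier A; y \<in> carrier A\<rbrakk> \<Longrightarrow> cnorm A (x \<oplus> y) \<le> cnorm A x + cnorm A y"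
    and cnorm_smult: "x \<in> carrier A \<Longrightarrow> cnorm A (c \<odot> x) = cmod c * cnorm A x"
    and cnorm_mult:
      "\<lbrakk>x \<in> carrier A; y \<in> carrier A\<rbrakk> \<Longrightarrow> cnorm A (x \<otimes> y) \<le> cnorm A x * cnorm A y"
    and cstar_identity: "x \<in> carrier A \<Longrightarrow> cnorm A (star A x \<otimes> x) = (cnorm A x)\<^sup>2"
    and mcomplete_norm: "Metric_space.mcomplete (carrier A) (\<lambda>x y. cnorm A (x \<ominus> y))"

definition star_hom ::
  "('a, 'm) star_algebra_scheme \<Rightarrow> ('b, 'n) star_algebra_scheme \<Rightarrow> ('a \<Rightarrow> 'b) \<Rightarrow> bool" where
  "star_hom A B f \<longleftrightarrow> f \<in> ring_hom A B \<and> linear_map A B f \<and>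
     (\<forall>x\<in>carrier A. f (star A x) = star B (f x))"

definition positive_element :: "('a, 'm) star_algebra_scheme \<Rightarrow> 'a \<Rightarrow> bool" where
  "positive_element A a \<longleftrightarrow> (\<exists>x\<in>carrier A. a = star A x \<otimes>\<^bsub>A\<^esub> x)"

text \<open>The *-algebra of \<open>n \<times> n\<close> matrices over a *-algebra.\<close>

definition matrix_algebra ::
  "nat \<Rightarrow> ('a, 'm) star_algebra_scheme \<Rightarrow> (nat \<times> nat \<Rightarrow> 'a) star_algebra" where
  "matrix_algebra n A =
    \<lparr>carrier = ({..<n} \<times> {..<n}) \<rightarrow>\<^sub>E carrier A,
     monoid.mult = (\<lambda>X Y. \<lambda>(i, j)\<in>{..<n} \<times> {..<n}. \<Oplus>\<^bsub>A\<^esub>k\<in>{..<n}. X (i, k) \<otimes>\<^bsub>A\<^esub> Y (k, j)),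
     one = (\<lambda>(i, j)\<in>{..<n} \<times> {..<n}. if i = j then \<one>\<^bsub>A\<^esub> else \<zero>\<^bsub>A\<^esub>),
     ring.zero = (\<lambda>_\<in>{..<n} \<times> {..<n}. \<zero>\<^bsub>A\<^esub>),
     add = (\<lambda>X Y. \<lambda>p\<in>{..<n} \<times> {..<n}. X p \<oplus>\<^bsub>A\<^esub> Y p),
     smult = (\<lambda>c X. \<lambda>p\<in>{..<n} \<times> {..<n}. c \<odot>\<^bsub>A\<^esub> X p),
     star = (\<lambda>X. \<lambda>(i, j)\<in>{..<n} \<times> {..<n}. star A (X (j, i)))\<rparr>"

definition completely_positive ::
  "('a, 'm) star_algebra_scheme \<Rightarrow> ('b, 'n) star_algebra_scheme \<Rightarrow> ('a \<Rightarrow> 'b) \<Rightarrow> bool" where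
  "completely_positive A B f \<longleftrightarrow>
     (\<forall>n. \<forall>X\<in>carrier (matrix_algebra n A). positive_element (matrix_algebra n A) X \<longrightarrow>
        positive_element (matrix_algebra n B) (\<lambda>p\<in>{..<n} \<times> {..<n}. f (X p)))"

record 'a inner_space = "(complex, 'a) module" +
  cinner :: "'a \<Rightarrow> 'a \<Rightarrow> complex"

definition hnorm :: "('a, 'm) inner_space_scheme \<Rightarrow> 'a \<Rightarrow> real" where
  "hnorm H x = sqrt (Re (cinner H x x))"

text \<open>Inner products are linear in the second argument.\<close>

locale hilbert_space = module complex_field H
  for H :: "('a, 'm) inner_space_scheme" (structure) +
  assumes cinner_add_right:
      "\<lbrakk>x \<in> carrier H; y \<in> carrier H; z \<in> carrier H\<rbrakk>
        \<Longrightarrow> cinner H x (y \<oplus> z) = cinner H x y + cinner H x z"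
    and cinner_smult_right:
      "\<lbrakk>x \<in> carrier H; y \<in> carrier H\<rbrakk> \<Longrightarrow> cinner H x (c \<odot> y) = c * cinner H x y"
    and cinner_commute:
      "\<lbrakk>x \<in> carrier H; y \<in> carrier H\<rbrakk> \<Longrightarrow> cinner H y x = cnj (cinner H x y)"
    and cinner_nonneg: "x \<in> carrier H \<Longrightarrow> 0 \<le> Re (cinner H x x)"
    and cinner_eq_zero: "x \<in> carrier H \<Longrightarrow> cinner H x x = 0 \<longleftrightarrow> x = \<zero>"
    and mcomplete_norm: "Metric_space.mcomplete (carrier H) (\<lambda>x y. hnorm H (x \<ominus> y))"

text \<open>
  Operators are extensional functions, so that equality of operators is equality of functions,
  and composition is \<^const>\<open>compose\<close>.
\<close>

definition bounded_ops ::
  "('a, 'm) inner_space_scheme \<Rightarrow> ('b, 'n) inner_space_scheme \<Rightarrow> ('a \<Rightarrow> 'b) set" where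
  "bounded_ops H I = {T \<in> carrier H \<rightarrow>\<^sub>E carrier I. linear_map H I T \<and>
     (\<exists>C. \<forall>x\<in>carrier H. hnorm I (T x) \<le> C * hnorm H x)}"

definition hadjoint ::
  "('a, 'm) inner_space_scheme \<Rightarrow> ('b, 'n) inner_space_scheme \<Rightarrow> ('a \<Rightarrow> 'b) \<Rightarrow> 'b \<Rightarrow> 'a" where
  "hadjoint H I T = (\<lambda>y\<in>carrier I. THE x. x \<in> carrier H \<and>
     (\<forall>z\<in>carrier H. cinner H x z = cinner I y (T z)))"

definition op_algebra :: "('a, 'm) inner_space_scheme \<Rightarrow> ('a \<Rightarrow> 'a) star_algebra" where
  "op_algebra H =
    \<lparr>carrier = bounded_ops H H,
     monoid.mult = compose (carrier H),
     one = (\<lambda>x\<in>carrier H. x),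
     ring.zero = (\<lambda>x\<in>carrier H. \<zero>\<^bsub>H\<^esub>),
     add = (\<lambda>S T. \<lambda>x\<in>carrier H. S x \<oplus>\<^bsub>H\<^esub> T x),
     smult = (\<lambda>c T. \<lambda>x\<in>carrier H. c \<odot>\<^bsub>H\<^esub> T x),
     star = hadjoint H H\<rparr>"

definition unitary_op ::
  "('a, 'm) inner_space_scheme \<Rightarrow> ('b, 'n) inner_space_scheme \<Rightarrow> ('a \<Rightarrow> 'b) \<Rightarrow> bool" where
  "unitary_op H I U \<longleftrightarrow> U \<in> bounded_ops H I \<and>
     compose (carrier H) (hadjoint H I U) U = (\<lambda>x\<in>carrier H. x) \<and>
     compose (carrier I) U (hadjoint H I U) = (\<lambda>y\<in>carrier I. y)"

definition intertwines ::
  "('a, 'm) star_algebra_scheme \<Rightarrow> ('h, 'n) inner_space_scheme \<Rightarrow> ('a \<Rightarrow> 'h \<Rightarrow> 'h) \<Rightarrow>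
   ('i, 'o) inner_space_scheme \<Rightarrow> ('a \<Rightarrow> 'i \<Rightarrow> 'i) \<Rightarrow> ('h \<Rightarrow> 'i) \<Rightarrow> bool" where
  "intertwines A H \<pi> I \<rho> S \<longleftrightarrow>
     (\<forall>a\<in>carrier A. compose (carrier H) S (\<pi> a) = compose (carrier H) (\<rho> a) S)"

definition unitarily_equivalent ::
  "('a, 'm) star_algebra_scheme \<Rightarrow> ('h, 'n) inner_space_scheme \<Rightarrow> ('a \<Rightarrow> 'h \<Rightarrow> 'h) \<Rightarrow>
   ('i, 'o) inner_space_scheme \<Rightarrow> ('a \<Rightarrow> 'i \<Rightarrow> 'i) \<Rightarrow> bool" where
  "unitarily_equivalent A H \<pi> I \<rho> \<longleftrightarrow> (\<exists>S. unitary_op H I S \<and> intertwines A H \<pi> I \<rho> S)"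

definition ocp_map ::
  "('a, 'm) star_algebra_scheme \<Rightarrow> ('k, 'n) inner_space_scheme \<Rightarrow> ('a \<Rightarrow> 'k \<Rightarrow> 'k) \<Rightarrow> bool" where
  "ocp_map A K \<phi> \<longleftrightarrow> linear_map A (op_algebra K) \<phi> \<and> completely_positive A (op_algebra K) \<phi>"

definition purification ::
  "('a, 'm) star_algebra_scheme \<Rightarrow> ('k, 'n) inner_space_scheme \<Rightarrow> ('a \<Rightarrow> 'k \<Rightarrow> 'k) \<Rightarrow>
   ('h, 'o) inner_space_scheme \<Rightarrow> ('a \<Rightarrow> 'h \<Rightarrow> 'h) \<Rightarrow> ('k \<Rightarrow> 'h) \<Rightarrow> bool" where
  "purification A K \<phi> H \<pi> V \<longleftrightarrow>
     hilbert_space H \<and> star_hom A (op_algebra H) \<pi> \<and> V \<in> bounded_ops K H \<and>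
     (\<forall>a\<in>carrier A.
        compose (carrier K) (hadjoint K H V) (compose (carrier K) (\<pi> a) V) = \<phi> a)"

end

theory Submission
  imports Defs "HOL-Computational_Algebra.Fundamental_Theorem_Algebra" "HOL-Analysis.L2_Norm"
begin

text \<open>
  Existence is Stinespring's dilation in reproducing-kernel form: complete positivity says that
  \<open>k((a, y), (b, z)) = \<langle>y, \<phi>(a\<^sup>* b) z\<rangle>\<close> is a positive kernel on \<open>A \<times> K\<close>. Restricting it to a finite
  family spanning \<open>A \<otimes> K\<close> realises the quotient of \<open>A \<otimes> K\<close> by the null space as the range of a Gram
  matrix, on which \<open>A\<close> acts by left multiplication.

  For uniqueness, pulling back along the given unitary equivalence makes both representations equal in
  suitable orthonormal bases. The vectors \<open>\<pi>(a)V y\<close> and \<open>\<rho>(a)W y\<close> have the same Gram matrix, so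
  \<open>\<pi>(a)V y \<mapsto> \<rho>(a)W y\<close> defines a partial isometry in the commutant, and in finite dimension it extends
  to a unitary of the commutant.
\<close>

section \<open>Unitaries with prescribed values in algebraic star-algebras\<close>

text \<open>A purification need not be minimal: fixing a map on the vectors
  \<open>\<pi>(a)V y\<close> leaves two orthogonal complements, which are subrepresentations that
  still have to be matched. Counting multiplicities would need the structure theory of
  \<open>A\<close>. Instead the matching is produced from the partial isometry by sums, products,
  adjoints, one inverse and polynomials, so it commutes with whatever the partial isometry and its
  adjoint commute with.

  The class isolates what this argument consumes. \<open>adj_sum_eq_0\<close> stands in for
  positivity of the inner product, and norm estimates become identities between sums of squares.
  \<open>algebraic_coeffs\<close> stands in for finite dimension: it makes spectra finite and
  injective elements invertible, and it turns functional calculus into polynomial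
  interpolation.\<close>

class algebraic_star_algebra = ring_1 +
  fixes adj :: "'a \<Rightarrow> 'a" and scal :: "complex \<Rightarrow> 'a"
  assumes scal_add: "scal (c + d) = scal c + scal d"
    and scal_mult: "scal (c * d) = scal c * scal d"
    and scal_1: "scal 1 = 1"
    and scal_commute: "scal c * x = x * scal c"
    and adj_adj [simp]: "adj (adj x) = x"
    and adj_add: "adj (x + y) = adj x + adj y"
    and adj_mult: "adj (x * y) = adj y * adj x"
    and adj_scal: "adj (scal c) = scal (cnj c)"
    and adj_sum_eq_0: "adj x * x + adj y * y = 0 \<Longrightarrow> x = 0"
    and algebraic_coeffs: "\<exists>n c. (\<exists>i\<le>n. c i \<noteq> 0) \<and> (\<Sum>i\<le>n. scal (c i) * x ^ i) = 0"
begin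

lemma scal_0 [simp]: "scal 0 = 0"
  using scal_add[of 0 0] by simp

lemma scal_minus: "scal (- c) = - scal c"
proof -
  have "scal (- c) + scal c = 0"
    by (simp flip: scal_add)
  then show ?thesis by (rule eq_neg_iff_add_eq_0[THEN iffD2])
qed

lemma scal_diff: "scal (c - d) = scal c - scal d"
  using scal_add[of c "- d"] by (simp add: scal_minus)

lemma scal_eq_0_cancel: "c \<noteq> 0 \<Longrightarrow> scal c * x = 0 \<Longrightarrow> x = 0"
  by (metis mult.assoc mult_1_left mult_zero_right scal_1 scal_mult left_inverse)

lemma scal_left_commute: "x * (scal c * y) = scal c * (x * y)"
  by (metis mult.assoc scal_commute)

lemma adj_0 [simp]: "adj 0 = 0"
  using adj_add[of 0 0] by simp

lemma adj_1 [simp]: "adj 1 = 1"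
  using adj_scal[of 1] by (simp add: scal_1)

lemma adj_minus: "adj (- x) = - adj x"
proof -
  have "adj (- x) + adj x = 0"
    by (simp flip: adj_add)
  then show ?thesis by (rule eq_neg_iff_add_eq_0[THEN iffD2])
qed

lemma adj_diff: "adj (x - y) = adj x - adj y"
  using adj_add[of x "- y"] by (simp add: adj_minus)

lemma adj_mult_eq_0: "adj x * x = 0 \<Longrightarrow> x = 0"
  using adj_sum_eq_0[of x 0] by simp

text \<open>Multiplying the hypothesis by \<open>adj y\<close> on the left gives
  \<open>adj (x * y) * (x * y) = 0\<close>. This is the algebraic form of the fact that
  \<open>adj x * x\<close> and \<open>x\<close> have the same kernel.\<close>

lemma adj_mult_cancel: "adj x * (x * y) = 0 \<Longrightarrow> x * y = 0"
  by (rule adj_mult_eq_0) (simp add: adj_mult mult.assoc)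

section \<open>Polynomials in one element of the algebra\<close>

text \<open>Horner's scheme. Coefficients are complex numbers while the argument lies in a
  noncommutative ring; they enter through the central \<open>scal\<close>, which is why evaluation
  remains multiplicative.\<close>

definition evalp :: "complex poly \<Rightarrow> 'a \<Rightarrow> 'a" where
  "evalp p x = fold_coeffs (\<lambda>a y. scal a + x * y) p 0"

lemma evalp_0 [simp]: "evalp 0 x = 0"
  by (simp add: evalp_def)

lemma evalp_pCons [simp]: "evalp (pCons a p) x = scal a + x * evalp p x"
  by (cases "p = 0 \<and> a = 0") (auto simp: evalp_def)

lemma evalp_add: "evalp (p + q) x = evalp p x + evalp q x"
  by (induction p q rule: poly_induct2) (simp_all add: algebra_simps scal_add)

lemma evalp_smult: "evalp (smult c p) x = scal c * evalp p x"
  by (induction p) (simp_all add: distrib_left scal_mult scal_left_commute)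

lemma evalp_mult: "evalp (p * q) x = evalp p x * evalp q x"
  by (induction p) (simp_all add: algebra_simps evalp_add evalp_smult)

lemma evalp_diff: "evalp (p - q) x = evalp p x - evalp q x"
  using evalp_add[of "p - q" q x] by (simp add: algebra_simps)

lemma evalp_monom: "evalp (monom c n) x = scal c * x ^ n"
  by (induction n) (simp_all add: monom_0 monom_Suc scal_left_commute)

lemma evalp_sum: "evalp (sum f S) x = (\<Sum>i\<in>S. evalp (f i) x)"
  by (induction S rule: infinite_finite_induct) (simp_all add: evalp_add)

lemma evalp_commute: "x * y = y * x \<Longrightarrow> evalp p x * y = y * evalp p x"
proof (induction p)
  case (pCons a p)
  then show ?case
    by (simp add: distrib_left distrib_right scal_commute) (metis mult.assoc)
qed simp

lemma evalp_eigen: "x * y = scal c * y \<Longrightarrow> evalp p x * y = scal (poly p c) * y"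
proof (induction p)
  case (pCons a p)
  then show ?case
    by (simp add: distrib_right scal_add scal_mult mult.assoc)
      (metis mult.assoc scal_commute)
qed simp

lemma adj_evalp: "adj (evalp p x) = evalp (map_poly cnj p) (adj x)"
proof (induction p)
  case (pCons a p)
  have "evalp (map_poly cnj p) y * y = y * evalp (map_poly cnj p) y" for y
    by (rule evalp_commute) simp
  with pCons show ?case
    by (simp add: map_poly_pCons adj_add adj_mult adj_scal)
qed simp

lemma algebraic: "\<exists>p. p \<noteq> 0 \<and> evalp p x = 0"
proof -
  obtain n c i where c: "i \<le> n" "c i \<noteq> 0" "(\<Sum>i\<le>n. scal (c i) * x ^ i) = 0"
    using algebraic_coeffs by metis
  let ?p = "\<Sum>i\<le>n. monom (c i) i"
  have "coeff ?p i = c i"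
    using c(1) by (simp add: coeff_sum sum.delta)
  with c show ?thesis
    by (intro exI[of _ ?p]) (auto simp: evalp_sum evalp_monom)
qed

text \<open>Injectivity strips factors of \<open>x\<close> from an annihilating polynomial until its
  constant term \<open>a\<close> is nonzero. Then \<open>x * evalp p x = - scal a\<close> exhibits
  the inverse as a polynomial in \<open>x\<close>, hence a two-sided one.\<close>

lemma invertible_if_injective:
  assumes "\<And>y. x * y = 0 \<Longrightarrow> y = 0"
  shows "\<exists>z. x * z = 1 \<and> z * x = 1"
proof -
  have "p \<noteq> 0 \<Longrightarrow> evalp p x = 0 \<Longrightarrow> ?thesis" for p
  proof (induction p)
    case (pCons a p)
    show ?case
    proof (cases "a = 0")
      case True
      then show ?thesis using pCons assms by auto
    next
      case False
      define z where "z = scal (- inverse a) * evalp p x"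
      have e: "x * evalp p x = - scal a"
        using pCons.prems by (simp add: add_eq_0_iff)
      have "x * z = scal (- inverse a) * (x * evalp p x)"
        by (simp add: z_def scal_left_commute)
      also have "\<dots> = scal (inverse a * a)"
        by (simp add: e scal_minus scal_mult)
      finally have xz: "x * z = 1" using False by (simp add: scal_1)
      have "x * evalp p x = evalp p x * x" by (rule evalp_commute[symmetric]) simp
      then have "z * x = x * z"
        unfolding z_def scal_left_commute mult.assoc by simp
      with xz show ?thesis by auto
    qed
  qed simp
  moreover obtain p where "p \<noteq> 0" "evalp p x = 0" using algebraic by blast
  ultimately show ?thesis by blast
qed

section \<open>Eigenvalues of hermitian elements\<close>

text \<open>Eigenvalues of left multiplication by \<open>x\<close>: the eigenvector is itself an
  element of the algebra, for matrices a whole array of columns, so no space of vectors has to be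
  introduced.\<close>

definition eigenvals :: "'a \<Rightarrow> complex set" where
  "eigenvals x = {c. \<exists>y. y \<noteq> 0 \<and> x * y = scal c * y}"

lemma eigenvals_root:
  assumes "evalp p x = 0" and "c \<in> eigenvals x"
  shows "poly p c = 0"
proof -
  obtain y where y: "y \<noteq> 0" "x * y = scal c * y"
    using assms(2) by (auto simp: eigenvals_def)
  then have "scal (poly p c) * y = 0"
    using evalp_eigen[of x y c p] assms(1) by simp
  with y(1) show ?thesis using scal_eq_0_cancel by blast
qed

lemma finite_eigenvals: "finite (eigenvals x)"
proof -
  obtain p where p: "p \<noteq> 0" "evalp p x = 0" using algebraic by blast
  have "eigenvals x \<subseteq> {c. poly p c = 0}" using eigenvals_root p(2) by blast
  with poly_roots_finite[OF p(1)] show ?thesis by (rule finite_subset[rotated])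
qed

lemma eigenvals_cancel:
  assumes "c \<notin> eigenvals x" and "(x - scal c) * y = 0"
  shows "y = 0"
  using assms by (auto simp: eigenvals_def left_diff_distrib)

lemma eigenvals_hermitian_real:
  assumes "adj x = x" and "c \<in> eigenvals x"
  shows "cnj c = c"
proof (rule ccontr)
  assume ne: "cnj c \<noteq> c"
  obtain y where y: "y \<noteq> 0" "x * y = scal c * y"
    using assms(2) by (auto simp: eigenvals_def)
  have *: "adj y * (x * y) = scal c * (adj y * y)"
    by (simp add: y(2) scal_left_commute)
  have "adj (adj y * (x * y)) = scal (cnj c) * (adj y * y)"
    by (simp add: * adj_mult adj_scal flip: scal_commute)
  moreover have "adj (adj y * (x * y)) = adj y * (x * y)"
    by (simp add: adj_mult assms(1) mult.assoc)
  ultimately have "scal (cnj c - c) * (adj y * y) = 0"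
    using * by (simp add: scal_diff left_diff_distrib)
  then have "adj y * y = 0" using ne scal_eq_0_cancel[of "cnj c - c"] by simp
  with y(1) show False using adj_mult_eq_0 by blast
qed

text \<open>For negative \<open>c\<close> the squares of \<open>sqrt (- c) * y\<close> and of
  \<open>x * y\<close> add up to 0, which forces \<open>y = 0\<close>. Here
  \<open>adj_sum_eq_0\<close> is needed with two summands.\<close>

lemma eigenvals_adj_mult_nonneg:
  assumes "c \<in> eigenvals (adj x * x)"
  shows "0 \<le> Re c"
proof (rule ccontr)
  assume neg: "\<not> 0 \<le> Re c"
  have "cnj c = c"
    by (rule eigenvals_hermitian_real[OF _ assms]) (simp add: adj_mult)
  then have re: "complex_of_real (sqrt (- Re c)) * complex_of_real (sqrt (- Re c)) = - c"
    using neg by (simp add: complex_eq_iff)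
  obtain y where y: "y \<noteq> 0" "adj x * x * y = scal c * y"
    using assms by (auto simp: eigenvals_def)
  let ?s = "scal (complex_of_real (sqrt (- Re c)))"
  have "adj (?s * y) * (?s * y) = adj y * (?s * ?s * y)"
    by (simp add: adj_mult adj_scal mult.assoc)
  also have "?s * ?s = - scal c"
    unfolding scal_mult[symmetric] re by (rule scal_minus)
  finally have "adj (?s * y) * (?s * y) + adj (x * y) * (x * y) = 0"
    using y(2) by (simp add: adj_mult mult.assoc)
  then have "?s * y = 0" by (rule adj_sum_eq_0)
  then have "y = 0" using neg by (intro scal_eq_0_cancel[of _ y]) auto
  with y(1) show False by simp
qed

text \<open>An annihilating polynomial is consumed root by root: a root that is no eigenvalue
  cancels, a repeated eigenvalue loses a factor by \<open>adj_mult_cancel\<close>, and a simple one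
  is divided out of \<open>p\<close> as well. In effect a hermitian element is
  diagonalizable.\<close>

lemma evalp_eq_0_hermitian:
  assumes "adj x = x" and "\<And>c. c \<in> eigenvals x \<Longrightarrow> poly p c = 0"
  shows "evalp p x = 0"
proof -
  \<comment> \<open>Stated for an annihilator of an arbitrary \<open>y\<close>, so that a factor
    split off from both \<open>q\<close> and \<open>p\<close> can be absorbed into \<open>y\<close>
    before the induction hypothesis is applied.\<close>
  have aux: "q \<noteq> 0 \<Longrightarrow> evalp q x * y = 0 \<Longrightarrow>
      (\<forall>c\<in>eigenvals x. poly q c = 0 \<longrightarrow> poly p c = 0) \<Longrightarrow> evalp p x * y = 0" for p q y
  proof (induction "degree q" arbitrary: q p y)
    case 0
    then obtain a where a: "q = [:a:]" "a \<noteq> 0" by (metis degree_eq_zeroE pCons_0_0)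
    with 0 have "y = 0" using scal_eq_0_cancel[of a y] by simp
    then show ?case by simp
  next
    case (Suc n)
    obtain z where z: "poly q z = 0"
      using fundamental_theorem_of_algebra[of q] Suc.hyps(2)
      by (metis Zero_not_Suc constant_degree)
    then obtain q' where q': "q = [:- z, 1:] * q'"
      by (metis dvdE poly_eq_0_iff_dvd)
    have q'0: "q' \<noteq> 0" using q' Suc.prems(1) by auto
    have deg: "n = degree q'"
      using Suc.hyps(2) q'0 degree_mult_eq[of "[:- z, 1:]" q'] unfolding q' by simp
    have lin: "evalp [:- z, 1:] x = x - scal z"
      by (simp add: scal_minus scal_1)
    have kill: "(x - scal z) * (evalp q' x * y) = 0"
      using Suc.prems(2) unfolding q' evalp_mult lin by (simp add: mult.assoc)
    have reduce: "evalp p x * y = 0" if "evalp q' x * y = 0"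
      using Suc.hyps(1)[OF deg q'0 that] Suc.prems(3) by (auto simp: q')
    show ?case
    proof (cases "z \<in> eigenvals x")
      case False
      then show ?thesis using eigenvals_cancel[OF False kill] reduce by blast
    next
      case True
      \<comment> \<open>The eigenvalue is real, so the linear factor is hermitian and
        \<open>adj_mult_cancel\<close> can reduce its square to its first power.\<close>
      then have adjz: "adj (x - scal z) = x - scal z"
        using eigenvals_hermitian_real[OF assms(1)] assms(1) by (simp add: adj_diff adj_scal)
      show ?thesis
      proof (cases "poly q' z = 0")
        case True
        then obtain q'' where q'': "q' = [:- z, 1:] * q''"
          by (metis dvdE poly_eq_0_iff_dvd)
        let ?w = "evalp q'' x * y"
        have "adj (x - scal z) * ((x - scal z) * ?w) = 0"
          using kill unfolding q'' evalp_mult lin adjz by (simp add: mult.assoc)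
        then have "(x - scal z) * ?w = 0" by (rule adj_mult_cancel)
        then have "evalp q' x * y = 0"
          unfolding q'' evalp_mult lin by (simp add: mult.assoc)
        then show ?thesis by (rule reduce)
      next
        case False
        have "poly p z = 0" using Suc.prems(3) True z by blast
        then obtain p' where p': "p = [:- z, 1:] * p'"
          by (metis dvdE poly_eq_0_iff_dvd)
        have comm: "evalp r x * (x - scal z) = (x - scal z) * evalp r x" for r
          by (rule evalp_commute) (simp add: algebra_simps scal_commute)
        have "evalp q' x * ((x - scal z) * y) = 0"
          using kill by (metis comm mult.assoc)
        moreover have "\<forall>c\<in>eigenvals x. poly q' c = 0 \<longrightarrow> poly p' c = 0"
        proof (intro ballI impI)
          fix c assume c: "c \<in> eigenvals x" "poly q' c = 0"
          then have "poly p c = 0" "c \<noteq> z" using Suc.prems(3) False by (auto simp: q')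
          then show "poly p' c = 0" by (simp add: p')
        qed
        ultimately have "evalp p' x * ((x - scal z) * y) = 0"
          using Suc.hyps(1)[OF deg q'0] by blast
        then show ?thesis
          unfolding p' evalp_mult lin by (metis comm mult.assoc)
      qed
    qed
  qed
  obtain q where "q \<noteq> 0" "evalp q x = 0" using algebraic by blast
  then show ?thesis using aux[of q 1 p] assms(2) by simp
qed

lemma evalp_eq_hermitian:
  assumes "adj x = x" and "\<And>c. c \<in> eigenvals x \<Longrightarrow> poly p c = poly q c"
  shows "evalp p x = evalp q x"
  using evalp_eq_0_hermitian[OF assms(1), of "p - q"] assms(2) by (simp add: evalp_diff)

end

section \<open>Functional calculus by interpolation\<close>

lemma poly_interpolation:
  fixes f :: "'b::field \<Rightarrow> 'b"
  assumes "finite S"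
  shows "\<exists>p. \<forall>c\<in>S. poly p c = f c"
  using assms
proof (induction S)
  case (insert a S)
  then obtain p where p: "\<forall>c\<in>S. poly p c = f c" by blast
  \<comment> \<open>Newton's scheme: \<open>r\<close> vanishes on the old nodes, so adding a
    multiple of it corrects the value at \<open>a\<close> alone.\<close>
  define r where "r = (\<Prod>c\<in>S. [:- c, 1:])"
  have r: "poly r a \<noteq> 0" "\<And>c. c \<in> S \<Longrightarrow> poly r c = 0"
    using insert.hyps by (auto simp: r_def poly_prod prod_zero_iff)
  show ?case
    using p r by (intro exI[of _ "p + smult ((f a - poly p a) / poly r a) r"]) auto
qed simp

context algebraic_star_algebra
begin

text \<open>The witness is \<open>evalp r x\<close>, where \<open>r\<close> interpolates
  \<open>f\<close> on the finitely many eigenvalues. These are real, so a real function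
  \<open>f\<close> suffices and yields a hermitian element. The conclusion hides \<open>r\<close>
  and keeps commutation, the action on fixed elements, and the transfer of identities
  \<open>p * f ^ k = q\<close> from the eigenvalues to the algebra.\<close>

lemma functional_calculus:
  assumes "adj x = x"
  shows "\<exists>y. adj y = y \<and> (\<forall>z. x * z = z * x \<longrightarrow> y * z = z * y) \<and>
    (\<forall>z. x * z = z \<longrightarrow> y * z = scal (complex_of_real (f 1)) * z) \<and>
    (\<forall>p q. (\<forall>c\<in>eigenvals x. poly p c * complex_of_real (f (Re c)) ^ k = poly q c) \<longrightarrow>
       evalp p x * y ^ k = evalp q x)"
proof -
  obtain r where r: "\<forall>c\<in>eigenvals x. poly r c = complex_of_real (f (Re c))"
    using poly_interpolation[OF finite_eigenvals, of x "\<lambda>c. complex_of_real (f (Re c))"] by blast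
  have cnj_poly: "poly (map_poly cnj p) (cnj c) = cnj (poly p c)" for p c
    by (induction p) (simp_all add: map_poly_pCons)
  have pow: "evalp r x ^ k = evalp (r ^ k) x" for k
    by (induction k) (simp_all add: evalp_mult scal_1 one_pCons)
  have "adj (evalp r x) = evalp (map_poly cnj r) x"
    by (simp add: adj_evalp assms)
  also have "\<dots> = evalp r x"
  proof (rule evalp_eq_hermitian[OF assms])
    fix c assume c: "c \<in> eigenvals x"
    then have "cnj c = c" using eigenvals_hermitian_real assms by blast
    then show "poly (map_poly cnj r) c = poly r c"
      using cnj_poly[of r c] r c by simp
  qed
  finally have "adj (evalp r x) = evalp r x" .
  moreover have "evalp r x * z = z * evalp r x" if "x * z = z * x" for z
    using that by (rule evalp_commute)
  moreover have "evalp r x * z = scal (complex_of_real (f 1)) * z" if "x * z = z" for z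
  proof (cases "z = 0")
    case False
    with that have "1 \<in> eigenvals x" by (auto simp: eigenvals_def scal_1)
    with r evalp_eigen[of x z 1 r] that show ?thesis by (simp add: scal_1)
  qed simp
  moreover have "evalp p x * evalp r x ^ k = evalp q x"
    if "\<forall>c\<in>eigenvals x. poly p c * complex_of_real (f (Re c)) ^ k = poly q c" for p q
    unfolding pow evalp_mult[symmetric]
    by (rule evalp_eq_hermitian[OF assms]) (use that r in auto)
  ultimately show ?thesis by blast
qed

lemma pseudo_inverse:
  assumes "adj x = x"
  shows "\<exists>y. adj y = y \<and> x * y = y * x \<and> x * y * x = x"
proof -
  obtain y where y: "adj y = y" "\<forall>z. x * z = z * x \<longrightarrow> y * z = z * y"
    "\<forall>p q. (\<forall>c\<in>eigenvals x. poly p c * complex_of_real (inverse (Re c)) ^ 1 = poly q c) \<longrightarrow>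
       evalp p x * y ^ 1 = evalp q x"
    using functional_calculus[OF assms, of inverse 1] by metis
  have xy: "x * y = y * x" using y(2) by metis
  \<comment> \<open>Transfers \<open>t * t * inverse t = t\<close>, which survives at the eigenvalue
    0 because \<open>inverse 0 = 0\<close>.\<close>
  have "evalp [:0, 0, 1:] x * y ^ 1 = evalp [:0, 1:] x"
  proof (rule y(3)[rule_format])
    fix c assume "c \<in> eigenvals x"
    then have "complex_of_real (Re c) = c"
      using eigenvals_hermitian_real[OF assms] by (simp add: complex_eq_iff)
    then show "poly [:0, 0, 1:] c * complex_of_real (inverse (Re c)) ^ 1 = poly [:0, 1:] c"
      by (cases "c = 0") (simp_all add: of_real_inverse)
  qed
  then have "x * x * y = x" by (simp add: scal_1 mult.assoc)
  with xy y(1) show ?thesis by (metis mult.assoc)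
qed

text \<open>This is the positive factor of a polar decomposition: \<open>x * y\<close> becomes
  isometric. Injectivity removes the eigenvalue 0 of \<open>adj x * x\<close>, so that the inverse
  square root makes sense; the clause on fixed elements preserves prescribed values when
  \<open>x\<close> is replaced by \<open>x * y\<close>.\<close>

lemma inverse_sqrt:
  assumes inj: "\<And>y. x * y = 0 \<Longrightarrow> y = 0"
  shows "\<exists>y. adj y = y \<and> (\<forall>z. adj x * x * z = z * (adj x * x) \<longrightarrow> y * z = z * y) \<and>
    (\<forall>z. adj x * x * z = z \<longrightarrow> y * z = z) \<and> adj x * x * y ^ 2 = 1"
proof -
  let ?r = "adj x * x"
  have herm: "adj ?r = ?r" by (simp add: adj_mult)
  obtain y where y: "adj y = y" "\<forall>z. ?r * z = z * ?r \<longrightarrow> y * z = z * y"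
    "\<forall>z. ?r * z = z \<longrightarrow> y * z = scal (complex_of_real (inverse (sqrt 1))) * z"
    "\<forall>p q. (\<forall>c\<in>eigenvals ?r. poly p c * complex_of_real (inverse (sqrt (Re c))) ^ 2 = poly q c) \<longrightarrow>
       evalp p ?r * y ^ 2 = evalp q ?r"
    using functional_calculus[OF herm, of "\<lambda>t. inverse (sqrt t)" 2] by metis
  have "evalp [:0, 1:] ?r * y ^ 2 = evalp 1 ?r"
  proof (rule y(4)[rule_format])
    fix c assume c: "c \<in> eigenvals ?r"
    have "z = 0" if "?r * z = 0" for z
      using that inj adj_mult_cancel[of x z] by (simp add: mult.assoc)
    then have "0 \<notin> eigenvals ?r" by (auto simp: eigenvals_def)
    moreover have "complex_of_real (Re c) = c"
      using eigenvals_hermitian_real[OF herm c] by (simp add: complex_eq_iff)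
    ultimately have c': "complex_of_real (Re c) = c" "Re c > 0"
      using c eigenvals_adj_mult_nonneg[OF c] by (metis, metis less_eq_real_def of_real_0)
    then have "complex_of_real (inverse (sqrt (Re c))) ^ 2 = inverse c"
      by (metis less_imp_le of_real_inverse of_real_power power_inverse real_sqrt_pow2)
    moreover have "c \<noteq> 0" using c'(2) by auto
    ultimately show "poly [:0, 1:] c * complex_of_real (inverse (sqrt (Re c))) ^ 2 = poly 1 c"
      by auto
  qed
  then have "?r * y ^ 2 = 1" by (simp add: scal_1 one_pCons)
  with y(1-3) show ?thesis by (auto simp: scal_1)
qed


section \<open>Intertwining unitaries from equal Gram matrices\<close>

text \<open>With a pseudo-inverse \<open>G\<close> of the common Gram matrix \<open>R\<close>, the
  element \<open>Y * G * adj X\<close> is the partial isometry from the column space of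
  \<open>X\<close> to that of \<open>Y\<close>. It commutes with \<open>p\<close> because the same
  \<open>m\<close> describes \<open>p\<close> on the columns of \<open>X\<close> and of
  \<open>Y\<close>; closure of \<open>PP\<close> under \<open>adj\<close> supplies the action of
  \<open>p\<close> on the rows of \<open>adj X\<close>.\<close>

lemma partial_isometry_of_gram:
  assumes gram: "adj X * X = adj Y * Y"
    and PP: "\<And>p. p \<in> PP \<Longrightarrow> adj p \<in> PP \<and> (\<exists>m. p * X = X * m \<and> p * Y = Y * m)"
  shows "\<exists>u. u * X = Y \<and> adj u * Y = X \<and> u * adj u * u = u \<and> (\<forall>p\<in>PP. u * p = p * u)"
proof -
  define R where "R = adj X * X"
  have R: "adj R = R" by (simp add: R_def adj_mult)
  obtain G where G: "adj G = G" "R * G = G * R" "R * G * R = R"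
    using pseudo_inverse[OF R] by blast
  have RY: "adj Y * Y = R" using gram R_def by simp
  \<comment> \<open>\<open>G * R\<close> projects along the kernel of \<open>R\<close>, which is
    also the kernel of \<open>Z\<close>. The defect \<open>d\<close> has the form \<open>Z\<close>
    times something and is orthogonal to \<open>Z\<close>, so it vanishes.\<close>
  have absorb: "Z * G * R = Z" if "adj Z * Z = R" for Z
  proof -
    define d where "d = Z * G * R - Z"
    have "adj d * Z = R * G * (adj Z * Z) - adj Z * Z"
      unfolding d_def adj_diff adj_mult G(1) R left_diff_distrib by (simp add: mult.assoc)
    then have "adj d * Z = 0" by (simp add: that G(3))
    moreover have "d = Z * (G * R - 1)" by (simp add: d_def right_diff_distrib mult.assoc)
    ultimately have "adj d * d = 0" by (metis mult.assoc mult_zero_left)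
    then have "d = 0" by (rule adj_mult_eq_0)
    then show ?thesis by (simp add: d_def)
  qed
  \<comment> \<open>\<open>R\<close> and any \<open>Z\<close> with Gram matrix \<open>R\<close> have
    the same kernel, so both outer factors of \<open>R * D * R\<close> can be traded for such
    elements; the right one is reached by passing to adjoints.\<close>
  have cancel: "Z1 * D * adj Z2 = 0"
    if "R * D * R = 0" "adj Z1 * Z1 = R" "adj Z2 * Z2 = R" for D Z1 Z2
  proof -
    have "adj Z1 * (Z1 * (D * R)) = 0" using that by (simp add: mult.assoc[symmetric])
    then have "Z1 * (D * R) = 0" by (rule adj_mult_cancel)
    then have "adj (Z1 * (D * R)) = 0" by simp
    then have "R * (adj D * adj Z1) = 0" by (simp add: adj_mult R mult.assoc)
    then have "adj Z2 * (Z2 * (adj D * adj Z1)) = 0"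
      using that by (simp add: mult.assoc[symmetric])
    then have "Z2 * (adj D * adj Z1) = 0" by (rule adj_mult_cancel)
    then have "adj (Z2 * (adj D * adj Z1)) = 0" by simp
    then show ?thesis by (simp add: adj_mult mult.assoc)
  qed
  define u where "u = Y * G * adj X"
  have adju: "adj u = X * G * adj Y" by (simp add: u_def adj_mult G mult.assoc)
  have uX: "u * X = Y"
    using absorb[OF RY] by (simp add: u_def R_def mult.assoc)
  have uY: "adj u * Y = X"
    using absorb[OF R_def[symmetric]] RY by (simp add: adju mult.assoc)
  have uuu: "u * adj u * u = u"
    using uX uY by (metis mult.assoc u_def)
  have "u * p = p * u" if p: "p \<in> PP" for p
  proof -
    obtain m where m: "p * X = X * m" "p * Y = Y * m" using PP[OF p] by blast
    obtain m' where m': "adj p * X = X * m'" using PP[of "adj p"] PP[OF p] by blast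
    have Xp: "adj X * p = adj m' * adj X"
      using arg_cong[OF m', of adj] by (simp add: adj_mult)
    have Rm: "R * m = adj m' * R"
      unfolding R_def by (metis Xp m(1) mult.assoc)
    \<comment> \<open>\<open>G * adj m'\<close> and \<open>m * G\<close> need not be equal, since
      neither \<open>G\<close> nor \<open>m\<close> is determined on the kernel of \<open>R\<close>;
      only their compressions by \<open>R\<close> are compared.\<close>
    have "R * (G * adj m' - m * G) * R = R * G * (R * m) - (adj m' * R) * G * R"
      by (simp only: Rm[symmetric] mult.assoc left_diff_distrib right_diff_distrib)
    also have "\<dots> = R * G * R * m - adj m' * (R * G * R)" by (simp add: mult.assoc)
    also have "\<dots> = 0" by (simp add: G(3) Rm)
    finally have "Y * (G * adj m' - m * G) * adj X = 0"
      by (rule cancel) (simp_all add: RY R_def)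
    then have "Y * G * (adj m' * adj X) = Y * m * G * adj X"
      by (simp add: algebra_simps)
    then show ?thesis
      unfolding u_def Xp[symmetric] m(2)[symmetric] by (simp add: mult.assoc)
  qed
  with uX uY uuu show ?thesis by blast
qed

text \<open>
  A partial isometry \<open>u\<close> in the commutant \<open>M\<close> of \<open>PP\<close> extends to a unitary in \<open>M\<close>: for small generic
  \<open>\<lambda>\<close> both \<open>c = u + \<lambda>\<close> and its block from the initial to the final space of \<open>u\<close> are injective, so the
  complementary block of \<open>c\<^sup>-\<^sup>1\<close> identifies the two orthogonal complements inside \<open>M\<close>. Polar
  decomposition turns that identification into a unitary one.
\<close>

lemma unitary_extension:
  assumes u: "u * adj u * u = u" and uX: "u * X = Y" "adj u * Y = X"
    and PP: "\<And>p. p \<in> PP \<Longrightarrow> adj p \<in> PP \<and> u * p = p * u"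
  shows "\<exists>U. adj U * U = 1 \<and> U * adj U = 1 \<and> U * X = Y \<and> (\<forall>p\<in>PP. U * p = p * U)"
proof -
  define P where "P = adj u * u"
  define Q where "Q = u * adj u"
  have adjP: "adj P = P" and adjQ: "adj Q = Q" by (simp_all add: P_def Q_def adj_mult)
  have uP: "u * P = u" and Qu: "Q * u = u" using u by (simp_all add: P_def Q_def mult.assoc)
  have Pu: "P * adj u = adj u" and uQ: "adj u * Q = adj u"
    using arg_cong[OF uP, of adj] arg_cong[OF Qu, of adj] by (simp_all add: adj_mult adjP adjQ)
  have PP': "P * P = P" and QQ: "Q * Q = Q"
    by (metis P_def mult.assoc uP, metis Q_def mult.assoc Qu)
  \<comment> \<open>All but finitely many \<open>l\<close> make \<open>u + l\<close> injective. The
    bound \<open>l < 1\<close> is what defeats the overlap of initial and final space below.\<close>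
  have "infinite {0<..<1::real}" by simp
  then have "infinite (complex_of_real ` {0<..<1})"
    by (simp add: finite_image_iff inj_on_def)
  then obtain l where l: "0 < l" "l < 1" "- complex_of_real l \<notin> eigenvals u"
  proof -
    assume a: "\<And>l. 0 < l \<Longrightarrow> l < 1 \<Longrightarrow> - complex_of_real l \<notin> eigenvals u \<Longrightarrow> thesis"
    have "\<not> complex_of_real ` {0<..<1} \<subseteq> uminus ` eigenvals u"
      using \<open>infinite (complex_of_real ` _)\<close> finite_eigenvals finite_subset by blast
    then obtain l where "l \<in> {0<..<1}" "complex_of_real l \<notin> uminus ` eigenvals u" by blast
    then show thesis using a[of l] by force
  qed
  define s where "s = scal (complex_of_real l)"
  have adjs: "adj s = s" by (simp add: s_def adj_scal)
  have scomm: "s * x = x * s" for x by (simp add: s_def scal_commute)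
  define C where "C = u + s"
  have "C * y = 0 \<Longrightarrow> y = 0" for y
    using eigenvals_cancel[OF l(3), of y] by (simp add: C_def s_def scal_minus)
  then obtain D where D: "C * D = 1" "D * C = 1" using invertible_if_injective by blast
  have D': "adj D * adj C = 1" "adj C * adj D = 1"
    using arg_cong[OF D(1), of adj] arg_cong[OF D(2), of adj] by (simp_all add: adj_mult)
  \<comment> \<open>\<open>adj C\<close> leads from the final space \<open>Q\<close> to the initial
    space \<open>P\<close> with block \<open>adj u + s * P * Q\<close>. The complementary block of
    its inverse leads from \<open>1 - P\<close> to \<open>1 - Q\<close>, which is why
    \<open>adj D\<close> and not \<open>D\<close> appears. Adding \<open>u\<close> gives a map that
    still sends \<open>X\<close> to \<open>Y\<close>.\<close>
  define T where "T = u + (1 - Q) * adj D * (1 - P)"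
  have adjT: "adj T = adj u + (1 - P) * D * (1 - Q)"
    by (simp add: T_def adj_add adj_mult adj_diff adjP adjQ mult.assoc)
  \<comment> \<open>In Hilbert space terms, \<open>z = adj D * y\<close> lies in the final space and
    \<open>|z| = |adj u * z| = l * |P * z| \<le> l * |z|\<close>, so \<open>l < 1\<close> forces
    \<open>z = 0\<close>.\<close>
  have inj: "y = 0" if Ty: "T * y = 0" for y
  proof -
    have uQ0: "adj u * (1 - Q) = 0" by (simp add: right_diff_distrib uQ)
    have "adj u * T = P + (adj u * (1 - Q)) * adj D * (1 - P)"
      by (simp add: T_def distrib_left P_def mult.assoc)
    then have "adj u * T = P" by (simp add: uQ0)
    then have Py: "P * y = 0" using Ty by (metis mult.assoc mult_zero_right)
    then have uy: "u * y = 0" by (metis uP mult.assoc mult_zero_right)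
    define z where "z = adj D * y"
    have "(1 - P) * y = y" by (simp add: left_diff_distrib Py)
    then have "(1 - Q) * z = 0"
      using Ty by (simp add: T_def distrib_right uy z_def mult.assoc)
    then have Qz: "Q * z = z" by (simp add: left_diff_distrib)
    have Cz: "adj C * z = y" by (simp add: z_def mult.assoc[symmetric] D')
    have "P * (adj C * z) = 0" by (simp add: Cz Py)
    then have "adj u * z + s * (P * z) = 0"
      by (simp add: C_def adj_add adjs distrib_left distrib_right mult.assoc[symmetric] Pu scomm[of P])
    then have uz: "adj u * z = - (s * (P * z))" by (simp add: eq_neg_iff_add_eq_0)
    have "adj z * z = adj (adj u * z) * (adj u * z)"
      using Qz by (simp add: adj_mult Q_def mult.assoc)
    also have "\<dots> = adj z * (P * (s * (s * (P * z))))"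
      by (simp add: uz adj_minus adj_mult adjs adjP mult.assoc)
    also have "\<dots> = s * s * (adj z * (P * z))"
      by (metis PP' scomm mult.assoc)
    finally have zz: "adj z * z = s * s * (adj z * (P * z))" .
    \<comment> \<open>Replaces the norm inequality by an identity: \<open>|z|^2 - l^2 * |P z|^2 = (1
      - l^2) * |z|^2 + l^2 * |(1 - P) z|^2\<close> is a sum of two squares, to which
      \<open>adj_sum_eq_0\<close> applies.\<close>
    define r where "r = scal (complex_of_real (sqrt (1 - l\<^sup>2)))"
    have l2: "1 - l\<^sup>2 > 0" using l by (simp add: power_less_one_iff abs_square_less_1)
    have "sqrt (1 - l\<^sup>2) * sqrt (1 - l\<^sup>2) = 1 - l * l"
      using l2 by (simp add: Power.power2_eq_square)
    then have "complex_of_real (sqrt (1 - l\<^sup>2)) * complex_of_real (sqrt (1 - l\<^sup>2))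
        = 1 - complex_of_real l * complex_of_real l"
      by (metis of_real_1 of_real_diff of_real_mult)
    then have rr: "r * r = 1 - s * s"
      unfolding r_def s_def scal_mult[symmetric] scal_1[symmetric] scal_diff[symmetric] by simp
    have adjr: "adj r = r" by (simp add: r_def adj_scal)
    have rcomm: "r * x = x * r" for x by (simp add: r_def scal_commute)
    have e1: "adj (r * z) * (r * z) = r * r * (adj z * z)"
      by (simp add: adj_mult adjr mult.assoc) (metis rcomm mult.assoc)
    have e2: "adj (s * ((1 - P) * z)) * (s * ((1 - P) * z)) = s * s * (adj z * ((1 - P) * z))"
    proof -
      have "adj (s * ((1 - P) * z)) * (s * ((1 - P) * z))
          = adj z * ((1 - P) * (s * (s * ((1 - P) * z))))"
        by (simp add: adj_mult adjs adj_diff adjP mult.assoc)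
      also have "\<dots> = s * s * (adj z * (((1 - P) * (1 - P)) * z))"
        by (metis scomm mult.assoc)
      also have "(1 - P) * (1 - P) = 1 - P" by (simp add: algebra_simps PP')
      finally show ?thesis .
    qed
    have "adj z * ((1 - P) * z) = adj z * z - adj z * (P * z)"
      by (simp add: left_diff_distrib right_diff_distrib)
    then have "adj (r * z) * (r * z) + adj (s * ((1 - P) * z)) * (s * ((1 - P) * z))
        = adj z * z - s * s * (adj z * (P * z))"
      unfolding e1 e2 rr by (simp add: left_diff_distrib right_diff_distrib) (simp add: algebra_simps)
    then have "adj (r * z) * (r * z) + adj (s * ((1 - P) * z)) * (s * ((1 - P) * z)) = 0"
      using zz by simp
    then have "r * z = 0" by (rule adj_sum_eq_0)
    then have "z = 0" unfolding r_def using l2 by (intro scal_eq_0_cancel[of _ z]) auto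
    with Cz show ?thesis by simp
  qed
  have PX: "P * X = X" using uX by (simp add: P_def mult.assoc)
  have QY: "Q * Y = Y" using uX by (simp add: Q_def mult.assoc)
  have TX: "T * X = Y"
    by (simp add: T_def distrib_right uX mult.assoc left_diff_distrib PX)
  have TY: "adj T * Y = X"
    by (simp add: adjT distrib_right uX mult.assoc left_diff_distrib QY)
  obtain S where S: "adj S = S" "\<forall>z. adj T * T * z = z * (adj T * T) \<longrightarrow> S * z = z * S"
    "\<forall>z. adj T * T * z = z \<longrightarrow> S * z = z" "adj T * T * S ^ 2 = 1"
    using inverse_sqrt[OF inj] by blast
  define U where "U = T * S"
  have SR: "S * (adj T * T) = adj T * T * S" using S(2) by simp
  have UU: "adj U * U = 1"
    using S(4) by (simp add: U_def adj_mult S(1) power2_eq_square) (metis SR mult.assoc)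
  \<comment> \<open>An isometry is injective, hence invertible here, and its left inverse
    \<open>adj U\<close> is then a right inverse too.\<close>
  obtain U' where U': "U * U' = 1" "U' * U = 1"
    using invertible_if_injective[of U] UU by (metis mult.assoc mult_1_left mult_zero_right)
  then have UU': "U * adj U = 1" using UU by (metis mult.assoc mult_1_left mult_1_right)
  \<comment> \<open>\<open>adj T * T\<close> fixes \<open>X\<close>, so its inverse square root
    \<open>S\<close> does as well.\<close>
  have UX: "U * X = Y"
    using S(3) TX TY by (simp add: U_def mult.assoc)
  have comm: "T * p = p * T" if p: "p \<in> PP" for p
  proof -
    have up: "u * p = p * u" "u * adj p = adj p * u" using PP p by blast+
    have uap: "adj u * p = p * adj u"
      using arg_cong[OF up(2), of adj] by (simp add: adj_mult)
    have "C * adj p = adj p * C" by (simp add: C_def distrib_left distrib_right up scomm)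
    then have "D * adj p = adj p * D" using D by (metis mult.assoc mult_1_left mult_1_right)
    then have Dp: "adj D * p = p * adj D" by (metis adj_adj adj_mult)
    have Pp: "(1 - P) * p = p * (1 - P)" and Qp: "(1 - Q) * p = p * (1 - Q)"
      unfolding P_def Q_def left_diff_distrib right_diff_distrib
      by (simp_all add: mult.assoc up uap) (metis mult.assoc up uap)+
    show ?thesis unfolding T_def distrib_left distrib_right up
      by (metis Dp Pp Qp mult.assoc)
  qed
  have "U * p = p * U" if p: "p \<in> PP" for p
  proof -
    have "T * p = p * T" "adj T * p = p * adj T"
      using comm[OF p] arg_cong[OF comm[of "adj p"], of adj] PP[OF p] by (simp_all add: adj_mult)
    then have "adj T * T * p = p * (adj T * T)" by (metis mult.assoc)
    with S(2) have "S * p = p * S" by blast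
    with \<open>T * p = p * T\<close> show ?thesis by (metis U_def mult.assoc)
  qed
  with UU UU' UX show ?thesis by blast
qed

lemma unitary_of_gram:
  assumes "adj X * X = adj Y * Y"
    and PP: "\<And>p. p \<in> PP \<Longrightarrow> adj p \<in> PP \<and> (\<exists>m. p * X = X * m \<and> p * Y = Y * m)"
  shows "\<exists>U. adj U * U = 1 \<and> U * adj U = 1 \<and> U * X = Y \<and> (\<forall>p\<in>PP. U * p = p * U)"
proof -
  obtain u where "u * X = Y" "adj u * Y = X" "u * adj u * u = u" "\<forall>p\<in>PP. u * p = p * u"
    using partial_isometry_of_gram[OF assms] by blast
  then show ?thesis using unitary_extension[of u X Y PP] PP by blast
qed

end

section \<open>Matrices of arbitrary finite size in one unital ring\<close>

text \<open>
  Infinite matrices that agree with a scalar multiple of the identity outside a finite block: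
  rectangular matrices of all sizes embed by zero padding, and dimensions need not be tracked.
\<close>

typedef cmat = "{f :: nat \<Rightarrow> nat \<Rightarrow> complex.
    \<exists>n c. \<forall>i j. n \<le> i \<or> n \<le> j \<longrightarrow> f i j = (if i = j then c else 0)}"
  morphisms entry Cmat
  by (rule exI[of _ "\<lambda>_ _. 0"]) (rule CollectI, rule exI[of _ 0], rule exI[of _ 0], simp)

definition scalar_outside :: "nat \<Rightarrow> complex \<Rightarrow> (nat \<Rightarrow> nat \<Rightarrow> complex) \<Rightarrow> bool" where
  "scalar_outside n c f \<longleftrightarrow> (\<forall>i j. n \<le> i \<or> n \<le> j \<longrightarrow> f i j = (if i = j then c else 0))"

lemma scalar_outside_mono: "scalar_outside n c f \<Longrightarrow> n \<le> m \<Longrightarrow> scalar_outside m c f"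
  by (auto simp: scalar_outside_def)

lemma scalar_outside_entry: "\<exists>n c. scalar_outside n c (entry x)"
  using entry[of x] unfolding scalar_outside_def by blast

lemma entry_Cmat: "scalar_outside n c f \<Longrightarrow> entry (Cmat f) = f"
  unfolding scalar_outside_def by (rule Cmat_inverse) blast

lemma cmat_eqI: "(\<And>i j. entry x i j = entry y i j) \<Longrightarrow> x = y"
  by (metis entry_inject ext)

definition finite_cmat :: "nat \<Rightarrow> nat \<Rightarrow> (nat \<Rightarrow> nat \<Rightarrow> complex) \<Rightarrow> cmat" where
  "finite_cmat m n f = Cmat (\<lambda>i j. if i < m \<and> j < n then f i j else 0)"

lemma entry_finite_cmat [simp]:
  "entry (finite_cmat m n f) i j = (if i < m \<and> j < n then f i j else 0)"
proof -
  have "scalar_outside (max m n) 0 (\<lambda>i j. if i < m \<and> j < n then f i j else 0)"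
    by (auto simp: scalar_outside_def)
  then show ?thesis by (simp add: finite_cmat_def entry_Cmat)
qed

instantiation cmat :: "{zero, one, plus, minus, uminus, times}"
begin

definition "0 = Cmat (\<lambda>_ _. 0)"
definition "1 = Cmat (\<lambda>i j. if i = j then 1 else 0)"
definition "x + y = Cmat (\<lambda>i j. entry x i j + entry y i j)"
definition "x - y = Cmat (\<lambda>i j. entry x i j - entry y i j)"
definition "- x = Cmat (\<lambda>i j. - entry x i j)"
text \<open>Summing over the support of row \<open>i\<close> keeps the product free of a chosen
  block size. The support is finite, as it lies in the block together with the diagonal
  position.\<close>

definition "x * y = Cmat (\<lambda>i j. \<Sum>k | entry x i k \<noteq> 0. entry x i k * entry y k j)"

instance ..

end

lemma scalar_outside_both:
  obtains n c d where "scalar_outside n c (entry x)" "scalar_outside n d (entry y)"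
proof -
  obtain n c m d where "scalar_outside n c (entry x)" "scalar_outside m d (entry y)"
    using scalar_outside_entry by metis
  then have "scalar_outside (max n m) c (entry x)" "scalar_outside (max n m) d (entry y)"
    by (auto elim: scalar_outside_mono)
  then show thesis by (rule that)
qed

lemma entry_zero [simp]: "entry 0 i j = 0"
  by (simp add: zero_cmat_def entry_Cmat[of 0 0] scalar_outside_def)

lemma entry_one [simp]: "entry 1 i j = (if i = j then 1 else 0)"
  by (simp add: one_cmat_def entry_Cmat[of 0 1] scalar_outside_def)

lemma entry_plus [simp]: "entry (x + y) i j = entry x i j + entry y i j"
proof -
  obtain n c d where "scalar_outside n c (entry x)" "scalar_outside n d (entry y)"
    by (rule scalar_outside_both)
  then have "scalar_outside n (c + d) (\<lambda>i j. entry x i j + entry y i j)"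
    by (simp add: scalar_outside_def)
  then show ?thesis by (simp add: plus_cmat_def entry_Cmat)
qed

lemma entry_minus [simp]: "entry (x - y) i j = entry x i j - entry y i j"
proof -
  obtain n c d where "scalar_outside n c (entry x)" "scalar_outside n d (entry y)"
    by (rule scalar_outside_both)
  then have "scalar_outside n (c - d) (\<lambda>i j. entry x i j - entry y i j)"
    by (simp add: scalar_outside_def)
  then show ?thesis by (simp add: minus_cmat_def entry_Cmat)
qed

lemma entry_uminus [simp]: "entry (- x) i j = - entry x i j"
proof -
  obtain n c where "scalar_outside n c (entry x)"
    using scalar_outside_entry by blast
  then have "scalar_outside n (- c) (\<lambda>i j. - entry x i j)"
    by (simp add: scalar_outside_def)
  then show ?thesis by (simp add: uminus_cmat_def entry_Cmat)
qed

lemma finite_row: "finite {k. entry x i k \<noteq> 0}"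
proof -
  obtain n c where "scalar_outside n c (entry x)"
    using scalar_outside_entry by blast
  then have "{k. entry x i k \<noteq> 0} \<subseteq> {..<n} \<union> {i}"
    unfolding scalar_outside_def by (auto simp: not_less) (metis not_less)
  then show ?thesis by (rule finite_subset) simp
qed

lemma row_sum_eq:
  assumes "finite S" and "\<And>k. k \<notin> S \<Longrightarrow> entry x i k * f k = 0"
  shows "(\<Sum>k | entry x i k \<noteq> 0. entry x i k * f k) = (\<Sum>k\<in>S. entry x i k * f k)"
proof -
  have "(\<Sum>k | entry x i k \<noteq> 0. entry x i k * f k)
      = (\<Sum>k\<in>{k. entry x i k \<noteq> 0} \<union> S. entry x i k * f k)"
    by (rule sum.mono_neutral_left) (use finite_row assms in auto)
  also have "\<dots> = (\<Sum>k\<in>S. entry x i k * f k)"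
    by (rule sum.mono_neutral_right) (use finite_row assms in auto)
  finally show ?thesis .
qed

lemma scalar_outside_times:
  assumes "scalar_outside n c (entry x)" "scalar_outside n d (entry y)"
  shows "scalar_outside n (c * d) (\<lambda>i j. \<Sum>k | entry x i k \<noteq> 0. entry x i k * entry y k j)"
  unfolding scalar_outside_def
proof (intro allI impI)
  fix i j assume ij: "n \<le> i \<or> n \<le> j"
  \<comment> \<open>An index outside the block leaves only \<open>k = i = j\<close>: the
    intersection of the two singletons is \<open>{i}\<close> on the diagonal and empty off
    it.\<close>
  have "(\<Sum>k | entry x i k \<noteq> 0. entry x i k * entry y k j)
      = (\<Sum>k\<in>{i} \<inter> {j}. entry x i k * entry y k j)"
  proof (rule row_sum_eq)
    fix k assume "k \<notin> {i} \<inter> {j}"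
    then show "entry x i k * entry y k j = 0"
      using ij assms unfolding scalar_outside_def by (metis IntI mult_eq_0_iff singletonI)
  qed simp
  also have "\<dots> = (if i = j then c * d else 0)"
    using ij assms by (auto simp: scalar_outside_def)
  finally show "(\<Sum>k | entry x i k \<noteq> 0. entry x i k * entry y k j) = (if i = j then c * d else 0)" .
qed

lemma entry_times: "entry (x * y) i j = (\<Sum>k | entry x i k \<noteq> 0. entry x i k * entry y k j)"
proof -
  obtain n c d where "scalar_outside n c (entry x)" "scalar_outside n d (entry y)"
    by (rule scalar_outside_both)
  then show ?thesis by (simp add: times_cmat_def entry_Cmat[OF scalar_outside_times])
qed

lemma entry_times_sum:
  assumes "finite S" and "\<And>k. k \<notin> S \<Longrightarrow> entry x i k * entry y k j = 0"
  shows "entry (x * y) i j = (\<Sum>k\<in>S. entry x i k * entry y k j)"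
  unfolding entry_times by (rule row_sum_eq[OF assms])

lemma entry_times_eventually:
  assumes "n > i" "n > j" "scalar_outside n c (entry x)"
  shows "entry (x * y) i j = (\<Sum>k<n. entry x i k * entry y k j)"
  by (rule entry_times_sum) (use assms in \<open>auto simp: scalar_outside_def\<close>)

instance cmat :: ring_1
proof
  fix x y z :: cmat
  show "x * y * z = x * (y * z)"
  proof (rule cmat_eqI)
    fix i j
    obtain n c d where "scalar_outside n c (entry x)" "scalar_outside n d (entry y)"
      by (rule scalar_outside_both)
    moreover define m where "m = Suc (max n (max i j))"
    ultimately have xy: "scalar_outside m c (entry x)" "scalar_outside m d (entry y)"
      by (auto elim: scalar_outside_mono)
    have x_y: "scalar_outside m (c * d) (entry (x * y))"
      using scalar_outside_times[OF xy] by (simp add: entry_times[abs_def])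
    have "entry (x * y * z) i j = (\<Sum>k<m. entry (x * y) i k * entry z k j)"
      by (rule entry_times_eventually[OF _ _ x_y]) (simp_all add: m_def)
    also have "\<dots> = (\<Sum>k<m. (\<Sum>l<m. entry x i l * entry y l k) * entry z k j)"
      by (intro sum.cong refl arg_cong2[where f = "(*)"] entry_times_eventually[OF _ _ xy(1)])
        (auto simp: m_def)
    also have "\<dots> = (\<Sum>l<m. entry x i l * (\<Sum>k<m. entry y l k * entry z k j))"
      by (simp add: sum_distrib_left sum_distrib_right mult.assoc) (rule sum.swap)
    also have "\<dots> = (\<Sum>l<m. entry x i l * entry (y * z) l j)"
      by (intro sum.cong refl arg_cong2[where f = "(*)"] entry_times_eventually[OF _ _ xy(2), symmetric])
        (auto simp: m_def)
    also have "\<dots> = entry (x * (y * z)) i j"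
      by (rule entry_times_eventually[OF _ _ xy(1), symmetric]) (simp_all add: m_def)
    finally show "entry (x * y * z) i j = entry (x * (y * z)) i j" .
  qed
  show "1 * x = x" "x * 1 = x"
    by (rule cmat_eqI, subst entry_times_sum[of "{i}" for i], auto)
      (rule cmat_eqI, subst entry_times_sum[of "{j}" for j], auto)
  show "(x + y) * z = x * z + y * z"
  proof (rule cmat_eqI)
    fix i j
    let ?S = "{k. entry x i k \<noteq> 0} \<union> {k. entry y i k \<noteq> 0}"
    show "entry ((x + y) * z) i j = entry (x * z + y * z) i j"
      by (subst (1 2 3) entry_times_sum[of ?S] | simp add: finite_row distrib_right sum.distrib)+
  qed
  show "x * (y + z) = x * y + x * z"
    by (rule cmat_eqI) (simp add: entry_times distrib_left sum.distrib)
  have "entry (0 :: cmat) 0 0 \<noteq> entry 1 0 0" by simp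
  then show "(0 :: cmat) \<noteq> 1" by metis
qed (auto intro!: cmat_eqI)

lemma entry_sum: "entry (sum f S) i j = (\<Sum>s\<in>S. entry (f s) i j)"
  by (induction S rule: infinite_finite_induct) simp_all


section \<open>Adjoints, scalars and algebraicity of matrices\<close>

text \<open>Gaussian elimination with unknowns \<open>K\<close> and equations \<open>S\<close>:
  equation \<open>s\<close> eliminates the pivot unknown \<open>k0\<close>. It is used to find a
  linear relation between the powers of a matrix.\<close>

lemma linear_dependence:
  fixes f :: "'b \<Rightarrow> 'c \<Rightarrow> 'd::field"
  assumes "finite S" "finite K" "card S < card K"
  shows "\<exists>c. (\<exists>k\<in>K. c k \<noteq> 0) \<and> (\<forall>s\<in>S. (\<Sum>k\<in>K. c k * f k s) = 0)"
  using assms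
proof (induction S arbitrary: K f)
  case empty
  then have "K \<noteq> {}" by auto
  then show ?case by (intro exI[of _ "\<lambda>_. 1"]) auto
next
  case (insert s S)
  show ?case
  proof (cases "\<forall>k\<in>K. f k s = 0")
    case True
    then show ?thesis using insert.IH[of K f] insert.prems insert.hyps by auto
  next
    case False
    then obtain k0 where k0: "k0 \<in> K" "f k0 s \<noteq> 0" by blast
    define K' where "K' = K - {k0}"
    have K': "finite K'" "card S < card K'" "k0 \<notin> K'" "K = insert k0 K'"
      using insert.prems insert.hyps k0 by (auto simp: K'_def)
    obtain c where c: "\<exists>k\<in>K'. c k \<noteq> 0"
      "\<forall>t\<in>S. (\<Sum>k\<in>K'. c k * (f k t - f k s / f k0 s * f k0 t)) = 0"
      using insert.IH[of K' "\<lambda>k t. f k t - f k s / f k0 s * f k0 t"] K' by blast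
    define a where "a = - (\<Sum>k\<in>K'. c k * f k s) / f k0 s"
    define d where "d = c(k0 := a)"
    have split: "(\<Sum>k\<in>K. d k * f k t) = a * f k0 t + (\<Sum>k\<in>K'. c k * f k t)" for t
      using K' by (auto simp: d_def intro!: sum.cong)
    have "(\<Sum>k\<in>K. d k * f k t) = 0" if "t \<in> insert s S" for t
    proof (cases "t = s")
      case True
      then show ?thesis unfolding split using k0 by (simp add: a_def)
    next
      case False
      with that c(2) have "0 = (\<Sum>k\<in>K'. c k * (f k t - f k s / f k0 s * f k0 t))" by simp
      also have "\<dots> = (\<Sum>k\<in>K'. c k * f k t) - (\<Sum>k\<in>K'. c k * f k s * (f k0 t / f k0 s))"
        by (simp add: sum_subtractf algebra_simps)
      also have "\<dots> = (\<Sum>k\<in>K'. c k * f k t) - (\<Sum>k\<in>K'. c k * f k s) * (f k0 t / f k0 s)"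
        by (simp only: sum_distrib_right)
      also have "\<dots> = (\<Sum>k\<in>K. d k * f k t)" unfolding split by (simp add: a_def)
      finally show ?thesis by simp
    qed
    moreover have "\<exists>k\<in>K. d k \<noteq> 0" using c(1) K' by (auto simp: d_def)
    ultimately show ?thesis by blast
  qed
qed

instantiation cmat :: algebraic_star_algebra
begin

definition "adj x = Cmat (\<lambda>i j. cnj (entry x j i))"
definition "scal c = Cmat (\<lambda>i j. if i = j then c else 0)"

lemma entry_adj [simp]: "entry (adj x) i j = cnj (entry x j i)"
proof -
  obtain n c where "scalar_outside n c (entry x)"
    using scalar_outside_entry by blast
  then have "scalar_outside n (cnj c) (\<lambda>i j. cnj (entry x j i))"
    by (auto simp: scalar_outside_def)
  then show ?thesis by (simp add: adj_cmat_def entry_Cmat)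
qed

lemma entry_scal [simp]: "entry (scal c) i j = (if i = j then c else 0)"
  by (simp add: scal_cmat_def entry_Cmat[of 0 c] scalar_outside_def)

lemma entry_scal_times [simp]: "entry (scal c * x) i j = c * entry x i j"
  by (subst entry_times_sum[of "{i}"]) auto

lemma entry_times_scal [simp]: "entry (x * scal c) i j = entry x i j * c"
  by (subst entry_times_sum[of "{j}"]) auto

lemma adj_outside: "scalar_outside n c (entry x) \<Longrightarrow> scalar_outside n (cnj c) (entry (adj x))"
  by (auto simp: scalar_outside_def)

instance
proof
  fix x y :: cmat and c d :: complex
  show "adj (x * y) = adj y * adj x"
  proof (rule cmat_eqI)
    fix i j
    obtain n c d where "scalar_outside n c (entry x)" "scalar_outside n d (entry y)"
      by (rule scalar_outside_both)
    moreover define m where "m = Suc (max n (max i j))"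
    ultimately have xy: "scalar_outside m c (entry x)" "scalar_outside m d (entry y)"
      by (auto elim: scalar_outside_mono)
    have "entry (adj (x * y)) i j = cnj (\<Sum>k<m. entry x j k * entry y k i)"
      unfolding entry_adj by (subst entry_times_eventually[OF _ _ xy(1)]) (simp_all add: m_def)
    also have "\<dots> = (\<Sum>k<m. entry (adj y) i k * entry (adj x) k j)"
      by (simp add: mult.commute)
    also have "\<dots> = entry (adj y * adj x) i j"
      by (rule entry_times_eventually[OF _ _ adj_outside[OF xy(2)], symmetric])
        (simp_all add: m_def)
    finally show "entry (adj (x * y)) i j = entry (adj y * adj x) i j" .
  qed
  show "x = 0" if "adj x * x + adj y * y = 0"
  proof (rule cmat_eqI)
    fix i j
    obtain n c d where "scalar_outside n c (entry x)" "scalar_outside n d (entry y)"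
      by (rule scalar_outside_both)
    moreover define m where "m = Suc (max n (max i j))"
    ultimately have xy: "scalar_outside m c (entry x)" "scalar_outside m d (entry y)"
      by (auto elim: scalar_outside_mono)
    have ij: "i < m" "j < m" by (auto simp: m_def)
    have sq: "entry (adj z * z) j j = of_real (\<Sum>k<m. (cmod (entry z k j))\<^sup>2)"
      if "scalar_outside m e (entry z)" for z e
      by (subst entry_times_eventually[OF ij(2) ij(2) adj_outside[OF that]])
        (simp add: mult.commute flip: complex_norm_square)
    have "entry (adj x * x + adj y * y) j j = 0" using that by simp
    then have "complex_of_real ((\<Sum>k<m. (cmod (entry x k j))\<^sup>2) + (\<Sum>k<m. (cmod (entry y k j))\<^sup>2)) = 0"
      using sq[OF xy(1)] sq[OF xy(2)] by simp
    then have "(\<Sum>k<m. (cmod (entry x k j))\<^sup>2) + (\<Sum>k<m. (cmod (entry y k j))\<^sup>2) = 0"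
      by (simp only: of_real_eq_0_iff)
    then have "(\<Sum>k<m. (cmod (entry x k j))\<^sup>2) = 0"
      by (simp add: add_nonneg_eq_0_iff sum_nonneg)
    then have "(cmod (entry x i j))\<^sup>2 = 0"
      using ij by (subst (asm) sum_nonneg_eq_0_iff) auto
    then show "entry x i j = entry 0 i j" by simp
  qed
  show "\<exists>n c. (\<exists>i\<le>n. c i \<noteq> 0) \<and> (\<Sum>i\<le>n. scal (c i) * x ^ i) = 0"
  proof -
    obtain n e where x: "scalar_outside n e (entry x)"
      using scalar_outside_entry by blast
    have pow: "scalar_outside n (e ^ k) (entry (x ^ k))" for k
    proof (induction k)
      case 0
      show ?case by (simp add: scalar_outside_def)
    next
      case (Suc k)
      show ?case using scalar_outside_times[OF x Suc] by (simp add: entry_times[abs_def])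
    qed
    \<comment> \<open>Coordinates of a power of \<open>x\<close>: its entries in the block and,
      under \<open>None\<close>, the scalar on the diagonal outside it. There are
      \<open>card S\<close> of them, so the \<open>card S + 1\<close> powers with exponents in
      \<open>{..card S}\<close> are dependent.\<close>
    define S where "S = insert None (Some ` ({..<n} \<times> {..<n}))"
    define f where "f k s = (case s of None \<Rightarrow> e ^ k | Some (i, j) \<Rightarrow> entry (x ^ k) i j)" for k s
    have "finite S" by (simp add: S_def)
    then obtain c where c: "\<exists>k\<in>{..card S}. c k \<noteq> 0" "\<forall>s\<in>S. (\<Sum>k\<le>card S. c k * f k s) = 0"
      using linear_dependence[of S "{..card S}" f] by auto
    have "(\<Sum>i\<le>card S. scal (c i) * x ^ i) = 0"
    proof (rule cmat_eqI)
      fix i j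
      show "entry (\<Sum>i\<le>card S. scal (c i) * x ^ i) i j = entry 0 i j"
      proof (cases "i < n \<and> j < n")
        case True
        then have "(\<Sum>k\<le>card S. c k * f k (Some (i, j))) = 0"
          using c(2) by (auto simp: S_def)
        then show ?thesis by (simp add: entry_sum f_def)
      next
        case False
        then have "entry (x ^ k) i j = (if i = j then f k None else 0)" for k
          using pow[of k] by (auto simp: scalar_outside_def f_def not_less)
        moreover have "(\<Sum>k\<le>card S. c k * f k None) = 0"
          using c(2) by (auto simp: S_def)
        ultimately show ?thesis by (cases "i = j") (simp_all add: entry_sum)
      qed
    qed
    with c(1) show ?thesis by (intro exI[of _ "card S"] exI[of _ c]) auto
  qed
qed (auto intro!: cmat_eqI)

end

section \<open>Finite-dimensional inner product spaces\<close>

lemma complex_field_simps [simp]: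
  "carrier complex_field = UNIV" "\<zero>\<^bsub>complex_field\<^esub> = 0" "\<one>\<^bsub>complex_field\<^esub> = 1"
  "c \<oplus>\<^bsub>complex_field\<^esub> d = c + d" "c \<otimes>\<^bsub>complex_field\<^esub> d = c * d"
  by (simp_all add: complex_field_def)

lemma cring_complex_field: "cring complex_field"
proof (rule cringI)
  show "abelian_group complex_field"
  proof (rule abelian_groupI)
    fix x :: complex
    show "\<exists>y\<in>carrier complex_field. y \<oplus>\<^bsub>complex_field\<^esub> x = \<zero>\<^bsub>complex_field\<^esub>"
      by (intro bexI[of _ "- x"]) simp_all
  qed simp_all
  show "comm_monoid complex_field"
    by (rule comm_monoidI) simp_all
qed (simp add: distrib_right)

lemma (in module) additive_finsum:
  fixes f :: "'c \<Rightarrow> 'x::ab_group_add"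
  assumes add: "\<And>x y. x \<in> carrier M \<Longrightarrow> y \<in> carrier M \<Longrightarrow> f (x \<oplus>\<^bsub>M\<^esub> y) = f x + f y"
    and g: "g \<in> I \<rightarrow> carrier M" and "finite I"
  shows "f (\<Oplus>\<^bsub>M\<^esub>i\<in>I. g i) = (\<Sum>i\<in>I. f (g i))"
  using \<open>finite I\<close> g
proof (induction I)
  case empty
  then show ?case using add[of "\<zero>\<^bsub>M\<^esub>" "\<zero>\<^bsub>M\<^esub>"] by simp
next
  case (insert i I)
  then have "g i \<in> carrier M" "g \<in> I \<rightarrow> carrier M" by auto
  then show ?case using insert add M.finsum_closed[of g I] by simp
qed

lemma linear_map_zero:
  assumes "module complex_field M" "module complex_field N" "linear_map M N f"
  shows "f \<zero>\<^bsub>M\<^esub> = \<zero>\<^bsub>N\<^esub>"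
proof -
  interpret M: module complex_field M by fact
  interpret N: module complex_field N by fact
  have "f \<in> carrier M \<rightarrow> carrier N" "\<forall>c. \<forall>x\<in>carrier M. f (c \<odot>\<^bsub>M\<^esub> x) = c \<odot>\<^bsub>N\<^esub> f x"
    using assms(3) unfolding linear_map_def by blast+
  then have "f (0 \<odot>\<^bsub>M\<^esub> \<zero>\<^bsub>M\<^esub>) = 0 \<odot>\<^bsub>N\<^esub> f \<zero>\<^bsub>M\<^esub>" "f \<zero>\<^bsub>M\<^esub> \<in> carrier N"
    using M.M.zero_closed by blast+
  then show ?thesis
    using M.smult_l_null[of "\<zero>\<^bsub>M\<^esub>"] N.smult_l_null[of "f \<zero>\<^bsub>M\<^esub>"] by simp
qed

lemma linear_map_finsum:
  assumes "module complex_field M" "module complex_field N" "linear_map M N f"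
    and g: "g \<in> I \<rightarrow> carrier M" and "finite I"
  shows "f (\<Oplus>\<^bsub>M\<^esub>i\<in>I. g i) = (\<Oplus>\<^bsub>N\<^esub>i\<in>I. f (g i))"
  using \<open>finite I\<close> g
proof (induction I)
  interpret M: module complex_field M by fact
  interpret N: module complex_field N by fact
  have f: "f \<in> carrier M \<rightarrow> carrier N" using assms(3) by (simp add: linear_map_def)
  {
    case empty
    then show ?case using linear_map_zero[OF assms(1-3)] by simp
  next
    case (insert i I)
    then have i: "g i \<in> carrier M" "g \<in> I \<rightarrow> carrier M" by auto
    have "(\<lambda>i. f (g i)) \<in> I \<rightarrow> carrier N" "f (g i) \<in> carrier N" using f i by auto
    moreover have "f (g i \<oplus>\<^bsub>M\<^esub> (\<Oplus>\<^bsub>M\<^esub>i\<in>I. g i)) = f (g i) \<oplus>\<^bsub>N\<^esub> f (\<Oplus>\<^bsub>M\<^esub>i\<in>I. g i)"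
      using assms(3) i M.M.finsum_closed[of g I] by (simp add: linear_map_def)
    ultimately show ?case using insert i by simp
  }
qed

lemma generators_exist:
  assumes "module complex_field M" "fin_dim M"
  obtains m :: nat and g where "g \<in> {..<m} \<rightarrow> carrier M"
    and "\<And>v. v \<in> carrier M \<Longrightarrow> \<exists>c. v = (\<Oplus>\<^bsub>M\<^esub>i\<in>{..<m}. c i \<odot>\<^bsub>M\<^esub> g i)"
proof -
  interpret M: module complex_field M by fact
  obtain B where B: "finite B" "B \<subseteq> carrier M"
    "\<And>v. v \<in> carrier M \<Longrightarrow> \<exists>c. v = (\<Oplus>\<^bsub>M\<^esub>b\<in>B. c b \<odot>\<^bsub>M\<^esub> b)"
    using assms(2) unfolding fin_dim_def by blast
  obtain g where g: "bij_betw g {0..<card B} B" using ex_bij_betw_nat_finite[OF B(1)] ..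
  then have gB: "g ` {..<card B} = B" "inj_on g {..<card B}"
    by (simp_all add: bij_betw_def atLeast0LessThan)
  show thesis
  proof (rule that[of g "card B"])
    show "g \<in> {..<card B} \<rightarrow> carrier M" using gB(1) B(2) by auto
    fix v assume "v \<in> carrier M"
    then obtain c where "v = (\<Oplus>\<^bsub>M\<^esub>b\<in>B. c b \<odot>\<^bsub>M\<^esub> b)" using B(3) by blast
    also have "\<dots> = (\<Oplus>\<^bsub>M\<^esub>i\<in>{..<card B}. c (g i) \<odot>\<^bsub>M\<^esub> g i)"
      using B(2) gB(2) by (subst gB(1)[symmetric], intro M.M.finsum_reindex) (auto simp: gB(1))
    finally show "\<exists>c. v = (\<Oplus>\<^bsub>M\<^esub>i\<in>{..<card B}. c i \<odot>\<^bsub>M\<^esub> g i)"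
      by (intro exI[of _ "\<lambda>i. c (g i)"])
  qed
qed

section \<open>Orthonormal bases\<close>

text \<open>Completeness is left out because orthonormal bases are needed before it is known: for
  the dilation space it is deduced from such a basis.\<close>

locale pre_hilbert_space = module complex_field H
  for H :: "('a, 'm) inner_space_scheme" (structure) +
  assumes cinner_add_right:
      "\<lbrakk>x \<in> carrier H; y \<in> carrier H; z \<in> carrier H\<rbrakk>
        \<Longrightarrow> cinner H x (y \<oplus> z) = cinner H x y + cinner H x z"
    and cinner_smult_right:
      "\<lbrakk>x \<in> carrier H; y \<in> carrier H\<rbrakk> \<Longrightarrow> cinner H x (c \<odot> y) = c * cinner H x y"
    and cinner_commute:
      "\<lbrakk>x \<in> carrier H; y \<in> carrier H\<rbrakk> \<Longrightarrow> cinner H y x = cnj (cinner H x y)"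
    and cinner_nonneg: "x \<in> carrier H \<Longrightarrow> 0 \<le> Re (cinner H x x)"
    and cinner_eq_zero: "x \<in> carrier H \<Longrightarrow> cinner H x x = 0 \<longleftrightarrow> x = \<zero>"
begin

lemma cinner_add_left:
  assumes "x \<in> carrier H" "y \<in> carrier H" "z \<in> carrier H"
  shows "cinner H (x \<oplus> y) z = cinner H x z + cinner H y z"
  using assms cinner_add_right[of z x y] cinner_commute[of z] by simp

lemma cinner_smult_left:
  assumes "x \<in> carrier H" "y \<in> carrier H"
  shows "cinner H (c \<odot> x) y = cnj c * cinner H x y"
  using assms cinner_smult_right[of y x c] cinner_commute[of y] by simp

lemma cinner_zero_right [simp]: "x \<in> carrier H \<Longrightarrow> cinner H x \<zero> = 0"
  using cinner_smult_right[of x \<zero> 0] by simp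

lemma diff_add: "x \<in> carrier H \<Longrightarrow> y \<in> carrier H \<Longrightarrow> (x \<ominus> y) \<oplus> y = x"
  by (simp add: M.minus_eq M.a_assoc M.l_neg)

lemma diff_eq_zero:
  assumes "x \<in> carrier H" "y \<in> carrier H" "x \<ominus> y = \<zero>"
  shows "x = y"
  using diff_add[OF assms(1,2)] assms by simp

lemma cinner_diff_right:
  assumes "x \<in> carrier H" "y \<in> carrier H" "z \<in> carrier H"
  shows "cinner H x (y \<ominus> z) = cinner H x y - cinner H x z"
proof -
  have "cinner H x ((y \<ominus> z) \<oplus> z) = cinner H x (y \<ominus> z) + cinner H x z"
    using assms by (simp add: cinner_add_right)
  then show ?thesis using assms by (simp add: diff_add)
qed

lemma cinner_diff_left:
  assumes "x \<in> carrier H" "y \<in> carrier H" "z \<in> carrier H"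
  shows "cinner H (x \<ominus> y) z = cinner H x z - cinner H y z"
  using assms cinner_diff_right[of z x y] cinner_commute[of z] by simp

lemma cinner_finsum_right:
  assumes "x \<in> carrier H" "g \<in> I \<rightarrow> carrier H" "finite I"
  shows "cinner H x (\<Oplus>i\<in>I. g i) = (\<Sum>i\<in>I. cinner H x (g i))"
  by (rule additive_finsum) (use assms cinner_add_right in auto)

lemma cinner_eqI:
  assumes x: "x \<in> carrier H" and y: "y \<in> carrier H"
    and eq: "\<And>z. z \<in> carrier H \<Longrightarrow> cinner H z x = cinner H z y"
  shows "x = y"
proof -
  have "cinner H (x \<ominus> y) (x \<ominus> y) = 0"
    using x y eq[of "x \<ominus> y"] by (simp add: cinner_diff_right)
  then have "x \<ominus> y = \<zero>" using x y by (simp add: cinner_eq_zero)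
  then show ?thesis by (rule diff_eq_zero[OF x y])
qed

definition orthonormal :: "(nat \<Rightarrow> 'a) \<Rightarrow> nat \<Rightarrow> bool" where
  "orthonormal e n \<longleftrightarrow> e \<in> {..<n} \<rightarrow> carrier H \<and>
     (\<forall>i<n. \<forall>j<n. cinner H (e i) (e j) = (if i = j then 1 else 0))"

definition proj :: "(nat \<Rightarrow> 'a) \<Rightarrow> nat \<Rightarrow> 'a \<Rightarrow> 'a" where
  "proj e n x = (\<Oplus>i\<in>{..<n}. cinner H (e i) x \<odot> e i)"

definition onb :: "(nat \<Rightarrow> 'a) \<Rightarrow> nat \<Rightarrow> bool" where
  "onb e n \<longleftrightarrow> orthonormal e n \<and> (\<forall>x\<in>carrier H. proj e n x = x)"

lemma proj_closed [simp]: "e \<in> {..<n} \<rightarrow> carrier H \<Longrightarrow> proj e n x \<in> carrier H"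
  unfolding proj_def by (rule M.finsum_closed) auto

lemma cinner_proj_right:
  assumes "e \<in> {..<n} \<rightarrow> carrier H" "y \<in> carrier H"
  shows "cinner H y (proj e n x) = (\<Sum>i<n. cinner H (e i) x * cinner H y (e i))"
proof -
  have "cinner H y (proj e n x) = (\<Sum>i<n. cinner H y (cinner H (e i) x \<odot> e i))"
    unfolding proj_def using assms by (intro cinner_finsum_right) auto
  also have "\<dots> = (\<Sum>i<n. cinner H (e i) x * cinner H y (e i))"
    using assms by (intro sum.cong refl cinner_smult_right) auto
  finally show ?thesis .
qed

lemma cinner_basis_proj:
  assumes "orthonormal e n" "j < n"
  shows "cinner H (e j) (proj e n x) = cinner H (e j) x"
proof -
  have "cinner H (e j) (proj e n x) = (\<Sum>i<n. cinner H (e i) x * cinner H (e j) (e i))"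
    using assms by (intro cinner_proj_right) (auto simp: orthonormal_def)
  also have "\<dots> = (\<Sum>i<n. if i = j then cinner H (e i) x else 0)"
    using assms by (intro sum.cong) (auto simp: orthonormal_def)
  finally show ?thesis using assms(2) by simp
qed

lemma gram_schmidt:
  assumes "finite B" "B \<subseteq> carrier H"
  shows "\<exists>n e. orthonormal e n \<and> (\<forall>b\<in>B. proj e n b = b)"
  using assms
proof (induction B)
  case empty
  have "orthonormal e 0" for e by (simp add: orthonormal_def)
  then show ?case by blast
next
  case (insert v B)
  then obtain n e where e: "orthonormal e n" "\<forall>b\<in>B. proj e n b = b" by auto
  have v: "v \<in> carrier H" and B: "B \<subseteq> carrier H" using insert.prems by auto
  have ec: "e \<in> {..<n} \<rightarrow> carrier H" using e(1) by (simp add: orthonormal_def)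
  define w where "w = v \<ominus> proj e n v"
  have w: "w \<in> carrier H" using v ec by (simp add: w_def)
  have vw: "v = w \<oplus> proj e n v"
    using v ec by (simp add: w_def diff_add)
  have ew: "cinner H (e i) w = 0" if "i < n" for i
    using that v ec funcset_mem[OF ec, of i] e(1) by (simp add: w_def cinner_diff_right cinner_basis_proj)
  show ?case
  proof (cases "w = \<zero>")
    case True
    then have "proj e n v = v" using vw ec by simp
    with e show ?thesis by blast
  next
    case False
    define r where "r = Re (cinner H w w)"
    have im: "cinner H w w = complex_of_real r"
      using cinner_commute[OF w w] by (simp add: r_def complex_eq_iff)
    have "r \<noteq> 0" using im cinner_eq_zero[OF w] False by force
    moreover have "r \<ge> 0" using cinner_nonneg[OF w] by (simp only: r_def)
    ultimately have r: "r > 0" by simp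
    define u where "u = complex_of_real (1 / sqrt r) \<odot> w"
    have u: "u \<in> carrier H" using w by (simp add: u_def)
    have "1 / sqrt r * r = sqrt r" using r by (simp add: real_div_sqrt)
    then have sr: "complex_of_real (1 / sqrt r) * complex_of_real r = complex_of_real (sqrt r)"
      by (metis of_real_mult)
    then have uw: "cinner H u w = complex_of_real (sqrt r)"
      using w unfolding u_def by (simp only: cinner_smult_left im complex_cnj_complex_of_real)
    have "cinner H u u = complex_of_real (1 / sqrt r) * cinner H u w"
      using w unfolding u_def by (simp only: cinner_smult_right smult_closed complex_field_simps UNIV_I)
    then have uu: "cinner H u u = 1" using r by (simp add: uw)
    have eu: "cinner H (e i) u = 0" and ue: "cinner H u (e i) = 0" if "i < n" for i
      using that ew ec w cinner_commute[of "e i" u] u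
      by (auto simp: u_def cinner_smult_right Pi_iff)
    have "complex_of_real (sqrt r) \<odot> u = (complex_of_real (sqrt r) * complex_of_real (1 / sqrt r)) \<odot> w"
      using w smult_assoc1[of "complex_of_real (sqrt r)" "complex_of_real (1 / sqrt r)" w]
      by (simp add: u_def)
    then have ru: "complex_of_real (sqrt r) \<odot> u = w" using smult_one[OF w] r by simp
    define e' where "e' = e(n := u)"
    have on: "orthonormal e' (Suc n)"
      using e(1) u uu eu ue by (auto simp: orthonormal_def e'_def less_Suc_eq)
    have proj': "proj e' (Suc n) x = cinner H u x \<odot> u \<oplus> proj e n x" if "x \<in> carrier H" for x
    proof -
      have "(\<Oplus>i\<in>{..<n}. cinner H (e' i) x \<odot> e' i) = proj e n x"
        unfolding proj_def using ec by (intro M.finsum_cong') (auto simp: e'_def)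
      moreover have "(\<lambda>i. cinner H (e' i) x \<odot> e' i) \<in> {..<n} \<rightarrow> carrier H"
        using ec by (auto simp: e'_def Pi_iff)
      ultimately show ?thesis
        unfolding proj_def[of e'] lessThan_Suc using u by (simp add: e'_def)
    qed
    have u0: "cinner H u (proj e n x) = 0" for x
      using cinner_proj_right[OF ec u] ue by simp
    have "proj e' (Suc n) b = b" if "b \<in> B" for b
    proof -
      have b: "b \<in> carrier H" "proj e n b = b" using that B e(2) by auto
      then have "cinner H u b = 0" using u0[of b] by simp
      then show ?thesis using proj'[OF b(1)] b smult_l_null[OF u] by simp
    qed
    moreover have "proj e' (Suc n) v = v"
    proof -
      have "cinner H u v = complex_of_real (sqrt r)"
        by (subst vw) (simp add: u w ec cinner_add_right u0 uw)
      then show ?thesis using proj'[OF v] vw ru by simp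
    qed
    ultimately show ?thesis using on by blast
  qed
qed

text \<open>The residual of \<open>x\<close> is orthogonal to \<open>e\<close>, hence to all
  generators, hence to itself. Generators form a family and not a set, so the vectors spanning the
  dilation space may repeat.\<close>

lemma onb_of_generators:
  fixes m :: nat
  assumes g: "g \<in> {..<m} \<rightarrow> carrier H"
    and span: "\<And>v. v \<in> carrier H \<Longrightarrow> \<exists>c. v = (\<Oplus>i\<in>{..<m}. c i \<odot> g i)"
  obtains e n where "onb e n"
proof -
  have "\<exists>n e. orthonormal e n \<and> (\<forall>b\<in>g ` {..<m}. proj e n b = b)"
    using g by (intro gram_schmidt) auto
  then obtain n e where e: "orthonormal e n" "\<forall>i<m. proj e n (g i) = g i" by fastforce
  have ec: "e \<in> {..<n} \<rightarrow> carrier H" using e(1) by (simp add: orthonormal_def)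
  have "proj e n x = x" if x: "x \<in> carrier H" for x
  proof -
    define r where "r = x \<ominus> proj e n x"
    have r: "r \<in> carrier H" using x ec by (simp add: r_def)
    have "cinner H (e i) r = 0" if "i < n" for i
      using that x ec funcset_mem[OF ec, of i] e(1)
      by (simp add: r_def cinner_diff_right cinner_basis_proj)
    then have re: "cinner H r (e i) = 0" if "i < n" for i
      using that cinner_commute[of "e i" r] r ec by auto
    have rp: "cinner H r (proj e n y) = 0" for y
      using cinner_proj_right[OF ec r] re by simp
    then have rg: "cinner H r (g i) = 0" if "i < m" for i using e(2) that by metis
    obtain c where c: "x = (\<Oplus>i\<in>{..<m}. c i \<odot> g i)" using span[OF x] by blast
    have "cinner H r x = (\<Sum>i<m. cinner H r (c i \<odot> g i))"
      unfolding c using g r by (intro cinner_finsum_right) (auto simp: Pi_iff)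
    also have "\<dots> = 0"
      using g r rg by (intro sum.neutral) (auto simp: cinner_smult_right Pi_iff)
    finally have "cinner H r r = 0"
      using rp[of x] r x ec by (simp add: r_def cinner_diff_right)
    then have "r = \<zero>" using r by (simp add: cinner_eq_zero)
    then show ?thesis using diff_eq_zero[of x "proj e n x"] x ec by (simp add: r_def)
  qed
  with e(1) have "onb e n" by (simp add: onb_def)
  then show thesis by (rule that)
qed

lemma onb_exists:
  assumes "fin_dim H"
  obtains e n where "onb e n"
proof -
  obtain m g where gens: "g \<in> {..<m} \<rightarrow> carrier H"
    "\<And>v. v \<in> carrier H \<Longrightarrow> \<exists>c. v = (\<Oplus>i\<in>{..<m::nat}. c i \<odot> g i)"
    by (rule generators_exist[OF module_axioms assms]) (rule that, assumption+)
  obtain e n where "onb e n" by (rule onb_of_generators[OF gens]) (assumption | rule that)+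
  then show thesis by (rule that)
qed


lemma onb_closed: "onb e n \<Longrightarrow> i < n \<Longrightarrow> e i \<in> carrier H"
  by (auto simp: onb_def orthonormal_def)

lemma onb_Pi: "onb e n \<Longrightarrow> e \<in> {..<n} \<rightarrow> carrier H"
  by (simp add: onb_def orthonormal_def)

lemma onb_inner: "onb e n \<Longrightarrow> i < n \<Longrightarrow> j < n \<Longrightarrow> cinner H (e i) (e j) = (if i = j then 1 else 0)"
  by (simp add: onb_def orthonormal_def)

lemma onb_expand: "onb e n \<Longrightarrow> x \<in> carrier H \<Longrightarrow> (\<Oplus>i\<in>{..<n}. cinner H (e i) x \<odot> e i) = x"
  by (simp add: onb_def proj_def)

lemma parseval:
  assumes "onb e n" "x \<in> carrier H" "y \<in> carrier H"
  shows "cinner H x y = (\<Sum>i<n. cnj (cinner H (e i) x) * cinner H (e i) y)"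
proof -
  have "cinner H x y = cinner H x (proj e n y)" using assms by (simp add: onb_def)
  also have "\<dots> = (\<Sum>i<n. cinner H (e i) y * cinner H x (e i))"
    using assms by (intro cinner_proj_right onb_Pi)
  also have "\<dots> = (\<Sum>i<n. cnj (cinner H (e i) x) * cinner H (e i) y)"
    using assms cinner_commute[of _ x] onb_closed by (intro sum.cong) (auto simp: mult.commute)
  finally show ?thesis .
qed

lemma onb_eqI:
  assumes "onb e n" "x \<in> carrier H" "y \<in> carrier H"
    and "\<And>i. i < n \<Longrightarrow> cinner H (e i) x = cinner H (e i) y"
  shows "x = y"
  by (rule cinner_eqI) (use assms parseval[OF assms(1)] in auto)

definition comb :: "(nat \<Rightarrow> 'a) \<Rightarrow> nat \<Rightarrow> (nat \<Rightarrow> complex) \<Rightarrow> 'a" where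
  "comb e n c = (\<Oplus>i\<in>{..<n}. c i \<odot> e i)"

lemma comb_closed: "e \<in> {..<n} \<rightarrow> carrier H \<Longrightarrow> comb e n c \<in> carrier H"
  unfolding comb_def by (rule M.finsum_closed) (auto simp: Pi_iff)

lemma cinner_comb_right:
  assumes "e \<in> {..<n} \<rightarrow> carrier H" "y \<in> carrier H"
  shows "cinner H y (comb e n c) = (\<Sum>i<n. c i * cinner H y (e i))"
proof -
  have "cinner H y (comb e n c) = (\<Sum>i<n. cinner H y (c i \<odot> e i))"
    unfolding comb_def using assms by (intro cinner_finsum_right) (auto simp: Pi_iff)
  also have "\<dots> = (\<Sum>i<n. c i * cinner H y (e i))"
    using assms by (intro sum.cong refl cinner_smult_right) auto
  finally show ?thesis .
qed

lemma cinner_basis_comb: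
  assumes "onb e n" "j < n"
  shows "cinner H (e j) (comb e n c) = c j"
proof -
  have "cinner H (e j) (comb e n c) = (\<Sum>i<n. c i * cinner H (e j) (e i))"
    using assms by (intro cinner_comb_right onb_Pi onb_closed)
  also have "\<dots> = (\<Sum>i<n. if i = j then c i else 0)"
    using assms by (intro sum.cong) (auto simp: onb_inner)
  finally show ?thesis using assms(2) by simp
qed

lemma fin_dim_onb:
  assumes "onb e n"
  shows "fin_dim H"
  unfolding fin_dim_def
proof (intro exI[of _ "e ` {..<n}"] conjI ballI)
  show "e ` {..<n} \<subseteq> carrier H" using onb_closed[OF assms] by auto
  have inj: "inj_on e {..<n}"
  proof (rule inj_onI)
    fix i j assume "i \<in> {..<n}" "j \<in> {..<n}" "e i = e j"
    then show "i = j" using onb_inner[OF assms, of i i] onb_inner[OF assms, of i j]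
      by (auto split: if_splits)
  qed
  fix v assume v: "v \<in> carrier H"
  have "(\<Oplus>b\<in>e ` {..<n}. cinner H b v \<odot> b) = (\<Oplus>i\<in>{..<n}. cinner H (e i) v \<odot> e i)"
    using onb_closed[OF assms] by (intro M.finsum_reindex inj) auto
  then show "\<exists>c. v = (\<Oplus>b\<in>e ` {..<n}. c b \<odot> b)" using onb_expand[OF assms v] by metis
qed simp

lemma hnorm_onb:
  assumes "onb e n" "x \<in> carrier H"
  shows "hnorm H x = L2_set (\<lambda>i. cmod (cinner H (e i) x)) {..<n}"
proof -
  have "Re (cinner H x x) = (\<Sum>i<n. (cmod (cinner H (e i) x))\<^sup>2)"
    unfolding parseval[OF assms(1) assms(2) assms(2)] Re_sum
    by (intro sum.cong refl) (simp add: cmod_power2, simp add: power2_eq_square)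
  then show ?thesis by (simp add: hnorm_def L2_set_def)
qed

text \<open>
  \<^locale>\<open>Metric_space\<close> constrains the distance of arbitrary elements of the type; hence the extra
  assumptions on differences of elements outside the carrier.
\<close>

lemma hilbert_space_onb:
  assumes e: "onb e n"
    and closed: "\<And>x y. x \<ominus> y \<in> carrier H"
    and sym: "\<And>x y. hnorm H (x \<ominus> y) = hnorm H (y \<ominus> x)"
  shows "hilbert_space H"
proof -
  define N where "N x = L2_set (\<lambda>i. cmod (cinner H (e i) x)) {..<n}" for x
  let ?d = "\<lambda>x y. hnorm H (x \<ominus> y)"
  have d: "?d x y = L2_set (\<lambda>i. cmod (cinner H (e i) x - cinner H (e i) y)) {..<n}"
    if "x \<in> carrier H" "y \<in> carrier H" for x y
  proof -
    have "?d x y = L2_set (\<lambda>i. cmod (cinner H (e i) (x \<ominus> y))) {..<n}"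
      by (rule hnorm_onb[OF e closed])
    also have "\<dots> = L2_set (\<lambda>i. cmod (cinner H (e i) x - cinner H (e i) y)) {..<n}"
      using that onb_closed[OF e] by (intro L2_set_cong) (auto simp: cinner_diff_right)
    finally show ?thesis .
  qed
  interpret D: Metric_space "carrier H" ?d
  proof
    fix x y z
    show "0 \<le> ?d x y" using cinner_nonneg[OF closed] by (simp add: hnorm_def)
    show "?d x y = ?d y x" by (rule sym)
    assume xy: "x \<in> carrier H" "y \<in> carrier H"
    show "?d x y = 0 \<longleftrightarrow> x = y"
      using onb_eqI[OF e xy] by (auto simp: d[OF xy] L2_set_eq_0_iff)
    assume z: "z \<in> carrier H"
    have "?d x z \<le> L2_set (\<lambda>i. cmod (cinner H (e i) x - cinner H (e i) y)
        + cmod (cinner H (e i) y - cinner H (e i) z)) {..<n}"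
      unfolding d[OF xy(1) z] by (rule L2_set_mono) (auto intro: norm_diff_triangle_le)
    also have "\<dots> \<le> ?d x y + ?d y z"
      unfolding d[OF xy] d[OF xy(2) z] by (rule L2_set_triangle_ineq)
    finally show "?d x z \<le> ?d x y + ?d y z" .
  qed
  have "D.mcomplete"
    unfolding D.mcomplete_def
  proof (intro allI impI)
    fix s assume cauchy: "D.MCauchy s"
    then have s: "s k \<in> carrier H" for k by (auto simp: D.MCauchy_def)
    have "\<exists>l. (\<lambda>k. cinner H (e i) (s k)) \<longlonglongrightarrow> l" if i: "i < n" for i
    proof -
      have "Cauchy (\<lambda>k. cinner H (e i) (s k))"
      proof (rule CauchyI)
        fix r :: real assume "r > 0"
        then obtain M where M: "\<And>k l. M \<le> k \<Longrightarrow> M \<le> l \<Longrightarrow> ?d (s k) (s l) < r"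
          using cauchy unfolding D.MCauchy_def by meson
        have "cmod (cinner H (e i) (s k) - cinner H (e i) (s l)) \<le> ?d (s k) (s l)" for k l
          unfolding d[OF s s]
          by (rule member_le_L2_set[where f = "\<lambda>i. cmod (cinner H (e i) (s k) - cinner H (e i) (s l))"])
            (use i in auto)
        then show "\<exists>M. \<forall>m\<ge>M. \<forall>n\<ge>M. cmod (cinner H (e i) (s m) - cinner H (e i) (s n)) < r"
          using M by (meson le_less_trans)
      qed
      then show ?thesis using Cauchy_convergent convergent_def by blast
    qed
    then obtain l where l: "\<And>i. i < n \<Longrightarrow> (\<lambda>k. cinner H (e i) (s k)) \<longlonglongrightarrow> l i" by metis
    define x where "x = comb e n l"
    have x: "x \<in> carrier H" unfolding x_def by (rule comb_closed[OF onb_Pi[OF e]])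
    have ex: "cinner H (e i) x = l i" if "i < n" for i
      using cinner_basis_comb[OF e that] by (simp add: x_def)
    \<comment> \<open>The norm is dominated by the sum of the moduli of finitely many coordinates,
      so the coordinatewise limit is a limit in the metric.\<close>
    have "(\<lambda>k. \<Sum>i<n. cmod (cinner H (e i) (s k) - l i)) \<longlonglongrightarrow> (\<Sum>i<n. cmod (l i - l i))"
      by (intro tendsto_intros l) auto
    then have lim: "(\<lambda>k. \<Sum>i<n. cmod (cinner H (e i) (s k) - l i)) \<longlonglongrightarrow> 0" by simp
    have bound: "?d (s k) x \<le> (\<Sum>i<n. cmod (cinner H (e i) (s k) - l i))" for k
      unfolding d[OF s x] by (rule order_trans[OF L2_set_le_sum]) (simp_all add: ex)
    have "limitin D.mtopology s x sequentially"
      unfolding D.limit_metric_sequentially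
    proof (intro conjI allI impI)
      fix r :: real assume "r > 0"
      with lim obtain M where "\<forall>k\<ge>M. (\<Sum>i<n. cmod (cinner H (e i) (s k) - l i)) < r"
        using order_tendstoD(2)[OF lim, of r] by (auto simp: eventually_sequentially)
      then show "\<exists>N. \<forall>n\<ge>N. s n \<in> carrier H \<and> ?d (s n) x < r"
        using s bound by (meson le_less_trans)
    qed (rule x)
    then show "\<exists>x. limitin D.mtopology s x sequentially" by blast
  qed
  then show ?thesis
    using module_axioms cinner_add_right cinner_smult_right cinner_commute cinner_nonneg cinner_eq_zero
    unfolding hilbert_space_def hilbert_space_axioms_def by blast
qed

end

sublocale hilbert_space \<subseteq> pre_hilbert_space
  by unfold_locales
    (fact cinner_add_right cinner_smult_right cinner_commute cinner_nonneg cinner_eq_zero)+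

locale fin_hilbert_space = pre_hilbert_space +
  assumes fin_dim: "fin_dim H"

section \<open>Bounded operators and adjoints\<close>

lemma cinner_linear_map:
  assumes "pre_hilbert_space H" "pre_hilbert_space I" "linear_map H I T"
    and e: "pre_hilbert_space.onb H e n" and x: "x \<in> carrier H" and y: "y \<in> carrier I"
  shows "cinner I y (T x) = (\<Sum>i<n. cinner H (e i) x * cinner I y (T (e i)))"
proof -
  interpret H: pre_hilbert_space H by fact
  interpret I: pre_hilbert_space I by fact
  note ei = H.onb_closed[OF e]
  have T: "T \<in> carrier H \<rightarrow> carrier I" "\<And>c x. x \<in> carrier H \<Longrightarrow> T (c \<odot>\<^bsub>H\<^esub> x) = c \<odot>\<^bsub>I\<^esub> T x"
    using assms(3) unfolding linear_map_def by blast+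
  have Tc: "x \<in> carrier H \<Longrightarrow> T x \<in> carrier I" for x using T(1) by blast
  have "T x = T (\<Oplus>\<^bsub>H\<^esub>i\<in>{..<n}. cinner H (e i) x \<odot>\<^bsub>H\<^esub> e i)"
    using H.onb_expand[OF e x] by simp
  also have "\<dots> = (\<Oplus>\<^bsub>I\<^esub>i\<in>{..<n}. T (cinner H (e i) x \<odot>\<^bsub>H\<^esub> e i))"
    by (rule linear_map_finsum[OF H.module_axioms I.module_axioms assms(3)]) (auto simp: ei)
  finally have "cinner I y (T x) = (\<Sum>i<n. cinner I y (T (cinner H (e i) x \<odot>\<^bsub>H\<^esub> e i)))"
    using y by (simp add: I.cinner_finsum_right ei Tc)
  also have "\<dots> = (\<Sum>i<n. cinner H (e i) x * cinner I y (T (e i)))"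
    by (intro sum.cong refl) (simp add: T(2) ei Tc y I.cinner_smult_right)
  finally show ?thesis .
qed

text \<open>Boundedness is automatic: the sum \<open>C\<close> of the moduli of all matrix entries
  is a bound.\<close>

lemma bounded_ops_iff:
  assumes "fin_hilbert_space H" "fin_hilbert_space I"
  shows "T \<in> bounded_ops H I \<longleftrightarrow> T \<in> extensional (carrier H) \<and> linear_map H I T"
proof
  assume "T \<in> bounded_ops H I"
  then show "T \<in> extensional (carrier H) \<and> linear_map H I T"
    by (auto simp: bounded_ops_def PiE_iff)
next
  assume T: "T \<in> extensional (carrier H) \<and> linear_map H I T"
  interpret H: fin_hilbert_space H by fact
  interpret I: fin_hilbert_space I by fact
  obtain e n where e: "H.onb e n" using H.onb_exists[OF H.fin_dim] .
  obtain f m where f: "I.onb f m" using I.onb_exists[OF I.fin_dim] .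
  have Tc: "T \<in> carrier H \<rightarrow> carrier I" using T by (simp add: linear_map_def)
  define C where "C = (\<Sum>j<m. \<Sum>i<n. cmod (cinner I (f j) (T (e i))))"
  have "hnorm I (T x) \<le> C * hnorm H x" if x: "x \<in> carrier H" for x
  proof -
    have Tx: "T x \<in> carrier I" using Tc x by blast
    have "hnorm I (T x) \<le> (\<Sum>j<m. cmod (cinner I (f j) (T x)))"
      unfolding I.hnorm_onb[OF f Tx] by (rule L2_set_le_sum) simp
    also have "\<dots> \<le> (\<Sum>j<m. \<Sum>i<n. cmod (cinner I (f j) (T (e i))) * hnorm H x)"
    proof (rule sum_mono)
      fix j assume "j \<in> {..<m}"
      then have "cinner I (f j) (T x) = (\<Sum>i<n. cinner H (e i) x * cinner I (f j) (T (e i)))"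
        using T by (intro cinner_linear_map H.pre_hilbert_space_axioms I.pre_hilbert_space_axioms
            e x I.onb_closed[OF f]) auto
      also have "cmod \<dots> \<le> (\<Sum>i<n. cmod (cinner H (e i) x * cinner I (f j) (T (e i))))"
        by (rule norm_sum)
      also have "\<dots> \<le> (\<Sum>i<n. cmod (cinner I (f j) (T (e i))) * hnorm H x)"
      proof (rule sum_mono)
        fix i assume "i \<in> {..<n}"
        then have "cmod (cinner H (e i) x) \<le> hnorm H x"
          unfolding H.hnorm_onb[OF e x]
          by (intro member_le_L2_set[where f = "\<lambda>i. cmod (cinner H (e i) x)"]) auto
        then show "cmod (cinner H (e i) x * cinner I (f j) (T (e i)))
            \<le> cmod (cinner I (f j) (T (e i))) * hnorm H x"
          by (simp add: norm_mult mult.commute mult_right_mono)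
      qed
      finally show "cmod (cinner I (f j) (T x)) \<le> (\<Sum>i<n. cmod (cinner I (f j) (T (e i))) * hnorm H x)" .
    qed
    finally show ?thesis by (simp add: C_def sum_distrib_right)
  qed
  then show "T \<in> bounded_ops H I"
    using T Tc by (auto simp: bounded_ops_def PiE_iff)
qed

lemma hadjoint_eqI:
  assumes "pre_hilbert_space H" and "y \<in> carrier I" and x: "x \<in> carrier H"
    and adj: "\<And>z. z \<in> carrier H \<Longrightarrow> cinner H x z = cinner I y (T z)"
  shows "hadjoint H I T y = x"
proof -
  interpret H: pre_hilbert_space H by fact
  have "(THE x. x \<in> carrier H \<and> (\<forall>z\<in>carrier H. cinner H x z = cinner I y (T z))) = x"
  proof (rule the_equality)
    fix x' assume x': "x' \<in> carrier H \<and> (\<forall>z\<in>carrier H. cinner H x' z = cinner I y (T z))"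
    show "x' = x"
    proof (rule H.cinner_eqI)
      fix z assume "z \<in> carrier H"
      then show "cinner H z x' = cinner H z x"
        using x x' adj H.cinner_commute[of x z] H.cinner_commute[of x' z] by simp
    qed (use x x' in auto)
  qed (use x adj in auto)
  then show ?thesis using assms(2) by (simp add: hadjoint_def)
qed

text \<open>The Riesz vector is written down in an orthonormal basis with coefficients
  \<open>cnj (cinner I y (T (e i)))\<close>. This is the existence that the definite description in
  \<open>hadjoint\<close> presupposes.\<close>

lemma
  assumes H: "fin_hilbert_space H" and I: "fin_hilbert_space I" and T: "linear_map H I T"
    and y: "y \<in> carrier I"
  shows hadjoint_closed: "hadjoint H I T y \<in> carrier H"
    and cinner_hadjoint: "z \<in> carrier H \<Longrightarrow> cinner H (hadjoint H I T y) z = cinner I y (T z)"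
proof -
  interpret H: fin_hilbert_space H by fact
  interpret I: fin_hilbert_space I by fact
  obtain e n where e: "H.onb e n" using H.onb_exists[OF H.fin_dim] .
  define x where "x = H.comb e n (\<lambda>i. cnj (cinner I y (T (e i))))"
  have x: "x \<in> carrier H" unfolding x_def by (rule H.comb_closed[OF H.onb_Pi[OF e]])
  have xz: "cinner H x z = cinner I y (T z)" if z: "z \<in> carrier H" for z
  proof -
    have "cinner H x z = (\<Sum>i<n. cnj (cinner H (e i) x) * cinner H (e i) z)"
      by (rule H.parseval[OF e x z])
    also have "\<dots> = (\<Sum>i<n. cinner H (e i) z * cinner I y (T (e i)))"
      by (intro sum.cong refl) (simp add: x_def H.cinner_basis_comb[OF e])
    also have "\<dots> = cinner I y (T z)"
      by (rule cinner_linear_map[OF H.pre_hilbert_space_axioms I.pre_hilbert_space_axioms T e z y, symmetric])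
    finally show ?thesis .
  qed
  have "hadjoint H I T y = x"
    by (rule hadjoint_eqI[OF H.pre_hilbert_space_axioms y x xz])
  with x xz show "hadjoint H I T y \<in> carrier H"
    "z \<in> carrier H \<Longrightarrow> cinner H (hadjoint H I T y) z = cinner I y (T z)" by auto
qed

lemma linear_map_hadjoint:
  assumes H: "fin_hilbert_space H" and I: "fin_hilbert_space I" and T: "linear_map H I T"
  shows "linear_map I H (hadjoint H I T)"
proof -
  interpret H: fin_hilbert_space H by fact
  interpret I: fin_hilbert_space I by fact
  have Tc: "x \<in> carrier H \<Longrightarrow> T x \<in> carrier I" for x using T by (auto simp: linear_map_def)
  note closed = hadjoint_closed[OF assms] and adj = cinner_hadjoint[OF assms]
  show ?thesis
    unfolding linear_map_def
  proof (intro conjI ballI allI)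
    fix x y c assume x: "x \<in> carrier I"
    show "hadjoint H I T (c \<odot>\<^bsub>I\<^esub> x) = c \<odot>\<^bsub>H\<^esub> hadjoint H I T x"
      by (rule hadjoint_eqI[OF H.pre_hilbert_space_axioms])
        (use x in \<open>auto simp: closed adj Tc H.cinner_smult_left I.cinner_smult_left\<close>)
    assume y: "y \<in> carrier I"
    show "hadjoint H I T (x \<oplus>\<^bsub>I\<^esub> y) = hadjoint H I T x \<oplus>\<^bsub>H\<^esub> hadjoint H I T y"
      by (rule hadjoint_eqI[OF H.pre_hilbert_space_axioms])
        (use x y in \<open>auto simp: closed adj Tc H.cinner_add_left I.cinner_add_left\<close>)
  qed (use closed in auto)
qed


lemma linear_map_comb:
  assumes "pre_hilbert_space H" "pre_hilbert_space I" "linear_map H I T"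
    and e: "e \<in> {..<n} \<rightarrow> carrier H"
  shows "T (pre_hilbert_space.comb H e n c) = pre_hilbert_space.comb I (\<lambda>i. T (e i)) n c"
proof -
  interpret H: pre_hilbert_space H by fact
  interpret I: pre_hilbert_space I by fact
  have T: "x \<in> carrier H \<Longrightarrow> T (c \<odot>\<^bsub>H\<^esub> x) = c \<odot>\<^bsub>I\<^esub> T x" "x \<in> carrier H \<Longrightarrow> T x \<in> carrier I" for c x
    using assms(3) unfolding linear_map_def by blast+
  have "T (H.comb e n c) = (\<Oplus>\<^bsub>I\<^esub>i\<in>{..<n}. T (c i \<odot>\<^bsub>H\<^esub> e i))"
    unfolding H.comb_def
    by (rule linear_map_finsum[OF H.module_axioms I.module_axioms assms(3)])
      (use e in \<open>auto simp: Pi_iff\<close>)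
  also have "\<dots> = I.comb (\<lambda>i. T (e i)) n c"
    unfolding I.comb_def using e by (intro I.M.finsum_cong') (auto simp: T Pi_iff)
  finally show ?thesis .
qed

lemma op_algebra_simps [simp]:
  "carrier (op_algebra H) = bounded_ops H H"
  "S \<otimes>\<^bsub>op_algebra H\<^esub> T = compose (carrier H) S T"
  "\<one>\<^bsub>op_algebra H\<^esub> = (\<lambda>x\<in>carrier H. x)"
  "\<zero>\<^bsub>op_algebra H\<^esub> = (\<lambda>x\<in>carrier H. \<zero>\<^bsub>H\<^esub>)"
  "S \<oplus>\<^bsub>op_algebra H\<^esub> T = (\<lambda>x\<in>carrier H. S x \<oplus>\<^bsub>H\<^esub> T x)"
  "c \<odot>\<^bsub>op_algebra H\<^esub> T = (\<lambda>x\<in>carrier H. c \<odot>\<^bsub>H\<^esub> T x)"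
  "star (op_algebra H) T = hadjoint H H T"
  by (simp_all add: op_algebra_def)

lemma bounded_opsD:
  assumes "T \<in> bounded_ops H I"
  shows "linear_map H I T" "T \<in> extensional (carrier H)"
    "x \<in> carrier H \<Longrightarrow> T x \<in> carrier I"
    "x \<in> carrier H \<Longrightarrow> y \<in> carrier H \<Longrightarrow> T (x \<oplus>\<^bsub>H\<^esub> y) = T x \<oplus>\<^bsub>I\<^esub> T y"
    "x \<in> carrier H \<Longrightarrow> T (c \<odot>\<^bsub>H\<^esub> x) = c \<odot>\<^bsub>I\<^esub> T x"
  using assms by (auto simp: bounded_ops_def linear_map_def PiE_iff)

lemma linear_map_restrict:
  assumes "module complex_field H" "linear_map H I T"
  shows "linear_map H I (restrict T (carrier H))"
proof -
  interpret module complex_field H by fact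
  show ?thesis using assms(2) by (auto simp: linear_map_def)
qed

context fin_hilbert_space
begin

lemma fin_hilbert_space: "fin_hilbert_space H" ..

lemma bounded_opsI:
  assumes "\<And>x. x \<in> carrier H \<Longrightarrow> T x \<in> carrier H"
    and "\<And>x y. x \<in> carrier H \<Longrightarrow> y \<in> carrier H \<Longrightarrow> T (x \<oplus> y) = T x \<oplus> T y"
    and "\<And>c x. x \<in> carrier H \<Longrightarrow> T (c \<odot> x) = c \<odot> T x"
  shows "(\<lambda>x\<in>carrier H. T x) \<in> bounded_ops H H"
  using assms
  by (auto simp: bounded_ops_iff[OF fin_hilbert_space fin_hilbert_space]
      intro!: linear_map_restrict[OF module_axioms]) (auto simp: linear_map_def)

lemma op_apply: "T \<in> bounded_ops H H \<Longrightarrow> x \<in> carrier H \<Longrightarrow> T x \<in> carrier H"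
  by (rule bounded_opsD(3))

lemma op_closed:
  assumes S: "S \<in> bounded_ops H H" and T: "T \<in> bounded_ops H H"
  shows "compose (carrier H) S T \<in> bounded_ops H H" "(\<lambda>x\<in>carrier H. S x \<oplus> T x) \<in> bounded_ops H H"
    "(\<lambda>x\<in>carrier H. c \<odot> T x) \<in> bounded_ops H H" "hadjoint H H T \<in> bounded_ops H H"
proof -
  note Sx = bounded_opsD[OF S] and Tx = bounded_opsD[OF T]
  show "compose (carrier H) S T \<in> bounded_ops H H"
    unfolding compose_def by (rule bounded_opsI) (simp_all add: Sx Tx)
  show "(\<lambda>x\<in>carrier H. S x \<oplus> T x) \<in> bounded_ops H H"
    by (rule bounded_opsI) (simp_all add: Sx Tx smult_r_distr M.add.m_ac)
  show "(\<lambda>x\<in>carrier H. c \<odot> T x) \<in> bounded_ops H H"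
    by (rule bounded_opsI)
      (simp_all add: Sx Tx smult_r_distr mult.commute flip: smult_assoc1[simplified])
  show "hadjoint H H T \<in> bounded_ops H H"
    using linear_map_hadjoint[OF fin_hilbert_space fin_hilbert_space Tx(1)]
    by (simp add: bounded_ops_iff[OF fin_hilbert_space fin_hilbert_space] hadjoint_def)
qed

text \<open>Entries of a product in a matrix algebra over \<open>op_algebra H\<close> are finite
  sums of operators; the monoid laws allow these to be evaluated pointwise.\<close>

lemma abelian_monoid_op_algebra: "abelian_monoid (op_algebra H)"
proof (rule abelian_monoidI)
  fix S T R
  assume "S \<in> carrier (op_algebra H)" "T \<in> carrier (op_algebra H)"
  then have ST: "S \<in> bounded_ops H H" "T \<in> bounded_ops H H" by auto
  show "S \<oplus>\<^bsub>op_algebra H\<^esub> T \<in> carrier (op_algebra H)" using op_closed ST by simp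
  show "S \<oplus>\<^bsub>op_algebra H\<^esub> T = T \<oplus>\<^bsub>op_algebra H\<^esub> S"
    using ST by (auto simp: op_apply M.a_comm intro!: restrict_ext)
  assume "R \<in> carrier (op_algebra H)"
  then show "S \<oplus>\<^bsub>op_algebra H\<^esub> T \<oplus>\<^bsub>op_algebra H\<^esub> R = S \<oplus>\<^bsub>op_algebra H\<^esub> (T \<oplus>\<^bsub>op_algebra H\<^esub> R)"
    using ST by (auto simp: op_apply M.a_assoc intro!: restrict_ext)
next
  show "\<zero>\<^bsub>op_algebra H\<^esub> \<in> carrier (op_algebra H)"
    unfolding op_algebra_simps by (rule bounded_opsI) simp_all
  fix T assume "T \<in> carrier (op_algebra H)"
  then have T: "T \<in> bounded_ops H H" by simp
  show "\<zero>\<^bsub>op_algebra H\<^esub> \<oplus>\<^bsub>op_algebra H\<^esub> T = T"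
    using bounded_opsD(2,3)[OF T] by (auto simp: fun_eq_iff extensional_def)
qed

lemma finsum_op_algebra:
  assumes "finite I" "T \<in> I \<rightarrow> bounded_ops H H" "x \<in> carrier H"
  shows "(\<Oplus>\<^bsub>op_algebra H\<^esub>i\<in>I. T i) x = (\<Oplus>i\<in>I. T i x)"
  using assms(1,2)
proof (induction I)
  interpret op: abelian_monoid "op_algebra H" by (rule abelian_monoid_op_algebra)
  {
    case empty
    show ?case using assms(3) by simp
  next
    case (insert i I)
    then have T: "T i \<in> bounded_ops H H" "T \<in> I \<rightarrow> bounded_ops H H" by auto
    then have "(\<lambda>i. T i x) \<in> I \<rightarrow> carrier H" "T i x \<in> carrier H"
      using assms(3) by (auto simp: op_apply Pi_iff)
    then show ?case using insert T assms(3) by simp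
  }
qed

end

section \<open>The dilation of a completely positive map\<close>

definition linear_functional :: "(complex, 'a, 'm) module_scheme \<Rightarrow> ('a \<Rightarrow> complex) \<Rightarrow> bool" where
  "linear_functional M f \<longleftrightarrow>
     (\<forall>x\<in>carrier M. \<forall>y\<in>carrier M. f (x \<oplus>\<^bsub>M\<^esub> y) = f x + f y) \<and>
     (\<forall>c. \<forall>x\<in>carrier M. f (c \<odot>\<^bsub>M\<^esub> x) = c * f x)"

definition bilinear_form ::
  "(complex, 'a, 'm) module_scheme \<Rightarrow> (complex, 'b, 'n) module_scheme \<Rightarrow> ('a \<Rightarrow> 'b \<Rightarrow> complex) \<Rightarrow> bool" where
  "bilinear_form M N F \<longleftrightarrow>
     (\<forall>y\<in>carrier N. linear_functional M (\<lambda>a. F a y)) \<and> (\<forall>a\<in>carrier M. linear_functional N (F a))"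

lemma linear_functional_comb:
  assumes "module complex_field M" "linear_functional M f" "g \<in> {..<n::nat} \<rightarrow> carrier M"
  shows "f (\<Oplus>\<^bsub>M\<^esub>i\<in>{..<n}. c i \<odot>\<^bsub>M\<^esub> g i) = (\<Sum>i<n. c i * f (g i))"
proof -
  interpret M: module complex_field M by fact
  have "f (\<Oplus>\<^bsub>M\<^esub>i\<in>{..<n}. c i \<odot>\<^bsub>M\<^esub> g i) = (\<Sum>i<n. f (c i \<odot>\<^bsub>M\<^esub> g i))"
    by (rule M.additive_finsum) (use assms in \<open>auto simp: linear_functional_def Pi_iff\<close>)
  also have "\<dots> = (\<Sum>i<n. c i * f (g i))"
    using assms by (intro sum.cong) (auto simp: linear_functional_def Pi_iff)
  finally show ?thesis .
qed

text \<open>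
  A spanning family of the tensor product, expressed through the bilinear forms it supports.
\<close>

lemma tensor_generators:
  assumes M: "module complex_field M" "fin_dim M" and N: "module complex_field N" "fin_dim N"
  obtains n :: nat and b x where "b \<in> {..<n} \<rightarrow> carrier M" "x \<in> {..<n} \<rightarrow> carrier N"
    and "\<And>a y. a \<in> carrier M \<Longrightarrow> y \<in> carrier N \<Longrightarrow>
      \<exists>c. \<forall>F. bilinear_form M N F \<longrightarrow> F a y = (\<Sum>p<n. c p * F (b p) (x p))"
proof -
  obtain m :: nat and g where g: "g \<in> {..<m} \<rightarrow> carrier M"
    "\<And>v. v \<in> carrier M \<Longrightarrow> \<exists>c. v = (\<Oplus>\<^bsub>M\<^esub>i\<in>{..<m}. c i \<odot>\<^bsub>M\<^esub> g i)"
    by (rule generators_exist[OF M]) (rule that, assumption+)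
  obtain k :: nat and h where h: "h \<in> {..<k} \<rightarrow> carrier N"
    "\<And>v. v \<in> carrier N \<Longrightarrow> \<exists>c. v = (\<Oplus>\<^bsub>N\<^esub>i\<in>{..<k}. c i \<odot>\<^bsub>N\<^esub> h i)"
    by (rule generators_exist[OF N]) (rule that, assumption+)
  let ?I = "{..<m} \<times> {..<k}"
  obtain e where e: "bij_betw e {0..<card ?I} ?I"
    using ex_bij_betw_nat_finite[of ?I] by auto
  have eI: "e p \<in> ?I" if "p < card ?I" for p
    by (rule bij_betw_apply[OF e]) (use that in simp)
  show thesis
  proof (rule that[of "\<lambda>p. g (fst (e p))" "card ?I" "\<lambda>p. h (snd (e p))"])
    show "(\<lambda>p. g (fst (e p))) \<in> {..<card ?I} \<rightarrow> carrier M"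
      using g(1) eI by (fastforce simp: Pi_iff)
    show "(\<lambda>p. h (snd (e p))) \<in> {..<card ?I} \<rightarrow> carrier N"
      using h(1) eI by (fastforce simp: Pi_iff)
    fix a y assume a: "a \<in> carrier M" and y: "y \<in> carrier N"
    obtain c d where c: "a = (\<Oplus>\<^bsub>M\<^esub>i\<in>{..<m}. c i \<odot>\<^bsub>M\<^esub> g i)"
      and d: "y = (\<Oplus>\<^bsub>N\<^esub>i\<in>{..<k}. d i \<odot>\<^bsub>N\<^esub> h i)"
      using g(2)[OF a] h(2)[OF y] by blast
    have key: "F a y = (\<Sum>p<card ?I. c (fst (e p)) * d (snd (e p)) * F (g (fst (e p))) (h (snd (e p))))"
      if F: "bilinear_form M N F" for F
    proof -
      have "linear_functional M (\<lambda>a. F a y)" using F y unfolding bilinear_form_def by blast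
      then have "F a y = (\<Sum>i<m. c i * F (g i) y)"
        by (subst c) (rule linear_functional_comb[OF M(1) _ g(1)])
      also have "\<dots> = (\<Sum>i<m. c i * (\<Sum>j<k. d j * F (g i) (h j)))"
      proof (intro sum.cong refl arg_cong2[where f = "(*)"])
        fix i assume "i \<in> {..<m}"
        then have "linear_functional N (F (g i))"
          using F g(1) unfolding bilinear_form_def by blast
        then show "F (g i) y = (\<Sum>j<k. d j * F (g i) (h j))"
          unfolding d by (rule linear_functional_comb[OF N(1) _ h(1)])
      qed
      also have "\<dots> = (\<Sum>(i, j)\<in>?I. c i * d j * F (g i) (h j))"
        by (simp add: sum_distrib_left mult.assoc sum.cartesian_product)
      also have "\<dots> = (\<Sum>p\<in>{0..<card ?I}. case e p of (i, j) \<Rightarrow> c i * d j * F (g i) (h j))"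
        by (rule sum.reindex_bij_betw[OF e, symmetric])
      finally show ?thesis by (simp add: case_prod_beta atLeast0LessThan)
    qed
    show "\<exists>c. \<forall>F. bilinear_form M N F \<longrightarrow>
        F a y = (\<Sum>p<card ?I. c p * F (g (fst (e p))) (h (snd (e p))))"
      by (intro exI[of _ "\<lambda>p. c (fst (e p)) * d (snd (e p))"] allI impI key)
  qed
qed

lemma matrix_algebra_simps [simp]:
  "carrier (matrix_algebra n A) = ({..<n} \<times> {..<n}) \<rightarrow>\<^sub>E carrier A"
  "X \<otimes>\<^bsub>matrix_algebra n A\<^esub> Y =
    (\<lambda>(i, j)\<in>{..<n} \<times> {..<n}. \<Oplus>\<^bsub>A\<^esub>k\<in>{..<n}. X (i, k) \<otimes>\<^bsub>A\<^esub> Y (k, j))"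
  "star (matrix_algebra n A) X = (\<lambda>(i, j)\<in>{..<n} \<times> {..<n}. star A (X (j, i)))"
  by (simp_all add: matrix_algebra_def)

section \<open>The positive kernel of a completely positive map\<close>

locale cp_map = cstar_algebra A + K: fin_hilbert_space K
  for A :: "('a, 'm) cstar_algebra_scheme" (structure)
    and K :: "('k, 'n) inner_space_scheme" +
  fixes \<phi> :: "'a \<Rightarrow> 'k \<Rightarrow> 'k"
  assumes phi_linear: "linear_map A (op_algebra K) \<phi>"
    and phi_cp: "completely_positive A (op_algebra K) \<phi>"
begin

lemma ring_A: "ring A"
  by (rule cstar_algebra.axioms(1)[OF cstar_algebra_axioms])

lemma abelian_monoid_A: "abelian_monoid A"
  by (rule abelian_group.axioms(1)[OF ring.is_abelian_group[OF ring_A]])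

lemmas A_assoc = ring.ring_simprules(11)[OF ring_A]
lemmas A_l_distr = ring.ring_simprules(13)[OF ring_A]
lemmas A_r_distr = ring.ring_simprules(23)[OF ring_A]

lemma star_zero [simp]: "star A \<zero> = \<zero>"
proof -
  have "star A (0 \<odot> \<zero>) = 0 \<odot> star A \<zero>"
    using star_smult[of \<zero> 0] by simp
  then show ?thesis using smult_l_null[of "\<zero>"] smult_l_null[of "star A \<zero>"] star_closed by simp
qed

lemma phi_bounded: "a \<in> carrier A \<Longrightarrow> \<phi> a \<in> bounded_ops K K"
  using phi_linear by (auto simp: linear_map_def)

lemmas phi_op = bounded_opsD(3-5)[OF phi_bounded]

lemma phi_add:
  "a \<in> carrier A \<Longrightarrow> b \<in> carrier A \<Longrightarrow> y \<in> carrier K \<Longrightarrow> \<phi> (a \<oplus> b) y = \<phi> a y \<oplus>\<^bsub>K\<^esub> \<phi> b y"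
  using phi_linear by (auto simp: linear_map_def)

lemma phi_smult: "a \<in> carrier A \<Longrightarrow> y \<in> carrier K \<Longrightarrow> \<phi> (c \<odot> a) y = c \<odot>\<^bsub>K\<^esub> \<phi> a y"
  using phi_linear by (auto simp: linear_map_def)

definition ker :: "'a \<Rightarrow> 'k \<Rightarrow> 'a \<Rightarrow> 'k \<Rightarrow> complex" where
  "ker a y b z = cinner K y (\<phi> (star A a \<otimes> b) z)"

lemma ker_bilinear:
  assumes "a \<in> carrier A" "y \<in> carrier K"
  shows "bilinear_form A K (ker a y)"
  using assms
  by (auto simp: bilinear_form_def linear_functional_def ker_def phi_add phi_smult phi_op star_closed
      A_r_distr smult_mult_right K.cinner_add_right K.cinner_smult_right)

text \<open>Shows that left multiplication by \<open>d\<close> has left multiplication by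
  \<open>star A d\<close> as its adjoint with respect to the kernel; on the dilation space this
  becomes preservation of the star.\<close>

lemma ker_move:
  assumes "a \<in> carrier A" "b \<in> carrier A" "d \<in> carrier A"
  shows "ker a y (d \<otimes> b) z = ker (star A d \<otimes> a) y b z"
  using assms by (simp add: ker_def star_mult star_star star_closed A_assoc)

text \<open>The matrix with entries \<open>star A (c i) \<otimes> c j\<close> is positive, so
  complete positivity factors its image as \<open>star Y\<close> times \<open>Y\<close>. Reading off
  entries turns the kernel into a sum of inner products in \<open>K\<close>, from which hermitian
  symmetry and positivity are both drawn.\<close>

lemma ker_factor:
  assumes c: "c \<in> {..<n::nat} \<rightarrow> carrier A"
  obtains Z where "\<And>k i. k < n \<Longrightarrow> i < n \<Longrightarrow> Z k i \<in> bounded_ops K K"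
    and "\<And>i j y z. i < n \<Longrightarrow> j < n \<Longrightarrow> y \<in> carrier K \<Longrightarrow> z \<in> carrier K \<Longrightarrow>
      ker (c i) y (c j) z = (\<Sum>k<n. cinner K (Z k i y) (Z k j z))"
proof -
  let ?S = "{..<n} \<times> {..<n}"
  have ci: "i < n \<Longrightarrow> c i \<in> carrier A" for i using c by auto
  define X where "X = (\<lambda>(i, j)\<in>?S. star A (c i) \<otimes> c j)"
  \<comment> \<open>The row vector \<open>c\<close> is completed to a square matrix by zero rows, so
    that \<open>star R\<close> times \<open>R\<close> stays inside the matrix algebra and has the
    wanted entries.\<close>
  define R where "R = (\<lambda>(k, j)\<in>?S. if k = 0 then c j else \<zero>)"
  have X: "X \<in> carrier (matrix_algebra n A)"
    using ci by (auto simp: X_def star_closed)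
  have R: "R \<in> carrier (matrix_algebra n A)"
    using ci by (auto simp: R_def)
  have prod: "(\<Oplus>k\<in>{..<n}. star (matrix_algebra n A) R (i, k) \<otimes> R (k, j)) = star A (c i) \<otimes> c j"
    if "i < n" "j < n" for i j
  proof -
    have "(\<Oplus>k\<in>{..<n}. star (matrix_algebra n A) R (i, k) \<otimes> R (k, j))
        = (\<Oplus>k\<in>{..<n}. if k = 0 then star A (c i) \<otimes> c j else \<zero>)"
      using that ci by (intro abelian_monoid.finsum_cong'[OF abelian_monoid_A]) (auto simp: R_def star_closed)
    also have "\<dots> = (\<Oplus>k\<in>{..<n}. if 0 = k then star A (c i) \<otimes> c j else \<zero>)"
      by (simp add: eq_commute)
    also have "\<dots> = star A (c i) \<otimes> c j"
      using that ci by (intro abelian_monoid.finsum_singleton[OF abelian_monoid_A]) (auto simp: star_closed)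
    finally show ?thesis .
  qed
  have "X = star (matrix_algebra n A) R \<otimes>\<^bsub>matrix_algebra n A\<^esub> R"
    unfolding X_def matrix_algebra_simps(2) by (intro restrict_ext) (auto simp only: prod mem_Times_iff
        lessThan_iff fst_conv snd_conv split_paired_all case_prod_conv)
  with R have "positive_element (matrix_algebra n A) X"
    unfolding positive_element_def by blast
  with X phi_cp have "positive_element (matrix_algebra n (op_algebra K)) (\<lambda>p\<in>?S. \<phi> (X p))"
    unfolding completely_positive_def by blast
  then obtain Y where Y: "Y \<in> carrier (matrix_algebra n (op_algebra K))"
    and eq: "(\<lambda>p\<in>?S. \<phi> (X p)) =
      star (matrix_algebra n (op_algebra K)) Y \<otimes>\<^bsub>matrix_algebra n (op_algebra K)\<^esub> Y"
    unfolding positive_element_def by blast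
  show thesis
  proof (rule that[of "\<lambda>k i. Y (k, i)"])
    show Yb: "Y (k, i) \<in> bounded_ops K K" if "k < n" "i < n" for k i
      using Y that by auto
    fix i j y z assume ij: "i < n" "j < n" and y: "y \<in> carrier K" and z: "z \<in> carrier K"
    let ?T = "\<lambda>k. compose (carrier K) (hadjoint K K (Y (k, i))) (Y (k, j))"
    have "?T k \<in> bounded_ops K K" if "k < n" for k
      using Yb[OF that ij(1)] Yb[OF that ij(2)] by (intro K.op_closed(1) K.op_closed(4))
    then have T: "?T \<in> {..<n} \<rightarrow> bounded_ops K K" by auto
    have "\<phi> (star A (c i) \<otimes> c j) = (\<Oplus>\<^bsub>op_algebra K\<^esub>k\<in>{..<n}.
        star (matrix_algebra n (op_algebra K)) Y (i, k) \<otimes>\<^bsub>op_algebra K\<^esub> Y (k, j))"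
      using fun_cong[OF eq, of "(i, j)"] ij by (simp add: X_def)
    also have "\<dots> = (\<Oplus>\<^bsub>op_algebra K\<^esub>k\<in>{..<n}. ?T k)"
      using T ij by (intro abelian_monoid.finsum_cong'[OF K.abelian_monoid_op_algebra]) auto
    finally have "\<phi> (star A (c i) \<otimes> c j) z = (\<Oplus>\<^bsub>K\<^esub>k\<in>{..<n}. ?T k z)"
      using K.finsum_op_algebra[OF _ T z] by simp
    then have "ker (c i) y (c j) z = (\<Sum>k<n. cinner K y (?T k z))"
      unfolding ker_def using T y z by (simp, intro K.cinner_finsum_right) (auto intro: K.op_apply)
    also have "\<dots> = (\<Sum>k<n. cinner K (Y (k, i) y) (Y (k, j) z))"
    proof (intro sum.cong refl)
      fix k assume "k \<in> {..<n}"
      then have Yk: "Y (k, i) \<in> bounded_ops K K" "Y (k, j) \<in> bounded_ops K K" using Yb ij by auto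
      then have w: "Y (k, j) z \<in> carrier K" using z K.op_apply by blast
      have L: "linear_map K K (Y (k, i))" using Yk bounded_opsD(1) by blast
      note K2 = K.fin_hilbert_space
      have "cinner K (hadjoint K K (Y (k, i)) (Y (k, j) z)) y = cinner K (Y (k, j) z) (Y (k, i) y)"
        by (rule cinner_hadjoint[OF K2 K2 L w y])
      then show "cinner K y (?T k z) = cinner K (Y (k, i) y) (Y (k, j) z)"
        using K.cinner_commute[of "hadjoint K K (Y (k, i)) (Y (k, j) z)" y]
          K.cinner_commute[of "Y (k, j) z" "Y (k, i) y"]
          hadjoint_closed[OF K2 K2 L w] w y z K.op_apply[OF Yk(1) y]
        by (simp add: compose_eq)
    qed
    finally show "ker (c i) y (c j) z = (\<Sum>k<n. cinner K (Y (k, i) y) (Y (k, j) z))" .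
  qed
qed

text \<open>Hermitian symmetry is extracted from positivity: after factorization for the pair
  \<open>a\<close>, \<open>b\<close> it is the symmetry of the inner product of
  \<open>K\<close>.\<close>

lemma ker_commute:
  assumes a: "a \<in> carrier A" and b: "b \<in> carrier A" and y: "y \<in> carrier K" and z: "z \<in> carrier K"
  shows "ker b z a y = cnj (ker a y b z)"
proof -
  define c where "c i = (if i = 0 then a else b)" for i :: nat
  have c: "c \<in> {..<2} \<rightarrow> carrier A" using a b by (auto simp: c_def)
  obtain Z where Z: "\<And>k i. k < (2::nat) \<Longrightarrow> i < (2::nat) \<Longrightarrow> Z k i \<in> bounded_ops K K"
    "\<And>i j y z. i < (2::nat) \<Longrightarrow> j < (2::nat) \<Longrightarrow> y \<in> carrier K \<Longrightarrow> z \<in> carrier K \<Longrightarrow>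
      ker (c i) y (c j) z = (\<Sum>k<(2::nat). cinner K (Z k i y) (Z k j z))"
    by (rule ker_factor[OF c]) (rule that, assumption+)
  have Zc: "Z k i y \<in> carrier K" if "k < 2" "i < 2" "y \<in> carrier K" for k i y
    by (rule K.op_apply[OF Z(1)]) (use that in auto)
  have "ker (c 1) z (c 0) y = (\<Sum>k<2. cinner K (Z k 1 z) (Z k 0 y))"
    using y z by (intro Z) auto
  also have "\<dots> = cnj (\<Sum>k<2. cinner K (Z k 0 y) (Z k 1 z))"
    unfolding cnj_sum by (intro sum.cong refl K.cinner_commute) (simp_all add: Zc y z)
  also have "\<dots> = cnj (ker (c 0) y (c 1) z)"
    using y z by (subst Z) auto
  finally show ?thesis by (simp add: c_def)
qed

end


section \<open>Construction of the dilation space\<close>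

locale gns = cp_map A K \<phi>
  for A :: "('a, 'm) cstar_algebra_scheme" (structure)
    and K :: "('k, 'n) inner_space_scheme" and \<phi> +
  fixes N :: nat and b :: "nat \<Rightarrow> 'a" and x :: "nat \<Rightarrow> 'k"
  assumes b: "b \<in> {..<N} \<rightarrow> carrier A" and x: "x \<in> {..<N} \<rightarrow> carrier K"
    and span: "\<And>a y. a \<in> carrier A \<Longrightarrow> y \<in> carrier K \<Longrightarrow>
      \<exists>c. \<forall>F. bilinear_form A K F \<longrightarrow> F a y = (\<Sum>p<N. c p * F (b p) (x p))"
begin

lemma bx [simp]: "p < N \<Longrightarrow> b p \<in> carrier A" "p < N \<Longrightarrow> x p \<in> carrier K"
  using b x by auto

text \<open>The Gram matrix applied to a coefficient vector. The value 0 beyond \<open>N\<close>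
  makes each vector of the quotient a single function, so no equivalence classes are needed.\<close>

definition gram :: "(nat \<Rightarrow> complex) \<Rightarrow> nat \<Rightarrow> complex" where
  "gram \<xi> p = (if p < N then \<Sum>q<N. \<xi> q * ker (b p) (x p) (b q) (x q) else 0)"

text \<open>
  The purifying space is the range of the Gram matrix of the kernel; \<open>dilate a y\<close> is the image of
  the elementary tensor of \<open>a\<close> and \<open>y\<close>. Addition truncates functions outside the carrier to \<open>0\<close>,
  so that the distance is symmetric on the whole type.
\<close>

definition dilate :: "'a \<Rightarrow> 'k \<Rightarrow> nat \<Rightarrow> complex" where
  "dilate a y p = (if p < N then ker (b p) (x p) a y else 0)"

definition trunc :: "(nat \<Rightarrow> complex) \<Rightarrow> nat \<Rightarrow> complex" where
  "trunc h = (if h \<in> range gram then h else (\<lambda>_. 0))"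

definition space :: "(nat \<Rightarrow> complex) inner_space" where
  "space = \<lparr>carrier = range gram, monoid.mult = undefined, one = undefined, ring.zero = (\<lambda>_. 0),
     add = (\<lambda>f g p. trunc f p + trunc g p), module.smult = (\<lambda>c f p. c * f p),
     cinner = (\<lambda>f g. \<Sum>p<N. cnj (inv_into UNIV gram f p) * g p)\<rparr>"

lemma gram_add: "gram (\<lambda>q. \<xi> q + \<eta> q) = (\<lambda>p. gram \<xi> p + gram \<eta> p)"
  by (rule ext) (simp add: gram_def distrib_right sum.distrib)

lemma gram_scale: "gram (\<lambda>q. c * \<xi> q) = (\<lambda>p. c * gram \<xi> p)"
  by (rule ext) (simp add: gram_def sum_distrib_left mult.assoc)

lemma gram_zero: "gram (\<lambda>q. 0) = (\<lambda>p. 0)"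
  by (rule ext) (simp add: gram_def)

lemma trunc_gram [simp]: "trunc (gram \<xi>) = gram \<xi>"
  by (simp add: trunc_def)

lemma trunc_mem: "trunc h \<in> range gram"
  using gram_zero by (auto simp: trunc_def intro: range_eqI[OF sym])

lemma space_simps [simp]:
  "carrier space = range gram" "\<zero>\<^bsub>space\<^esub> = (\<lambda>_. 0)"
  "f \<oplus>\<^bsub>space\<^esub> g = (\<lambda>p. trunc f p + trunc g p)" "c \<odot>\<^bsub>space\<^esub> f = (\<lambda>p. c * f p)"
  "cinner space f g = (\<Sum>p<N. cnj (inv_into UNIV gram f p) * g p)"
  by (simp_all add: space_def)

lemma gram_hermitian: "(\<Sum>p<N. cnj (\<xi> p) * gram \<eta> p) = (\<Sum>q<N. \<eta> q * cnj (gram \<xi> q))"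
proof -
  have kc: "cnj (ker (b q) (x q) (b p) (x p)) = ker (b p) (x p) (b q) (x q)"
    if "p \<in> {..<N}" "q \<in> {..<N}" for p q
    using that by (intro ker_commute[symmetric]) auto
  have "(\<Sum>p<N. cnj (\<xi> p) * gram \<eta> p)
      = (\<Sum>p<N. \<Sum>q<N. cnj (\<xi> p) * (\<eta> q * ker (b p) (x p) (b q) (x q)))"
    by (simp add: gram_def sum_distrib_left)
  also have "\<dots> = (\<Sum>q<N. \<Sum>p<N. cnj (\<xi> p) * (\<eta> q * ker (b p) (x p) (b q) (x q)))"
    by (rule sum.swap)
  also have "\<dots> = (\<Sum>q<N. \<eta> q * (\<Sum>p<N. cnj (\<xi> p * ker (b q) (x q) (b p) (x p))))"
    unfolding sum_distrib_left by (intro sum.cong refl) (simp add: kc mult.left_commute)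
  also have "\<dots> = (\<Sum>q<N. \<eta> q * cnj (gram \<xi> q))" by (simp add: gram_def)
  finally show ?thesis .
qed

text \<open>The inner product was defined through a chosen preimage under \<open>gram\<close>. By
  \<open>gram_hermitian\<close> the sum depends on that preimage only through its image
  \<open>gram \<xi>\<close>, so any other preimage gives the same value.\<close>

lemma cinner_gram: "cinner space (gram \<xi>) (gram \<eta>) = (\<Sum>p<N. cnj (\<xi> p) * gram \<eta> p)"
  using gram_hermitian[of "inv_into UNIV gram (gram \<xi>)" \<eta>] gram_hermitian[of \<xi> \<eta>]
  by (simp add: f_inv_into_f)

text \<open>By the factorization of the kernel the quadratic form is the sum of the squared norms of
  \<open>w k\<close>, the combination of the vectors \<open>Z k q (x q)\<close> with coefficients
  \<open>\<xi> q\<close>. If it vanishes then so does every \<open>w k\<close>, and the values of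
  \<open>gram \<xi>\<close> are sums of inner products with them. Definiteness thus needs no
  Cauchy-Schwarz inequality.\<close>

lemma gram_positive:
  shows "0 \<le> Re (\<Sum>p<N. cnj (\<xi> p) * gram \<xi> p)"
    and "(\<Sum>p<N. cnj (\<xi> p) * gram \<xi> p) = 0 \<Longrightarrow> gram \<xi> = (\<lambda>_. 0)"
proof -
  obtain Z where Z: "\<And>k i. k < N \<Longrightarrow> i < N \<Longrightarrow> Z k i \<in> bounded_ops K K"
    "\<And>i j y z. i < N \<Longrightarrow> j < N \<Longrightarrow> y \<in> carrier K \<Longrightarrow> z \<in> carrier K \<Longrightarrow>
      ker (b i) y (b j) z = (\<Sum>k<N. cinner K (Z k i y) (Z k j z))"
    by (rule ker_factor[OF b]) (rule that, assumption+)
  define v where "v k p = Z k p (x p)" for k p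
  have v: "v k p \<in> carrier K" if "k < N" "p < N" for k p
    unfolding v_def by (rule K.op_apply[OF Z(1)]) (use that in auto)
  then have vPi: "v k \<in> {..<N} \<rightarrow> carrier K" if "k < N" for k using that by auto
  define w where "w k = K.comb (v k) N \<xi>" for k
  have w: "w k \<in> carrier K" if "k < N" for k
    unfolding w_def by (rule K.comb_closed[OF vPi[OF that]])
  have gw: "gram \<xi> p = (\<Sum>k<N. cinner K (v k p) (w k))" if "p < N" for p
  proof -
    have "gram \<xi> p = (\<Sum>q<N. \<xi> q * (\<Sum>k<N. cinner K (v k p) (v k q)))"
      using that by (auto simp: gram_def Z(2) v_def intro!: sum.cong)
    also have "\<dots> = (\<Sum>k<N. \<Sum>q<N. \<xi> q * cinner K (v k p) (v k q))"
      unfolding sum_distrib_left by (rule sum.swap)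
    also have "\<dots> = (\<Sum>k<N. cinner K (v k p) (w k))"
      unfolding w_def using that by (intro sum.cong refl K.cinner_comb_right[symmetric] vPi v) auto
    finally show ?thesis .
  qed
  have ww: "cinner K (w k) (w k) = (\<Sum>p<N. cnj (\<xi> p) * cinner K (v k p) (w k))" if k: "k < N" for k
  proof -
    have "cinner K (w k) (w k) = cnj (\<Sum>p<N. \<xi> p * cinner K (w k) (v k p))"
      using K.cinner_comb_right[OF vPi[OF k] w[OF k], of \<xi>] K.cinner_commute[OF w[OF k] w[OF k]]
      by (simp add: w_def)
    also have "\<dots> = (\<Sum>p<N. cnj (\<xi> p) * cinner K (v k p) (w k))"
      unfolding cnj_sum using K.cinner_commute[OF w[OF k] v[OF k]]
      by (intro sum.cong refl) simp
    finally show ?thesis .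
  qed
  have sum: "(\<Sum>p<N. cnj (\<xi> p) * gram \<xi> p) = (\<Sum>k<N. cinner K (w k) (w k))"
  proof -
    have "(\<Sum>p<N. cnj (\<xi> p) * gram \<xi> p) = (\<Sum>p<N. \<Sum>k<N. cnj (\<xi> p) * cinner K (v k p) (w k))"
      by (intro sum.cong refl) (simp add: gw sum_distrib_left)
    also have "\<dots> = (\<Sum>k<N. \<Sum>p<N. cnj (\<xi> p) * cinner K (v k p) (w k))" by (rule sum.swap)
    finally show ?thesis by (simp add: ww)
  qed
  have nonneg: "0 \<le> Re (cinner K (w k) (w k))" if "k < N" for k
    by (rule K.cinner_nonneg[OF w[OF that]])
  then show "0 \<le> Re (\<Sum>p<N. cnj (\<xi> p) * gram \<xi> p)"
    unfolding sum Re_sum by (intro sum_nonneg) simp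
  assume "(\<Sum>p<N. cnj (\<xi> p) * gram \<xi> p) = 0"
  then have "(\<Sum>k<N. Re (cinner K (w k) (w k))) = 0"
    unfolding sum by (simp flip: Re_sum)
  then have Re0: "Re (cinner K (w k) (w k)) = 0" if "k < N" for k
    using that nonneg by (subst (asm) sum_nonneg_eq_0_iff) auto
  have "w k = \<zero>\<^bsub>K\<^esub>" if "k < N" for k
  proof -
    have "Im (cinner K (w k) (w k)) = 0"
      using arg_cong[OF K.cinner_commute[OF w[OF that] w[OF that]], of Im] by simp
    then have "cinner K (w k) (w k) = 0" using Re0[OF that] by (simp add: complex_eq_iff)
    then show ?thesis using K.cinner_eq_zero[OF w[OF that]] by blast
  qed
  then have "gram \<xi> p = 0" if "p < N" for p
    using gw[OF that] v that by simp
  then show "gram \<xi> = (\<lambda>_. 0)" by (intro ext) (metis gram_def)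
qed

lemma pre_hilbert_space: "pre_hilbert_space space"
proof -
  have "abelian_group space"
  proof (rule abelian_groupI)
    fix f g h assume fgh: "f \<in> carrier space" "g \<in> carrier space" "h \<in> carrier space"
    then show "f \<oplus>\<^bsub>space\<^esub> g \<in> carrier space"
      by (auto simp flip: gram_add)
    show "f \<oplus>\<^bsub>space\<^esub> g \<oplus>\<^bsub>space\<^esub> h = f \<oplus>\<^bsub>space\<^esub> (g \<oplus>\<^bsub>space\<^esub> h)"
      using fgh by (auto simp flip: gram_add) (simp add: gram_add add.assoc)
  next
    fix f assume "f \<in> carrier space"
    then obtain \<xi> where "f = gram \<xi>" by auto
    then show "\<exists>g\<in>carrier space. g \<oplus>\<^bsub>space\<^esub> f = \<zero>\<^bsub>space\<^esub>"
      using fun_cong[OF gram_scale[of "-1" \<xi>]] by (intro bexI[of _ "gram (\<lambda>q. - \<xi> q)"]) simp_all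
  qed (use gram_zero in \<open>auto simp: trunc_def add.commute intro: range_eqI[OF sym]\<close>)
  then have mod: "module complex_field space"
  proof (rule moduleI[OF cring_complex_field])
    fix c d :: complex and f g assume f: "f \<in> carrier space"
    then obtain \<xi> where \<xi>: "f = gram \<xi>" by auto
    show "c \<odot>\<^bsub>space\<^esub> f \<in> carrier space"
      unfolding \<xi> by (simp flip: gram_scale)
    have sc: "trunc (\<lambda>p. c * gram \<xi> p) = (\<lambda>p. c * gram \<xi> p)" for c \<xi>
      by (simp flip: gram_scale)
    show "(c \<oplus>\<^bsub>complex_field\<^esub> d) \<odot>\<^bsub>space\<^esub> f = (c \<odot>\<^bsub>space\<^esub> f) \<oplus>\<^bsub>space\<^esub> (d \<odot>\<^bsub>space\<^esub> f)"
      unfolding \<xi> by (simp add: sc distrib_right)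
    show "(c \<otimes>\<^bsub>complex_field\<^esub> d) \<odot>\<^bsub>space\<^esub> f = c \<odot>\<^bsub>space\<^esub> (d \<odot>\<^bsub>space\<^esub> f)"
      by (simp add: mult.assoc)
    show "\<one>\<^bsub>complex_field\<^esub> \<odot>\<^bsub>space\<^esub> f = f" by simp
    assume "g \<in> carrier space"
    then obtain \<eta> where \<eta>: "g = gram \<eta>" by auto
    show "c \<odot>\<^bsub>space\<^esub> (f \<oplus>\<^bsub>space\<^esub> g) = (c \<odot>\<^bsub>space\<^esub> f) \<oplus>\<^bsub>space\<^esub> (c \<odot>\<^bsub>space\<^esub> g)"
      unfolding \<xi> \<eta> by (simp add: sc distrib_left)
  qed
  show ?thesis
  proof (intro pre_hilbert_space.intro mod pre_hilbert_space_axioms.intro)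
    fix f g h c assume "f \<in> carrier space"
    then obtain \<xi> where \<xi>: "f = gram \<xi>" by auto
    show "0 \<le> Re (cinner space f f)"
      unfolding \<xi> cinner_gram by (rule gram_positive)
    show "cinner space f f = 0 \<longleftrightarrow> f = \<zero>\<^bsub>space\<^esub>"
      unfolding \<xi> cinner_gram using gram_positive(2)[of \<xi>] by auto
    assume "g \<in> carrier space"
    then obtain \<eta> where \<eta>: "g = gram \<eta>" by auto
    show "cinner space f (c \<odot>\<^bsub>space\<^esub> g) = c * cinner space f g"
      by (simp add: sum_distrib_left mult.left_commute)
    show "cinner space g f = cnj (cinner space f g)"
      unfolding \<xi> \<eta> cinner_gram gram_hermitian[of \<eta> \<xi>] by (simp add: mult.commute)
    assume "h \<in> carrier space"
    then obtain \<zeta> where \<zeta>: "h = gram \<zeta>" by auto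
    show "cinner space f (g \<oplus>\<^bsub>space\<^esub> h) = cinner space f g + cinner space f h"
      unfolding \<eta> \<zeta> by (simp add: distrib_left sum.distrib)
  qed
qed

sublocale H: pre_hilbert_space space
  by (rule pre_hilbert_space)

lemma dilate_eq_gram:
  assumes "a \<in> carrier A" "y \<in> carrier K"
  obtains c where "dilate a y = gram c"
    and "\<And>F. bilinear_form A K F \<Longrightarrow> F a y = (\<Sum>p<N. c p * F (b p) (x p))"
proof -
  obtain c where c: "\<And>F. bilinear_form A K F \<Longrightarrow> F a y = (\<Sum>p<N. c p * F (b p) (x p))"
    using span[OF assms] by blast
  have "dilate a y = gram c"
    by (rule ext) (simp add: dilate_def gram_def c[OF ker_bilinear] assms)
  then show thesis using c by (rule that)
qed

lemma dilate_closed: "a \<in> carrier A \<Longrightarrow> y \<in> carrier K \<Longrightarrow> dilate a y \<in> carrier space"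
  by (erule (1) dilate_eq_gram) simp

text \<open>\<open>ker_bilinear\<close> gives linearity only in the second pair of arguments. The
  coefficients that expand \<open>(a, y)\<close> are therefore applied to \<open>ker d z\<close>,
  with \<open>ker_commute\<close> used before and after.\<close>

lemma cinner_dilate:
  assumes a: "a \<in> carrier A" and y: "y \<in> carrier K" and d: "d \<in> carrier A" and z: "z \<in> carrier K"
  shows "cinner space (dilate a y) (dilate d z) = ker a y d z"
proof -
  obtain c where c: "dilate a y = gram c"
    "\<And>F. bilinear_form A K F \<Longrightarrow> F a y = (\<Sum>p<N. c p * F (b p) (x p))"
    by (rule dilate_eq_gram[OF a y]) (rule that, assumption+)
  obtain c' where c': "dilate d z = gram c'" by (rule dilate_eq_gram[OF d z])
  have "cinner space (dilate a y) (dilate d z) = (\<Sum>p<N. cnj (c p) * dilate d z p)"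
    unfolding c(1) c' by (rule cinner_gram)
  also have "\<dots> = (\<Sum>p<N. cnj (c p) * cnj (ker d z (b p) (x p)))"
  proof (intro sum.cong refl)
    fix p assume p: "p \<in> {..<N}"
    then have "ker (b p) (x p) d z = cnj (ker d z (b p) (x p))"
      using d z by (intro ker_commute) auto
    with p show "cnj (c p) * dilate d z p = cnj (c p) * cnj (ker d z (b p) (x p))"
      by (simp add: dilate_def)
  qed
  also have "\<dots> = cnj (ker d z a y)" by (simp add: c(2)[OF ker_bilinear[OF d z]])
  also have "\<dots> = ker a y d z" using ker_commute[OF d a z y] by simp
  finally show ?thesis .
qed

abbreviation gen :: "nat \<Rightarrow> nat \<Rightarrow> complex" where
  "gen p \<equiv> dilate (b p) (x p)"

lemma gen_Pi: "gen \<in> {..<N} \<rightarrow> carrier space"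
  using dilate_closed by (simp del: space_simps)

lemma comb_apply:
  assumes "g \<in> {..<n} \<rightarrow> carrier space"
  shows "H.comb g n c p = (\<Sum>i<n. c i * g i p)"
proof -
  have closed: "(\<lambda>i. c i \<odot>\<^bsub>space\<^esub> g i) \<in> {..<n} \<rightarrow> carrier space"
    using assms H.smult_closed by (auto simp del: space_simps simp: Pi_iff)
  have "(\<Oplus>\<^bsub>space\<^esub>i\<in>{..<n}. c i \<odot>\<^bsub>space\<^esub> g i) p = (\<Sum>i<n. (c i \<odot>\<^bsub>space\<^esub> g i) p)"
    by (rule H.additive_finsum[where f = "\<lambda>h. h p", OF _ closed]) auto
  then show ?thesis by (simp add: H.comb_def)
qed

lemma gram_eq_comb: "gram c = H.comb gen N c"
  by (rule ext) (simp only: comb_apply[OF gen_Pi], simp add: gram_def dilate_def)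

lemma space_eq_comb:
  assumes "h \<in> carrier space"
  obtains c where "h = H.comb gen N c"
  using assms gram_eq_comb by auto

lemma onb_space: obtains e n where "H.onb e n"
proof (rule H.onb_of_generators[OF gen_Pi])
  fix v assume "v \<in> carrier space"
  then obtain c where "v = H.comb gen N c" by (rule space_eq_comb)
  then show "\<exists>c. v = (\<Oplus>\<^bsub>space\<^esub>i\<in>{..<N}. c i \<odot>\<^bsub>space\<^esub> gen i)"
    unfolding H.comb_def by blast
qed (rule that)

lemma fin_dim_space: "fin_dim space"
  by (rule onb_space) (rule H.fin_dim_onb)

sublocale H: fin_hilbert_space space
  by unfold_locales (rule fin_dim_space)

text \<open>An element off the carrier is truncated to 0, so only \<open>h = 0\<close> satisfies the
  definite description of its additive inverse.\<close>

lemma a_inv_off_carrier: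
  assumes "g \<notin> carrier space"
  shows "\<ominus>\<^bsub>space\<^esub> g = \<zero>\<^bsub>space\<^esub>"
proof -
  have "(THE h. h \<in> carrier space \<and> g \<oplus>\<^bsub>space\<^esub> h = \<zero>\<^bsub>space\<^esub> \<and> h \<oplus>\<^bsub>space\<^esub> g = \<zero>\<^bsub>space\<^esub>)
      = \<zero>\<^bsub>space\<^esub>"
  proof (rule the_equality)
    show "\<zero>\<^bsub>space\<^esub> \<in> carrier space \<and> g \<oplus>\<^bsub>space\<^esub> \<zero>\<^bsub>space\<^esub> = \<zero>\<^bsub>space\<^esub> \<and>
        \<zero>\<^bsub>space\<^esub> \<oplus>\<^bsub>space\<^esub> g = \<zero>\<^bsub>space\<^esub>"
      using assms H.M.zero_closed by (auto simp: trunc_def)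
  next
    fix h assume "h \<in> carrier space \<and> g \<oplus>\<^bsub>space\<^esub> h = \<zero>\<^bsub>space\<^esub> \<and> h \<oplus>\<^bsub>space\<^esub> g = \<zero>\<^bsub>space\<^esub>"
    then show "h = \<zero>\<^bsub>space\<^esub>" using assms by (auto simp: trunc_def)
  qed
  then show ?thesis by (simp add: a_inv_def m_inv_def)
qed

text \<open>Addition truncates both operands, and inverses off the carrier are 0. This yields the
  closure and the symmetry on the whole type that \<open>hilbert_space_onb\<close> demands.\<close>

lemma space_minus: "f \<ominus>\<^bsub>space\<^esub> g = trunc f \<ominus>\<^bsub>space\<^esub> trunc g"
proof -
  have tt: "trunc (trunc h) = trunc h" for h using trunc_mem[of h] by (auto simp: trunc_def)
  have "\<ominus>\<^bsub>space\<^esub> (trunc g) = \<ominus>\<^bsub>space\<^esub> g"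
  proof (cases "g \<in> carrier space")
    case False
    then have "trunc g = \<zero>\<^bsub>space\<^esub>" by (auto simp: trunc_def)
    then show ?thesis using a_inv_off_carrier[OF False] abelian_group.minus_equality[OF H.M.abelian_group_axioms, of "\<zero>\<^bsub>space\<^esub>" "\<zero>\<^bsub>space\<^esub>"]
      H.M.zero_closed H.M.l_zero[OF H.M.zero_closed] by (simp del: space_simps)
  qed (auto simp: trunc_def)
  then show ?thesis by (simp add: a_minus_def tt)
qed

lemma hilbert_space_space: "hilbert_space space"
proof -
  obtain e n where e: "H.onb e n" by (rule onb_space)
  have closed: "f \<ominus>\<^bsub>space\<^esub> g \<in> carrier space" for f g
    unfolding space_minus[of f g] using trunc_mem by (intro H.M.minus_closed) (auto simp del: space_simps simp: space_simps(1))
  have "hnorm space (f \<ominus>\<^bsub>space\<^esub> g) = hnorm space (g \<ominus>\<^bsub>space\<^esub> f)" for f g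
  proof -
    let ?f = "trunc f" and ?g = "trunc g"
    have fg: "?f \<in> carrier space" "?g \<in> carrier space" using trunc_mem by auto
    have "cinner space (?f \<ominus>\<^bsub>space\<^esub> ?g) (?f \<ominus>\<^bsub>space\<^esub> ?g) = cinner space (?g \<ominus>\<^bsub>space\<^esub> ?f) (?g \<ominus>\<^bsub>space\<^esub> ?f)"
      using fg by (simp add: H.cinner_diff_left H.cinner_diff_right H.M.minus_closed del: space_simps)
    then show ?thesis
      unfolding space_minus[of f g] space_minus[of g f] hnorm_def by (simp only:)
  qed
  then show ?thesis by (rule H.hilbert_space_onb[OF e closed])
qed

text \<open>
  \<open>a\<close> acts by \<open>dilate d y \<mapsto> dilate (a \<otimes> d) y\<close>. Reading off coordinates against the moved kernel
  vectors makes this well defined on the range of the Gram matrix.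
\<close>

definition rep :: "'a \<Rightarrow> (nat \<Rightarrow> complex) \<Rightarrow> nat \<Rightarrow> complex" where
  "rep a = (\<lambda>h\<in>carrier space. \<lambda>p.
     if p < N then cinner space (dilate (star A a \<otimes> b p) (x p)) h else 0)"

definition embed :: "'k \<Rightarrow> nat \<Rightarrow> complex" where
  "embed = (\<lambda>y\<in>carrier K. dilate \<one> y)"

lemma one_closed_A [simp]: "\<one> \<in> carrier A" and mult_closed_A [simp]:
  "a \<in> carrier A \<Longrightarrow> d \<in> carrier A \<Longrightarrow> a \<otimes> d \<in> carrier A"
  using ring.ring_simprules(5,6)[OF ring_A] by auto

text \<open>Coordinate \<open>p\<close> of the left side is the kernel between
  \<open>star A a \<otimes> b p\<close> and \<open>d\<close>; \<open>ker_move\<close> carries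
  \<open>a\<close> over to \<open>d\<close>.\<close>

lemma rep_dilate:
  assumes a: "a \<in> carrier A" and d: "d \<in> carrier A" and y: "y \<in> carrier K"
  shows "rep a (dilate d y) = dilate (a \<otimes> d) y"
proof (rule ext)
  fix p
  show "rep a (dilate d y) p = dilate (a \<otimes> d) y p"
  proof (cases "p < N")
    case True
    then show ?thesis
      using a d y dilate_closed[OF d y]
      by (simp add: rep_def cinner_dilate star_closed dilate_def[of "a \<otimes> d"] ker_move del: space_simps)
  qed (use dilate_closed[OF d y] in \<open>simp add: rep_def dilate_def del: space_simps\<close>)
qed

text \<open>The coordinates defining \<open>rep a\<close> do not show that its values lie in the
  range of the Gram matrix; this expansion does.\<close>

lemma rep_comb:
  assumes a: "a \<in> carrier A"
  shows "rep a (H.comb gen N c) = H.comb (\<lambda>q. dilate (a \<otimes> b q) (x q)) N c"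
proof (rule ext)
  fix p
  have Pi: "(\<lambda>q. dilate (a \<otimes> b q) (x q)) \<in> {..<N} \<rightarrow> carrier space"
    using a dilate_closed by (simp del: space_simps)
  have "rep a (gen q) p = dilate (a \<otimes> b q) (x q) p" if "q < N" for q
    using that a by (simp add: rep_dilate)
  moreover have "rep a (gen q) p = (if p < N then cinner space (dilate (star A a \<otimes> b p) (x p)) (gen q) else 0)"
    if "q < N" for q using that dilate_closed by (simp add: rep_def del: space_simps)
  ultimately have *: "dilate (a \<otimes> b q) (x q) p
      = (if p < N then cinner space (dilate (star A a \<otimes> b p) (x p)) (gen q) else 0)"
    if "q < N" for q using that by simp
  have "rep a (H.comb gen N c) p = (if p < N then
      (\<Sum>q<N. c q * cinner space (dilate (star A a \<otimes> b p) (x p)) (gen q)) else 0)"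
    using a dilate_closed star_closed H.comb_closed[OF gen_Pi]
    by (simp add: rep_def H.cinner_comb_right[OF gen_Pi] del: space_simps)
  also have "\<dots> = (\<Sum>q<N. c q * dilate (a \<otimes> b q) (x q) p)" by (simp add: *)
  finally show "rep a (H.comb gen N c) p = H.comb (\<lambda>q. dilate (a \<otimes> b q) (x q)) N c p"
    by (simp only: comb_apply[OF Pi])
qed

lemma rep_bounded:
  assumes a: "a \<in> carrier A"
  shows "rep a \<in> bounded_ops space space"
proof -
  have "rep a = (\<lambda>h\<in>carrier space. rep a h)" by (auto simp: rep_def)
  also have "\<dots> \<in> bounded_ops space space"
  proof (rule H.bounded_opsI)
    fix h assume h: "h \<in> carrier space"
    then obtain c where c: "h = H.comb gen N c" by (rule space_eq_comb)
    show rh: "rep a h \<in> carrier space"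
      unfolding c rep_comb[OF a]
      by (rule H.comb_closed) (use a dilate_closed in \<open>simp del: space_simps\<close>)
    have w: "dilate (star A a \<otimes> b p) (x p) \<in> carrier space" if "p < N" for p
      using that a star_closed by (intro dilate_closed) auto
    show "rep a (c \<odot>\<^bsub>space\<^esub> h) = c \<odot>\<^bsub>space\<^esub> rep a h" for c
    proof (rule ext)
      fix p
      have "c \<odot>\<^bsub>space\<^esub> h \<in> carrier space" using h by (intro H.smult_closed) simp_all
      then show "rep a (c \<odot>\<^bsub>space\<^esub> h) p = (c \<odot>\<^bsub>space\<^esub> rep a h) p"
        unfolding space_simps(4)[of c "rep a h"]
        using h H.cinner_smult_right[OF w h] by (simp add: rep_def del: space_simps)
    qed
    fix g assume g: "g \<in> carrier space"
    have "g \<in> carrier space \<Longrightarrow> rep a g \<in> carrier space" for g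
    proof (erule space_eq_comb)
      fix c assume c: "g = H.comb gen N c"
      show "rep a g \<in> carrier space"
        unfolding c rep_comb[OF a]
        by (rule H.comb_closed) (use a dilate_closed in \<open>simp del: space_simps\<close>)
    qed
    then have t: "trunc (rep a h) = rep a h" "trunc (rep a g) = rep a g"
      using h g by (auto simp: trunc_def)
    show "rep a (h \<oplus>\<^bsub>space\<^esub> g) = rep a h \<oplus>\<^bsub>space\<^esub> rep a g"
    proof (rule ext)
      fix p
      have "h \<oplus>\<^bsub>space\<^esub> g \<in> carrier space" using h g by (rule H.M.a_closed)
      then show "rep a (h \<oplus>\<^bsub>space\<^esub> g) p = (rep a h \<oplus>\<^bsub>space\<^esub> rep a g) p"
        unfolding space_simps(3)[of "rep a h" "rep a g"] t
        using h g H.cinner_add_right[OF w h g] by (simp add: rep_def del: space_simps)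
    qed
  qed
  finally show ?thesis .
qed

text \<open>The vectors \<open>gen q\<close> span, so each homomorphism law for \<open>rep\<close>
  has to be checked only on them, where \<open>rep_dilate\<close> reduces it to a law of
  \<open>A\<close>.\<close>

lemma op_eqI:
  assumes S: "S \<in> bounded_ops space space" and T: "T \<in> bounded_ops space space"
    and eq: "\<And>q. q < N \<Longrightarrow> S (gen q) = T (gen q)"
  shows "S = T"
proof (rule extensionalityI)
  fix h assume "h \<in> carrier space"
  then obtain c where c: "h = H.comb gen N c" by (rule space_eq_comb)
  note H = H.pre_hilbert_space_axioms
  have "H.comb (\<lambda>q. S (gen q)) N c = H.comb (\<lambda>q. T (gen q)) N c"
    unfolding H.comb_def
  proof (rule H.M.finsum_cong')
    show "(\<lambda>q. c q \<odot>\<^bsub>space\<^esub> T (gen q)) \<in> {..<N} \<rightarrow> carrier space"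
      using gen_Pi bounded_opsD(3)[OF T] by (auto simp: Pi_iff simp del: space_simps intro!: H.smult_closed)
  qed (simp_all add: eq)
  then show "S h = T h"
    unfolding c linear_map_comb[OF H H bounded_opsD(1)[OF S] gen_Pi]
      linear_map_comb[OF H H bounded_opsD(1)[OF T] gen_Pi] .
qed (rule bounded_opsD(2)[OF S], rule bounded_opsD(2)[OF T])

lemma dilate_add_left:
  assumes "a \<in> carrier A" "d \<in> carrier A" "y \<in> carrier K"
  shows "dilate (a \<oplus> d) y = dilate a y \<oplus>\<^bsub>space\<^esub> dilate d y"
proof -
  have "trunc (dilate a y) = dilate a y" "trunc (dilate d y) = dilate d y"
    using dilate_closed assms by (auto simp: trunc_def)
  moreover have "ker (b p) (x p) (a \<oplus> d) y = ker (b p) (x p) a y + ker (b p) (x p) d y" if "p < N" for p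
    using ker_bilinear[of "b p" "x p"] that assms
    by (auto simp: bilinear_form_def linear_functional_def)
  ultimately show ?thesis by (auto simp: dilate_def)
qed

lemma dilate_add_right:
  assumes "a \<in> carrier A" "y \<in> carrier K" "z \<in> carrier K"
  shows "dilate a (y \<oplus>\<^bsub>K\<^esub> z) = dilate a y \<oplus>\<^bsub>space\<^esub> dilate a z"
proof -
  have "trunc (dilate a y) = dilate a y" "trunc (dilate a z) = dilate a z"
    using dilate_closed assms by (auto simp: trunc_def)
  moreover have "ker (b p) (x p) a (y \<oplus>\<^bsub>K\<^esub> z) = ker (b p) (x p) a y + ker (b p) (x p) a z" if "p < N" for p
    using ker_bilinear[of "b p" "x p"] that assms
    by (auto simp: bilinear_form_def linear_functional_def)
  ultimately show ?thesis by (auto simp: dilate_def)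
qed

lemma dilate_smult:
  assumes "a \<in> carrier A" "y \<in> carrier K"
  shows "dilate (c \<odot> a) y = c \<odot>\<^bsub>space\<^esub> dilate a y" "dilate a (c \<odot>\<^bsub>K\<^esub> y) = c \<odot>\<^bsub>space\<^esub> dilate a y"
proof -
  have "ker (b p) (x p) (c \<odot> a) y = c * ker (b p) (x p) a y"
    "ker (b p) (x p) a (c \<odot>\<^bsub>K\<^esub> y) = c * ker (b p) (x p) a y" if "p < N" for p
    using ker_bilinear[of "b p" "x p"] that assms
    by (auto simp: bilinear_form_def linear_functional_def)
  then show "dilate (c \<odot> a) y = c \<odot>\<^bsub>space\<^esub> dilate a y" "dilate a (c \<odot>\<^bsub>K\<^esub> y) = c \<odot>\<^bsub>space\<^esub> dilate a y"
    by (auto simp: dilate_def)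
qed

lemma star_hom_rep: "star_hom A (op_algebra space) rep"
proof -
  have gc: "gen q \<in> carrier space" if "q < N" for q using that by (intro dilate_closed) auto
  have mult: "rep (a \<otimes> d) = rep a \<otimes>\<^bsub>op_algebra space\<^esub> rep d" if "a \<in> carrier A" "d \<in> carrier A" for a d
    unfolding op_algebra_simps
    by (rule op_eqI) (use that gc in \<open>auto simp: rep_bounded H.op_closed compose_eq rep_dilate A_assoc
      simp del: space_simps\<close>)
  have add: "rep (a \<oplus> d) = rep a \<oplus>\<^bsub>op_algebra space\<^esub> rep d" if "a \<in> carrier A" "d \<in> carrier A" for a d
    unfolding op_algebra_simps
    by (rule op_eqI) (use that gc in \<open>auto simp: rep_bounded H.op_closed rep_dilate A_l_distr
      dilate_add_left simp del: space_simps\<close>)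
  have smult: "rep (c \<odot> a) = c \<odot>\<^bsub>op_algebra space\<^esub> rep a" if "a \<in> carrier A" for a c
    unfolding op_algebra_simps
    by (rule op_eqI) (use that gc in \<open>auto simp: rep_bounded H.op_closed(3)[OF rep_bounded rep_bounded]
      rep_dilate smult_mult_left dilate_smult simp del: space_simps\<close>)
  have id: "(\<lambda>h\<in>carrier space. h) \<in> bounded_ops space space"
    by (rule H.bounded_opsI) (assumption | rule refl)+
  have one: "rep \<one> = \<one>\<^bsub>op_algebra space\<^esub>"
    unfolding op_algebra_simps
    by (rule op_eqI) (use id gc ring.ring_simprules(12)[OF ring_A] in \<open>auto simp: rep_bounded rep_dilate
      simp del: space_simps\<close>)
  have star: "rep (star A a) = star (op_algebra space) (rep a)" if a: "a \<in> carrier A" for a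
    unfolding op_algebra_simps
  proof (rule op_eqI)
    show "rep (star A a) \<in> bounded_ops space space" by (rule rep_bounded) (simp add: a star_closed)
    show "hadjoint space space (rep a) \<in> bounded_ops space space"
      using rep_bounded[OF a] H.op_closed(4) by blast
    fix q assume q: "q < N"
    have sa: "star A a \<in> carrier A" using a by (rule star_closed)
    show "rep (star A a) (gen q) = hadjoint space space (rep a) (gen q)"
    proof (rule sym, rule hadjoint_eqI[OF H.pre_hilbert_space_axioms gc[OF q]])
      show w: "rep (star A a) (gen q) \<in> carrier space"
        by (rule H.op_apply[OF rep_bounded[OF sa] gc[OF q]])
      fix h assume "h \<in> carrier space"
      then obtain c where c: "h = H.comb gen N c" by (rule space_eq_comb)
      have Pi: "(\<lambda>q. dilate (a \<otimes> b q) (x q)) \<in> {..<N} \<rightarrow> carrier space"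
        using a dilate_closed by (simp del: space_simps)
      \<comment> \<open>Tested against spanning vectors, the adjoint relation is exactly
        \<open>ker_move\<close>.\<close>
      have "cinner space (rep (star A a) (gen q)) (gen r) = cinner space (gen q) (dilate (a \<otimes> b r) (x r))"
        if "r < N" for r
        using that q a sa by (simp add: rep_dilate cinner_dilate ker_move del: space_simps)
      then show "cinner space (rep (star A a) (gen q)) h = cinner space (gen q) (rep a h)"
        unfolding c rep_comb[OF a] H.cinner_comb_right[OF gen_Pi w] H.cinner_comb_right[OF Pi gc[OF q]]
        by simp
    qed
  qed
  have "linear_map A (op_algebra space) rep"
    unfolding linear_map_def using add smult rep_bounded by (simp del: op_algebra_simps(2-) add: Pi_iff)
  moreover have "rep \<in> ring_hom A (op_algebra space)"
    unfolding ring_hom_def using add mult one rep_bounded by (simp del: op_algebra_simps(2-) add: Pi_iff)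
  ultimately show ?thesis unfolding star_hom_def using star by blast
qed

lemma embed_bounded: "embed \<in> bounded_ops K space"
  unfolding bounded_ops_iff[OF K.fin_hilbert_space H.fin_hilbert_space]
proof
  show "embed \<in> extensional (carrier K)" by (simp add: embed_def)
  have "linear_map K space (dilate \<one>)"
    unfolding linear_map_def
    using dilate_closed dilate_add_right dilate_smult(2) by (simp del: space_simps)
  then show "linear_map K space embed"
    unfolding embed_def by (rule linear_map_restrict[OF K.module_axioms])
qed

lemma purification_space: "purification A K \<phi> space rep embed"
  unfolding purification_def
proof (intro conjI ballI hilbert_space_space star_hom_rep embed_bounded)
  fix a assume a: "a \<in> carrier A"
  show "compose (carrier K) (hadjoint K space embed) (compose (carrier K) (rep a) embed) = \<phi> a"
  proof (rule extensionalityI[of _ "carrier K"])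
    show "\<phi> a \<in> extensional (carrier K)" by (rule bounded_opsD(2)[OF phi_bounded[OF a]])
    fix y assume y: "y \<in> carrier K"
    have ra: "rep a (embed y) = dilate a y"
      using a y ring.ring_simprules(12)[OF ring_A]
      by (simp add: embed_def rep_dilate monoid.r_one[OF ring.is_monoid[OF ring_A]])
    have "hadjoint K space embed (dilate a y) = \<phi> a y"
    proof (rule hadjoint_eqI[OF K.pre_hilbert_space_axioms dilate_closed[OF a y] phi_op(1)[OF a y]])
      fix z assume z: "z \<in> carrier K"
      \<comment> \<open>Obtained by taking stars in
        \<open>star A a \<otimes> \<one> = star A a\<close>.\<close>
      have s1: "star A \<one> \<otimes> a = a"
        using a ring.ring_simprules(12)[OF ring_A] monoid.r_one[OF ring.is_monoid[OF ring_A]]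
        by (metis one_closed_A star_closed star_mult star_star)
      have "cinner K (\<phi> a y) z = cnj (cinner K z (\<phi> a y))"
        by (rule K.cinner_commute[OF z phi_op(1)[OF a y]])
      also have "\<dots> = cnj (ker \<one> z a y)" by (simp add: ker_def s1)
      also have "\<dots> = ker a y \<one> z"
        using ker_commute[OF one_closed_A a z y] by simp
      also have "\<dots> = cinner space (dilate a y) (embed z)"
        using cinner_dilate[OF a y one_closed_A z] z by (simp add: embed_def del: space_simps)
      finally show "cinner K (\<phi> a y) z = cinner space (dilate a y) (embed z)" .
    qed
    then show "compose (carrier K) (hadjoint K space embed) (compose (carrier K) (rep a) embed) y = \<phi> a y"
      using y ra by (simp add: compose_eq)
  qed simp
qed

end

lemma purification_exists:
  fixes A :: "('a, 'm) cstar_algebra_scheme" and K :: "('k, 'n) inner_space_scheme"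
  assumes "cstar_algebra A" "fin_dim A" "hilbert_space K" "fin_dim K" "ocp_map A K \<phi>"
  shows "\<exists>(H :: (nat \<Rightarrow> complex) inner_space) \<pi> V. fin_dim H \<and> purification A K \<phi> H \<pi> V"
proof -
  interpret A: cstar_algebra A by fact
  interpret K: hilbert_space K by fact
  have mA: "module complex_field A" by (rule cstar_algebra.axioms(2)[OF assms(1)])
  obtain n :: nat and b x where "b \<in> {..<n} \<rightarrow> carrier A" "x \<in> {..<n} \<rightarrow> carrier K"
    "\<And>a y. a \<in> carrier A \<Longrightarrow> y \<in> carrier K \<Longrightarrow>
      \<exists>c. \<forall>F. bilinear_form A K F \<longrightarrow> F a y = (\<Sum>p<n. c p * F (b p) (x p))"
    by (rule tensor_generators[OF mA assms(2) K.module_axioms assms(4)]) (rule that, assumption+)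
  then interpret gns A K \<phi> n b x
    using assms(4,5) by unfold_locales (auto simp: ocp_map_def)
  show ?thesis using fin_dim_space purification_space by blast
qed

section \<open>Uniqueness up to a unitary intertwiner\<close>

lemma fin_hilbert_spaceI:
  assumes "hilbert_space H" "fin_dim H"
  shows "fin_hilbert_space H"
proof -
  interpret hilbert_space H by fact
  show ?thesis by unfold_locales fact
qed

lemma unitary_cinner:
  assumes H: "fin_hilbert_space H" and I: "fin_hilbert_space I" and S: "unitary_op H I S"
    and x: "x \<in> carrier H" and y: "y \<in> carrier H"
  shows "cinner I (S x) (S y) = cinner H x y"
proof -
  have "S \<in> bounded_ops H I" using S by (simp add: unitary_op_def)
  note Sb = bounded_opsD[OF this]
  have "compose (carrier H) (hadjoint H I S) S x = x"
    using S x by (simp add: unitary_op_def)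
  then have "hadjoint H I S (S x) = x" using x by (simp add: compose_eq)
  then show ?thesis using cinner_hadjoint[OF H I Sb(1) Sb(3)[OF x] y] by simp
qed

lemma unitary_onb:
  assumes H: "fin_hilbert_space H" and I: "fin_hilbert_space I" and S: "unitary_op H I S"
    and e: "pre_hilbert_space.onb H e n"
  shows "pre_hilbert_space.onb I (\<lambda>i. S (e i)) n"
proof -
  interpret H: fin_hilbert_space H by fact
  interpret I: fin_hilbert_space I by fact
  have "S \<in> bounded_ops H I" using S by (simp add: unitary_op_def)
  note Sb = bounded_opsD[OF this]
  have ec: "i < n \<Longrightarrow> e i \<in> carrier H" for i by (rule H.onb_closed[OF e])
  have "I.proj (\<lambda>i. S (e i)) n y = y" if y: "y \<in> carrier I" for y
  proof -
    let ?z = "hadjoint H I S y"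
    have z: "?z \<in> carrier H" by (rule hadjoint_closed[OF H I Sb(1) y])
    have "compose (carrier I) S (hadjoint H I S) y = y"
      using S y by (simp add: unitary_op_def)
    then have Sz: "S ?z = y" using y by (simp add: compose_eq)
    have coeff: "cinner I (S (e i)) y = cinner H (e i) ?z" if "i < n" for i
      using unitary_cinner[OF H I S ec[OF that] z] Sz by simp
    have "?z = H.comb e n (\<lambda>i. cinner H (e i) ?z)"
      using H.onb_expand[OF e z] by (simp add: H.comb_def)
    then have "y = S (H.comb e n (\<lambda>i. cinner H (e i) ?z))" using Sz by simp
    also have "\<dots> = I.comb (\<lambda>i. S (e i)) n (\<lambda>i. cinner H (e i) ?z)"
      by (rule linear_map_comb[OF H.pre_hilbert_space_axioms I.pre_hilbert_space_axioms Sb(1) H.onb_Pi[OF e]])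
    also have "\<dots> = I.proj (\<lambda>i. S (e i)) n y"
      unfolding I.comb_def I.proj_def
      by (rule I.M.finsum_cong') (auto simp: coeff ec Sb intro!: I.smult_closed)
    finally show ?thesis ..
  qed
  then show ?thesis
    using ec Sb(3) H.onb_inner[OF e]
    by (auto simp: I.onb_def I.orthonormal_def unitary_cinner[OF H I S])
qed

section \<open>Operators given by matrices\<close>

definition matrix_op ::
  "('a, 'm) inner_space_scheme \<Rightarrow> ('b, 'n) inner_space_scheme \<Rightarrow> (nat \<Rightarrow> 'a) \<Rightarrow> (nat \<Rightarrow> 'b) \<Rightarrow>
   nat \<Rightarrow> (nat \<Rightarrow> nat \<Rightarrow> complex) \<Rightarrow> 'a \<Rightarrow> 'b" where
  "matrix_op H I e f n u = (\<lambda>x\<in>carrier H.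
     pre_hilbert_space.comb I f n (\<lambda>i. \<Sum>j<n. u i j * cinner H (e j) x))"

locale two_bases = H: fin_hilbert_space H + I: fin_hilbert_space I
  for H :: "('a, 'm) inner_space_scheme" and I :: "('b, 'n) inner_space_scheme" +
  fixes e f and n :: nat
  assumes e: "H.onb e n" and f: "I.onb f n"
begin

lemma ec: "i < n \<Longrightarrow> e i \<in> carrier H" and fc: "i < n \<Longrightarrow> f i \<in> carrier I"
  using H.onb_closed[OF e] I.onb_closed[OF f] by auto

lemma matrix_op_closed: "x \<in> carrier H \<Longrightarrow> matrix_op H I e f n u x \<in> carrier I"
  by (simp add: matrix_op_def I.comb_closed[OF I.onb_Pi[OF f]])

lemma coord_matrix_op:
  "i < n \<Longrightarrow> x \<in> carrier H \<Longrightarrow>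
    cinner I (f i) (matrix_op H I e f n u x) = (\<Sum>j<n. u i j * cinner H (e j) x)"
  by (simp add: matrix_op_def I.cinner_basis_comb[OF f])

lemma matrix_op_bounded: "matrix_op H I e f n u \<in> bounded_ops H I"
  unfolding bounded_ops_iff[OF H.fin_hilbert_space I.fin_hilbert_space]
proof
  show "matrix_op H I e f n u \<in> extensional (carrier H)" by (simp add: matrix_op_def)
  show "linear_map H I (matrix_op H I e f n u)"
    unfolding linear_map_def
  proof (intro conjI ballI allI)
    fix x y c assume x: "x \<in> carrier H"
    show "matrix_op H I e f n u (c \<odot>\<^bsub>H\<^esub> x) = c \<odot>\<^bsub>I\<^esub> matrix_op H I e f n u x"
      by (rule I.onb_eqI[OF f])
        (use x in \<open>simp_all add: matrix_op_closed coord_matrix_op fc ec H.cinner_smult_right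
          I.cinner_smult_right sum_distrib_left mult.left_commute\<close>)
    assume y: "y \<in> carrier H"
    show "matrix_op H I e f n u (x \<oplus>\<^bsub>H\<^esub> y) = matrix_op H I e f n u x \<oplus>\<^bsub>I\<^esub> matrix_op H I e f n u y"
      by (rule I.onb_eqI[OF f])
        (use x y in \<open>simp_all add: matrix_op_closed coord_matrix_op fc ec H.cinner_add_right
          I.cinner_add_right sum.distrib distrib_left\<close>)
  qed (use matrix_op_closed in auto)
qed

end

lemma hadjoint_matrix_op:
  assumes "two_bases H I e f n"
  shows "hadjoint H I (matrix_op H I e f n u) = matrix_op I H f e n (\<lambda>i j. cnj (u j i))"
proof -
  interpret two_bases H I e f n by fact
  interpret op: two_bases I H f e n by unfold_locales (fact f e)+
  show ?thesis
  proof (rule extensionalityI[of _ "carrier I"])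
    fix y assume y: "y \<in> carrier I"
    show "hadjoint H I (matrix_op H I e f n u) y = matrix_op I H f e n (\<lambda>i j. cnj (u j i)) y"
    proof (rule hadjoint_eqI[OF H.pre_hilbert_space_axioms y op.matrix_op_closed[OF y]])
      fix z assume z: "z \<in> carrier H"
      have "cinner H (matrix_op I H f e n (\<lambda>i j. cnj (u j i)) y) z
          = (\<Sum>i<n. \<Sum>j<n. u j i * cnj (cinner I (f j) y) * cinner H (e i) z)"
        by (simp add: H.parseval[OF e op.matrix_op_closed[OF y] z] op.coord_matrix_op y sum_distrib_right)
      also have "\<dots> = (\<Sum>j<n. \<Sum>i<n. u j i * cnj (cinner I (f j) y) * cinner H (e i) z)"
        by (rule sum.swap)
      also have "\<dots> = cinner I y (matrix_op H I e f n u z)"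
        by (simp add: I.parseval[OF f y matrix_op_closed[OF z]] coord_matrix_op z sum_distrib_left mult_ac)
      finally show "cinner H (matrix_op I H f e n (\<lambda>i j. cnj (u j i)) y) z
          = cinner I y (matrix_op H I e f n u z)" .
    qed
  qed (simp_all add: hadjoint_def matrix_op_def)
qed

lemma matrix_op_inverse:
  assumes "two_bases H I e f n"
    and inv: "\<And>i j. i < n \<Longrightarrow> j < n \<Longrightarrow> (\<Sum>k<n. v i k * u k j) = (if i = j then 1 else 0)"
  shows "compose (carrier H) (matrix_op I H f e n v) (matrix_op H I e f n u) = (\<lambda>x\<in>carrier H. x)"
proof -
  interpret two_bases H I e f n by fact
  interpret op: two_bases I H f e n by unfold_locales (fact f e)+
  show ?thesis
  proof (rule extensionalityI[of _ "carrier H"])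
    fix x assume x: "x \<in> carrier H"
    have "matrix_op I H f e n v (matrix_op H I e f n u x) = x"
    proof (rule H.onb_eqI[OF e _ x])
      show "matrix_op I H f e n v (matrix_op H I e f n u x) \<in> carrier H"
        by (intro op.matrix_op_closed matrix_op_closed x)
      fix i assume i: "i < n"
      have "cinner H (e i) (matrix_op I H f e n v (matrix_op H I e f n u x))
          = (\<Sum>k<n. \<Sum>j<n. v i k * u k j * cinner H (e j) x)"
        using i x by (simp add: op.coord_matrix_op matrix_op_closed coord_matrix_op sum_distrib_left mult.assoc)
      also have "\<dots> = (\<Sum>j<n. \<Sum>k<n. v i k * u k j * cinner H (e j) x)" by (rule sum.swap)
      also have "\<dots> = (\<Sum>j<n. (if i = j then 1 else 0) * cinner H (e j) x)"
        using i by (intro sum.cong refl) (simp add: inv flip: sum_distrib_right)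
      also have "\<dots> = (\<Sum>j<n. if j = i then cinner H (e j) x else 0)"
        by (intro sum.cong refl) simp
      also have "\<dots> = cinner H (e i) x" using i by simp
      finally show "cinner H (e i) (matrix_op I H f e n v (matrix_op H I e f n u x)) = cinner H (e i) x" .
    qed
    then show "compose (carrier H) (matrix_op I H f e n v) (matrix_op H I e f n u) x = (\<lambda>x\<in>carrier H. x) x"
      using x by (simp add: compose_eq)
  qed simp_all
qed

text \<open>A unitary of the ring \<open>cmat\<close> may mix the first \<open>n\<close> coordinates
  with the rest. The assumption \<open>block\<close> excludes this and cuts the sums in
  \<open>adj U * U\<close> and \<open>U * adj U\<close> down to \<open>{..<n}\<close>.\<close>

lemma unitary_matrix_op:
  assumes bases: "two_bases H I e f n"
    and U: "adj U * U = 1" "U * adj U = 1"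
    and block: "\<And>i j. i < n \<Longrightarrow> n \<le> j \<Longrightarrow> entry U i j = 0 \<and> entry U j i = 0"
  shows "unitary_op H I (matrix_op H I e f n (entry U))"
proof -
  interpret two_bases H I e f n by fact
  have op: "two_bases I H f e n" by unfold_locales (fact f e)+
  have "(\<Sum>k<n. cnj (entry U k i) * entry U k j) = (if i = j then 1 else 0)" if "i < n" "j < n" for i j
  proof -
    have "(\<Sum>k<n. cnj (entry U k i) * entry U k j) = entry (adj U * U) i j"
      using block that by (subst entry_times_sum[of "{..<n}"]) (auto simp: not_less)
    then show ?thesis by (simp add: U)
  qed
  moreover have "(\<Sum>k<n. entry U i k * cnj (entry U j k)) = (if i = j then 1 else 0)" if "i < n" "j < n" for i j
  proof -
    have "(\<Sum>k<n. entry U i k * cnj (entry U j k)) = entry (U * adj U) i j"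
      using block that by (subst entry_times_sum[of "{..<n}"]) (auto simp: not_less)
    then show ?thesis by (simp add: U)
  qed
  ultimately show ?thesis
    unfolding unitary_op_def hadjoint_matrix_op[OF bases]
    by (intro conjI matrix_op_bounded matrix_op_inverse[OF bases] matrix_op_inverse[OF op])
qed

section \<open>A purification in coordinates\<close>

text \<open>Interpreted once for each purification with the same \<open>b\<close>, \<open>x\<close>
  and \<open>c\<close>. The expansion coefficients are a function fixed in advance, so both
  interpretations speak of the same coefficient matrices.\<close>

locale purified = cp_map A K \<phi> + H: fin_hilbert_space H
  for A :: "('a, 'm) cstar_algebra_scheme" (structure)
    and K :: "('k, 'n) inner_space_scheme" and \<phi> and H :: "('h, 'o) inner_space_scheme" +
  fixes \<pi> :: "'a \<Rightarrow> 'h \<Rightarrow> 'h" and V :: "'k \<Rightarrow> 'h" and e :: "nat \<Rightarrow> 'h" and n :: nat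
    and N :: nat and b :: "nat \<Rightarrow> 'a" and x :: "nat \<Rightarrow> 'k" and c :: "'a \<Rightarrow> 'k \<Rightarrow> nat \<Rightarrow> complex"
  assumes pur: "purification A K \<phi> H \<pi> V" and e: "H.onb e n"
    and b: "b \<in> {..<N} \<rightarrow> carrier A" and x: "x \<in> {..<N} \<rightarrow> carrier K"
    and span: "\<And>a y F. a \<in> carrier A \<Longrightarrow> y \<in> carrier K \<Longrightarrow> bilinear_form A K F \<Longrightarrow>
      F a y = (\<Sum>p<N. c a y p * F (b p) (x p))"
begin

lemma closed [simp]:
  "p < N \<Longrightarrow> b p \<in> carrier A" "p < N \<Longrightarrow> x p \<in> carrier K" "i < n \<Longrightarrow> e i \<in> carrier H"
  "\<one> \<in> carrier A" "a \<in> carrier A \<Longrightarrow> d \<in> carrier A \<Longrightarrow> a \<otimes> d \<in> carrier A"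
  using b x H.onb_closed[OF e] ring.ring_simprules(5,6)[OF ring_A] by auto

lemma V_bounded: "V \<in> bounded_ops K H"
  using pur by (simp add: purification_def)

lemmas V = bounded_opsD[OF V_bounded]

lemma hom: "star_hom A (op_algebra H) \<pi>"
  using pur by (simp add: purification_def)

lemma pi_bounded: "a \<in> carrier A \<Longrightarrow> \<pi> a \<in> bounded_ops H H"
  using hom by (auto simp: star_hom_def linear_map_def)

lemmas pi_op = bounded_opsD(1,3-5)[OF pi_bounded]

lemma pi_mult: "a \<in> carrier A \<Longrightarrow> d \<in> carrier A \<Longrightarrow> h \<in> carrier H \<Longrightarrow> \<pi> (a \<otimes> d) h = \<pi> a (\<pi> d h)"
  using hom by (auto simp: star_hom_def ring_hom_def compose_eq)

lemma pi_add: "a \<in> carrier A \<Longrightarrow> d \<in> carrier A \<Longrightarrow> h \<in> carrier H \<Longrightarrow> \<pi> (a \<oplus> d) h = \<pi> a h \<oplus>\<^bsub>H\<^esub> \<pi> d h"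
  using hom by (auto simp: star_hom_def linear_map_def)

lemma pi_smult: "a \<in> carrier A \<Longrightarrow> h \<in> carrier H \<Longrightarrow> \<pi> (s \<odot> a) h = s \<odot>\<^bsub>H\<^esub> \<pi> a h"
  using hom by (auto simp: star_hom_def linear_map_def)

lemma pi_one: "h \<in> carrier H \<Longrightarrow> \<pi> \<one> h = h"
  using hom by (auto simp: star_hom_def ring_hom_def)

lemma cinner_pi:
  assumes a: "a \<in> carrier A" and h: "h \<in> carrier H" and g: "g \<in> carrier H"
  shows "cinner H (\<pi> a h) g = cinner H h (\<pi> (star A a) g)"
proof -
  have "\<pi> (star A a) = hadjoint H H (\<pi> a)"
    using hom a by (simp add: star_hom_def)
  then have "cinner H (\<pi> (star A a) g) h = cinner H g (\<pi> a h)"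
    using cinner_hadjoint[OF H.fin_hilbert_space H.fin_hilbert_space pi_op(1)[OF a] g h] by simp
  then show ?thesis
    using H.cinner_commute[OF pi_op(2)[OF star_closed[OF a] g] h] H.cinner_commute[OF g pi_op(2)[OF a h]]
    by simp
qed

text \<open>Moving \<open>\<pi> a\<close> and \<open>V\<close> to the other side leaves
  \<open>\<phi> (star A a \<otimes> d)\<close>. The inner products are therefore determined by
  \<open>\<phi>\<close>, which is why two purifications have equal Gram matrices.\<close>

lemma cinner_pi_V:
  assumes a: "a \<in> carrier A" and d: "d \<in> carrier A" and y: "y \<in> carrier K" and z: "z \<in> carrier K"
  shows "cinner H (\<pi> a (V y)) (\<pi> d (V z)) = ker a y d z"
proof -
  let ?s = "star A a \<otimes> d"
  have s: "?s \<in> carrier A" using a d star_closed by simp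
  have "cinner H (\<pi> a (V y)) (\<pi> d (V z)) = cinner H (V y) (\<pi> ?s (V z))"
    using a d y z by (simp add: cinner_pi V(3) pi_op pi_mult star_closed)
  also have "\<dots> = cnj (cinner H (\<pi> ?s (V z)) (V y))"
    by (rule H.cinner_commute) (use s y z in \<open>simp_all add: V(3) pi_op\<close>)
  also have "cinner H (\<pi> ?s (V z)) (V y) = cinner K (hadjoint K H V (\<pi> ?s (V z))) y"
    by (rule cinner_hadjoint[OF K.fin_hilbert_space H.fin_hilbert_space V(1) _ y, symmetric])
      (use s z in \<open>simp add: V(3) pi_op\<close>)
  also have "hadjoint K H V (\<pi> ?s (V z)) = \<phi> ?s z"
  proof -
    have "compose (carrier K) (hadjoint K H V) (compose (carrier K) (\<pi> ?s) V) = \<phi> ?s"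
      using pur s by (simp add: purification_def)
    from fun_cong[OF this, of z] z show ?thesis by (simp add: compose_eq)
  qed
  also have "cnj (cinner K (\<phi> ?s z) y) = ker a y d z"
    using K.cinner_commute[OF phi_op(1)[OF s z] y] by (simp add: ker_def)
  finally show ?thesis .
qed

definition X :: cmat where
  "X = finite_cmat n N (\<lambda>i p. cinner H (e i) (\<pi> (b p) (V (x p))))"

definition P :: "'a \<Rightarrow> cmat" where
  "P a = finite_cmat n n (\<lambda>i j. cinner H (e i) (\<pi> a (e j)))"

lemma bilinear_coord: "i < n \<Longrightarrow> bilinear_form A K (\<lambda>a y. cinner H (e i) (\<pi> a (V y)))"
  by (auto simp: bilinear_form_def linear_functional_def V pi_op pi_add pi_smult
      H.cinner_add_right H.cinner_smult_right)

lemma adj_X_X: "adj X * X = finite_cmat N N (\<lambda>p q. ker (b p) (x p) (b q) (x q))"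
proof (rule cmat_eqI)
  fix p q
  have "entry (adj X * X) p q = (\<Sum>i<n. cnj (entry X i p) * entry X i q)"
    by (subst entry_times_sum[of "{..<n}"]) (auto simp: X_def)
  also have "\<dots> = (if p < N \<and> q < N then cinner H (\<pi> (b p) (V (x p))) (\<pi> (b q) (V (x q))) else 0)"
  proof (cases "p < N \<and> q < N")
    case True
    then show ?thesis
      by (simp add: X_def V(3) pi_op H.parseval[OF e, of "\<pi> (b p) (V (x p))" "\<pi> (b q) (V (x q))"])
  qed (auto simp: X_def)
  finally show "entry (adj X * X) p q = entry (finite_cmat N N (\<lambda>p q. ker (b p) (x p) (b q) (x q))) p q"
    by (simp add: cinner_pi_V)
qed

lemma adj_P:
  assumes a: "a \<in> carrier A"
  shows "adj (P a) = P (star A a)"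
proof (rule cmat_eqI)
  fix i j
  have "cnj (cinner H (e j) (\<pi> a (e i))) = cinner H (e i) (\<pi> (star A a) (e j))" if "i < n" "j < n"
    using that a cinner_pi[of a "e i" "e j"] H.cinner_commute[of "e j" "\<pi> a (e i)"] by (simp add: pi_op)
  then show "entry (adj (P a)) i j = entry (P (star A a)) i j" by (simp add: P_def)
qed

lemma coord_pi:
  assumes "a \<in> carrier A" "h \<in> carrier H" "i < n"
  shows "cinner H (e i) (\<pi> a h) = (\<Sum>j<n. entry (P a) i j * cinner H (e j) h)"
  using assms
    cinner_linear_map[OF H.pre_hilbert_space_axioms H.pre_hilbert_space_axioms pi_op(1) e, of a h "e i"]
  by (simp add: P_def mult.commute)

text \<open>\<open>\<pi> a\<close> sends column \<open>q\<close> to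
  \<open>\<pi> (a \<otimes> b q) (V (x q))\<close>, which is expanded again in the spanning family.
  The coefficient matrix mentions neither \<open>\<pi>\<close> nor \<open>V\<close>, so it is the
  common \<open>m\<close> that \<open>unitary_of_gram\<close> asks for.\<close>

lemma P_times_X:
  assumes a: "a \<in> carrier A"
  shows "P a * X = X * finite_cmat N N (\<lambda>r q. c (a \<otimes> b q) (x q) r)"
proof (rule cmat_eqI)
  fix i q
  have "entry (P a * X) i q = (\<Sum>j<n. entry (P a) i j * entry X j q)"
    by (rule entry_times_sum) (auto simp: P_def)
  also have "\<dots> = (if i < n \<and> q < N then cinner H (e i) (\<pi> a (\<pi> (b q) (V (x q)))) else 0)"
  proof (cases "i < n \<and> q < N")
    case True
    then show ?thesis
      using a coord_pi[of a "\<pi> (b q) (V (x q))" i] by (auto simp: V(3) pi_op X_def)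
  next
    case False
    then show ?thesis by (auto simp: P_def X_def)
  qed
  also have "\<dots> = (\<Sum>r<N. entry X i r * entry (finite_cmat N N (\<lambda>r q. c (a \<otimes> b q) (x q) r)) r q)"
  proof (cases "i < n \<and> q < N")
    case True
    then have "cinner H (e i) (\<pi> (a \<otimes> b q) (V (x q)))
        = (\<Sum>r<N. c (a \<otimes> b q) (x q) r * cinner H (e i) (\<pi> (b r) (V (x r))))"
      using a by (intro span[OF _ _ bilinear_coord]) auto
    then show ?thesis using True a by (simp add: pi_mult V(3) X_def mult.commute)
  next
    case False
    then show ?thesis by (auto simp: X_def)
  qed
  also have "\<dots> = entry (X * finite_cmat N N (\<lambda>r q. c (a \<otimes> b q) (x q) r)) i q"
    by (rule entry_times_sum[symmetric]) (auto simp: X_def)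
  finally show "entry (P a * X) i q = entry (X * finite_cmat N N (\<lambda>r q. c (a \<otimes> b q) (x q) r)) i q" .
qed

text \<open>Because \<open>V y\<close> equals \<open>\<pi> \<one> (V y)\<close>, it is a combination
  of the columns of \<open>X\<close> with coefficients independent of the purification. Hence a
  matrix taking one \<open>X\<close> to the other also takes \<open>V\<close> to
  \<open>W\<close>.\<close>

lemma coord_V:
  assumes "y \<in> carrier K" "i < n"
  shows "cinner H (e i) (V y) = (\<Sum>r<N. c \<one> y r * entry X i r)"
proof -
  have "cinner H (e i) (\<pi> \<one> (V y)) = (\<Sum>r<N. c \<one> y r * cinner H (e i) (\<pi> (b r) (V (x r))))"
    using assms by (intro span[OF _ _ bilinear_coord]) auto
  then show ?thesis using assms by (simp add: pi_one V(3) X_def)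
qed

text \<open>Zero padding makes \<open>P \<one>\<close> the projection onto the first
  \<open>n\<close> coordinates instead of the unit of \<open>cmat\<close>. Commuting with it is what
  makes a unitary block diagonal.\<close>

lemma entry_P_one: "entry (P \<one>) i j = (if i < n \<and> i = j then 1 else 0)"
  by (auto simp: P_def pi_one H.onb_inner[OF e])

end

lemma purification_unique:
  fixes A :: "('a, 'm) cstar_algebra_scheme" and K :: "('k, 'n) inner_space_scheme"
    and H :: "('h, 'o) inner_space_scheme" and I :: "('i, 'p) inner_space_scheme"
  assumes "cstar_algebra A" "fin_dim A" "hilbert_space K" "fin_dim K" "ocp_map A K \<phi>"
    and H: "fin_dim H" "purification A K \<phi> H \<pi> V"
    and I: "fin_dim I" "purification A K \<phi> I \<rho> W"
    and equiv: "unitarily_equivalent A H \<pi> I \<rho>"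
  shows "\<exists>U. unitary_op H I U \<and> intertwines A H \<pi> I \<rho> U \<and> compose (carrier K) U V = W"
proof -
  interpret A: cstar_algebra A by fact
  interpret K: fin_hilbert_space K by (rule fin_hilbert_spaceI) fact+
  interpret H: fin_hilbert_space H by (rule fin_hilbert_spaceI) (use H in \<open>simp_all add: purification_def\<close>)
  interpret I: fin_hilbert_space I by (rule fin_hilbert_spaceI) (use I in \<open>simp_all add: purification_def\<close>)
  note HI = H.fin_hilbert_space I.fin_hilbert_space
  have mA: "module complex_field A" by (rule cstar_algebra.axioms(2)[OF assms(1)])
  obtain N :: nat and b x where bx: "b \<in> {..<N} \<rightarrow> carrier A" "x \<in> {..<N} \<rightarrow> carrier K"
    and span: "\<And>a y. a \<in> carrier A \<Longrightarrow> y \<in> carrier K \<Longrightarrow>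
      \<exists>c. \<forall>F. bilinear_form A K F \<longrightarrow> F a y = (\<Sum>p<N. c p * F (b p) (x p))"
    by (rule tensor_generators[OF mA assms(2) K.module_axioms assms(4)]) (rule that, assumption+)
  define c where "c a y = (SOME c. \<forall>F. bilinear_form A K F \<longrightarrow> F a y = (\<Sum>p<N. c p * F (b p) (x p)))" for a y
  have c: "F a y = (\<Sum>p<N. c a y p * F (b p) (x p))"
    if "a \<in> carrier A" "y \<in> carrier K" "bilinear_form A K F" for a y F
    using someI_ex[OF span[OF that(1,2)]] that(3) unfolding c_def by blast
  obtain S where S: "unitary_op H I S" "intertwines A H \<pi> I \<rho> S"
    using equiv unfolding unitarily_equivalent_def by blast
  have "S \<in> bounded_ops H I" using S by (simp add: unitary_op_def)
  note Sb = bounded_opsD[OF this]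
  obtain e n where e: "H.onb e n" using H.onb_exists[OF H.fin_dim] .
  \<comment> \<open>Transporting the basis also makes the two bases equally long, so square matrices
    describe operators from \<open>H\<close> to \<open>I\<close>.\<close>
  define f where "f i = S (e i)" for i
  have f: "I.onb f n" unfolding f_def by (rule unitary_onb[OF HI S(1) e])
  have cp: "cp_map A K \<phi>"
    using assms(5) by unfold_locales (auto simp: ocp_map_def)
  interpret h: purified A K \<phi> H \<pi> V e n N b x c
    using cp H.fin_hilbert_space H(2) e bx c
    by (intro purified.intro purified_axioms.intro)
  interpret i: purified A K \<phi> I \<rho> W f n N b x c
    using cp I.fin_hilbert_space I(2) f bx c
    by (intro purified.intro purified_axioms.intro)
  have bases: "two_bases H I e f n" by unfold_locales (fact e f)+
  interpret two_bases H I e f n by (rule bases)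
  have P: "i.P a = h.P a" if a: "a \<in> carrier A" for a
  proof (rule cmat_eqI)
    fix k l
    have "cinner I (f k) (\<rho> a (f l)) = cinner H (e k) (\<pi> a (e l))" if "k < n" "l < n"
    proof -
      have "compose (carrier H) S (\<pi> a) = compose (carrier H) (\<rho> a) S"
        using S(2) a by (simp add: intertwines_def)
      from fun_cong[OF this, of "e l"] have "\<rho> a (f l) = S (\<pi> a (e l))"
        using that by (simp add: compose_eq f_def)
      then show ?thesis
        using that a by (simp add: f_def unitary_cinner[OF HI S(1)] h.pi_op)
    qed
    then show "entry (i.P a) k l = entry (h.P a) k l" by (simp add: i.P_def h.P_def)
  qed
  have "\<exists>U. adj U * U = 1 \<and> U * adj U = 1 \<and> U * h.X = i.X \<and> (\<forall>p\<in>h.P ` carrier A. U * p = p * U)"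
  proof (rule unitary_of_gram)
    show "adj h.X * h.X = adj i.X * i.X" by (simp add: h.adj_X_X i.adj_X_X)
    fix p assume "p \<in> h.P ` carrier A"
    then obtain a where a: "a \<in> carrier A" "p = h.P a" by blast
    show "adj p \<in> h.P ` carrier A \<and> (\<exists>m. p * h.X = h.X * m \<and> p * i.X = i.X * m)"
      using h.adj_P[OF a(1)] A.star_closed[OF a(1)] h.P_times_X[OF a(1)] i.P_times_X[OF a(1)] P[OF a(1)] a(2)
      by auto
  qed
  then obtain U where U: "adj U * U = 1" "U * adj U = 1" "U * h.X = i.X"
    and comm: "\<And>a. a \<in> carrier A \<Longrightarrow> U * h.P a = h.P a * U" by blast
  have left: "entry (h.P a * U) k l = (\<Sum>j<n. entry (h.P a) k j * entry U j l)" for a k l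
    by (rule entry_times_sum) (auto simp: h.P_def)
  have right: "entry (U * h.P a) k l = (\<Sum>j<n. entry U k j * entry (h.P a) j l)" for a k l
    by (rule entry_times_sum) (auto simp: h.P_def)
  \<comment> \<open>Comparing \<open>U * P \<one>\<close> with \<open>P \<one> * U\<close> entrywise
    annihilates the entries with exactly one index below \<open>n\<close>.\<close>
  have block: "entry U k l = 0 \<and> entry U l k = 0" if "k < n" "n \<le> l" for k l
  proof -
    have "entry (U * h.P \<one>\<^bsub>A\<^esub>) k' l' = (if l' < n then entry U k' l' else 0)" for k' l'
      by (subst entry_times_sum[of "{l'}"]) (auto simp: h.entry_P_one)
    moreover have "entry (h.P \<one>\<^bsub>A\<^esub> * U) k' l' = (if k' < n then entry U k' l' else 0)" for k' l'
      by (subst entry_times_sum[of "{k'}"]) (auto simp: h.entry_P_one)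
    ultimately have "(if l' < n then entry U k' l' else 0) = (if k' < n then entry U k' l' else 0)" for k' l'
      using comm[OF h.closed(4)] by metis
    from this[of k l] this[of l k] that show ?thesis by (auto split: if_splits)
  qed
  let ?T = "matrix_op H I e f n (entry U)"
  have "unitary_op H I ?T" by (rule unitary_matrix_op[OF bases U(1,2) block])
  moreover have "intertwines A H \<pi> I \<rho> ?T"
    unfolding intertwines_def
  proof
    fix a assume a: "a \<in> carrier A"
    have "?T (\<pi> a y) = \<rho> a (?T y)" if y: "y \<in> carrier H" for y
    proof (rule I.onb_eqI[OF f])
      show "?T (\<pi> a y) \<in> carrier I" "\<rho> a (?T y) \<in> carrier I"
        using a y by (simp_all add: matrix_op_closed h.pi_op i.pi_op)
      fix k assume k: "k < n"
      have "cinner I (f k) (?T (\<pi> a y)) = (\<Sum>j<n. \<Sum>l<n. entry U k j * entry (h.P a) j l * cinner H (e l) y)"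
        using a y k by (simp add: coord_matrix_op h.pi_op h.coord_pi sum_distrib_left mult.assoc)
      also have "\<dots> = (\<Sum>l<n. entry (U * h.P a) k l * cinner H (e l) y)"
        unfolding right sum_distrib_right by (rule sum.swap)
      also have "\<dots> = (\<Sum>l<n. entry (h.P a * U) k l * cinner H (e l) y)" by (simp add: comm[OF a])
      also have "\<dots> = (\<Sum>j<n. \<Sum>l<n. entry (h.P a) k j * entry U j l * cinner H (e l) y)"
        unfolding left sum_distrib_right by (rule sum.swap)
      also have "\<dots> = cinner I (f k) (\<rho> a (?T y))"
        using a y k by (simp add: coord_matrix_op matrix_op_closed i.coord_pi P sum_distrib_left mult.assoc)
      finally show "cinner I (f k) (?T (\<pi> a y)) = cinner I (f k) (\<rho> a (?T y))" .
    qed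
    then show "compose (carrier H) ?T (\<pi> a) = compose (carrier H) (\<rho> a) ?T"
      by (auto simp: compose_def)
  qed
  moreover have "compose (carrier K) ?T V = W"
  proof (rule extensionalityI[of _ "carrier K"])
    show "W \<in> extensional (carrier K)" by (rule i.V(2))
    fix y assume y: "y \<in> carrier K"
    have "?T (V y) = W y"
    proof (rule I.onb_eqI[OF f])
      show "?T (V y) \<in> carrier I" "W y \<in> carrier I"
        using y by (simp_all add: matrix_op_closed h.V(3) i.V(3))
      fix k assume k: "k < n"
      have "cinner I (f k) (?T (V y)) = (\<Sum>j<n. \<Sum>r<N. c \<one>\<^bsub>A\<^esub> y r * (entry U k j * entry h.X j r))"
        using y k by (simp add: coord_matrix_op h.V(3) h.coord_V sum_distrib_left mult.left_commute)
      also have "\<dots> = (\<Sum>r<N. c \<one>\<^bsub>A\<^esub> y r * (\<Sum>j<n. entry U k j * entry h.X j r))"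
        unfolding sum_distrib_left by (rule sum.swap)
      also have "\<dots> = (\<Sum>r<N. c \<one>\<^bsub>A\<^esub> y r * entry (U * h.X) k r)"
        by (intro sum.cong refl arg_cong2[where f = "(*)"] entry_times_sum[symmetric]) (auto simp: h.X_def)
      also have "\<dots> = cinner I (f k) (W y)" using y k by (simp add: U(3) i.coord_V)
      finally show "cinner I (f k) (?T (V y)) = cinner I (f k) (W y)" .
    qed
    then show "compose (carrier K) ?T V y = W y" using y by (simp add: compose_eq)
  qed simp
  ultimately show ?thesis by blast
qed

theorem corollary7p38:
  fixes A :: "'a cstar_algebra" and K :: "'k inner_space" and \<phi> :: "'a \<Rightarrow> 'k \<Rightarrow> 'k"
  assumes "cstar_algebra A" and "fin_dim A"
    and "hilbert_space K" and "fin_dim K"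
    and "ocp_map A K \<phi>"
  shows "(\<exists>(H :: (nat \<Rightarrow> complex) inner_space) \<pi> V. fin_dim H \<and> purification A K \<phi> H \<pi> V) \<and>
    (\<forall>(H :: 'h inner_space) \<pi> V (I :: 'i inner_space) \<rho> W.
       fin_dim H \<and> purification A K \<phi> H \<pi> V \<and>
       fin_dim I \<and> purification A K \<phi> I \<rho> W \<and>
       unitarily_equivalent A H \<pi> I \<rho> \<longrightarrow>
       (\<exists>U. unitary_op H I U \<and> intertwines A H \<pi> I \<rho> U \<and> compose (carrier K) U V = W))"
  using purification_exists[OF assms] purification_unique[OF assms] by blast

end
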